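(* Let $\mathfrak k$ be a field, $n\ge 1$ an integer, and let $q\in\mathfrak k^*$ satisfy $q^2\ne 1$ and $[k]_q\neq 0$ for $2\le k\le n+1$. Let $A_{n+1}$ be either the Hecke algebra $H_{n+1}(q)$, or the Birman–Murakami–Wenzl algebra $BMW_{n+1}(q,\nu)$ with $\nu\in\mathfrak k\setminus\{0,q,-q^{-1}\}$ and $\nu\ne q^{2j-1}$ for $1\le j\le n$. Then: (a) in $A_{n+1}$ the multiplicative 1-shuffle satisfies $$({}^{q}\mathrm{Sh}_{1,n})^n\,\bigl({}^{q}\mathrm{Sh}_{1,n}-[n+1]_q!\bigr)=0,$$ and $t^n(t-[n+1]_q!)$ is the minimal polynomial of ${}^{q}\mathrm{Sh}_{1,n}$ (already in the Hecke algebra $H_{n+1}(q)$); (b) for $n>1$ the element ${}^{q}\mathrm{Sh}_{1,n}$ is not semi-simple; its semi-simple part is $[n+1]_q!\,S_{n+1}$; (c) for the operator of left multiplication by ${}^{q}\mathrm{Sh}_{1,n}$ on $H_{n+1}(q)$ the eigenvalue $[n+1]_q!$ is simple (has multiplicity one).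
   Context: Notation: $[n]_q=(q^n-q^{-n})/(q-q^{-1})$, $[n]_q!=[1]_q[2]_q\cdots[n]_q$. $B_n$ is the braid group with generators $\sigma_1,\dots,\sigma_{n-1}$ and relations $\sigma_i\sigma_j\sigma_i=\sigma_j\sigma_i\sigma_j$ for $|i-j|=1$, $\sigma_i\sigma_j=\sigma_j\sigma_i$ for $|i-j|>1$. $H_n(q)$ is the quotient of $\mathfrak k B_n$ by $\sigma_i^2=(q-q^{-1})\sigma_i+1$. $BMW_n(q,\nu)$ is the quotient of $\mathfrak kB_n$ by $\kappa_i\sigma_i=\sigma_i\kappa_i=\nu\kappa_i$, $\kappa_i\sigma_{i-1}\kappa_i=\nu^{-1}\kappa_i$, $\kappa_i\sigma_{i-1}^{-1}\kappa_i=\nu\kappa_i$, where $\kappa_i$ is defined by $\sigma_i-\sigma_i^{-1}=(q-q^{-1})(1-\kappa_i)$. Baxterized elements: in the Hecke algebra, $\sigma_i(x)=\frac{1}{q-q^{-1}}(x\sigma_i-x^{-1}\sigma_i^{-1})$; in the BMW algebra, $$\sigma_i(x)=x^{-1}\Bigl(1+\frac{x^2-1}{q-q^{-1}}\sigma_i+\frac{x^2-1}{1-\nu^{-1}q^{-1}x^2}\kappa_i\Bigr).$$ These satisfy (known) $\sigma_i(x)\sigma_{i-1}(xy)\sigma_i(y)=\sigma_{i-1}(y)\sigma_i(xy)\sigma_{i-1}(x)$. ${}^{q}\mathrm{Sh}_{1,n}=\sigma_1(q)\sigma_2(q^2)\cdots\sigma_n(q^n)$. The symmetrizer $S_{n+1}$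 is the unique non-zero element of $A_{n+1}$ with $\sigma_iS_{n+1}=S_{n+1}\sigma_i=qS_{n+1}$ for $i=1,\dots,n$ and $S_{n+1}^2=S_{n+1}$. "Semi-simple part" refers to the additive Jordan decomposition of an element of a finite-dimensional algebra (equivalently of the corresponding left multiplication operator). *)

theory Defs
  imports
    "HOL-Algebra.QuotRing"
    "HOL-Library.Poly_Mapping"
    "HOL-Computational_Algebra.Polynomial"
    "Jordan_Normal_Form.VS_Connect"
begin

section \<open>Quantum integers\<close>

definition qnum :: "'k::field \<Rightarrow> nat \<Rightarrow> 'k" where
  "qnum q k = (q ^ k - inverse q ^ k) / (q - inverse q)"

definition qfact :: "'k::field \<Rightarrow> nat \<Rightarrow> 'k" where
  "qfact q m = (\<Prod>k = 1..m. qnum q k)"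


section \<open>Braid groups\<close>

text \<open>A letter \<open>(i, True)\<close> stands for \<open>\<sigma>\<^sub>i\<close> and \<open>(i, False)\<close> for its inverse; an element of the braid
  group is an equivalence class of words.\<close>

type_synonym braid_word = "(nat \<times> bool) list"
type_synonym braid = "braid_word set"

definition braid_words :: "nat \<Rightarrow> braid_word set" where
  "braid_words n = lists ({1..<n} \<times> UNIV)"

inductive braid_eq :: "nat \<Rightarrow> braid_word \<Rightarrow> braid_word \<Rightarrow> bool" for n where
  refl: "w \<in> braid_words n \<Longrightarrow> braid_eq n w w"
| sym: "braid_eq n u v \<Longrightarrow> braid_eq n v u"
| trans: "braid_eq n u v \<Longrightarrow> braid_eq n v w \<Longrightarrow> braid_eq n u w"
| append: "braid_eq n u u' \<Longrightarrow> braid_eq n v v' \<Longrightarrow> braid_eq n (u @ v) (u' @ v')"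
| cancel: "i \<in> {1..<n} \<Longrightarrow> braid_eq n [(i, b), (i, \<not> b)] []"
| braid: "i \<in> {1..<n} \<Longrightarrow> j \<in> {1..<n} \<Longrightarrow> \<bar>int i - int j\<bar> = 1 \<Longrightarrow>
    braid_eq n [(i, True), (j, True), (i, True)] [(j, True), (i, True), (j, True)]"
| far: "i \<in> {1..<n} \<Longrightarrow> j \<in> {1..<n} \<Longrightarrow> \<bar>int i - int j\<bar> > 1 \<Longrightarrow>
    braid_eq n [(i, True), (j, True)] [(j, True), (i, True)]"

definition braid_class :: "nat \<Rightarrow> braid_word \<Rightarrow> braid" where
  "braid_class n w = {v. braid_eq n w v}"

definition braid_group :: "nat \<Rightarrow> braid monoid" where
  "braid_group n =
    \<lparr> carrier = braid_class n ` braid_words n,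
      mult = (\<lambda>X Y. \<Union>u\<in>X. \<Union>v\<in>Y. braid_class n (u @ v)),
      one = braid_class n [] \<rparr>"


section \<open>Group algebras and quotient algebras\<close>

definition group_algebra :: "('g, 'm) monoid_scheme \<Rightarrow> ('k::field, 'g \<Rightarrow>\<^sub>0 'k) module" where
  "group_algebra G =
    \<lparr> carrier = {f. Poly_Mapping.keys f \<subseteq> carrier G},
      mult = (\<lambda>f g. \<Sum>a\<in>Poly_Mapping.keys f. \<Sum>b\<in>Poly_Mapping.keys g.
        Poly_Mapping.single (a \<otimes>\<^bsub>G\<^esub> b) (Poly_Mapping.lookup f a * Poly_Mapping.lookup g b)),
      one = Poly_Mapping.single \<one>\<^bsub>G\<^esub> 1,
      zero = 0,
      add = (+),
      smult = (\<lambda>c f. Poly_Mapping.map ((*) c) f) \<rparr>"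

definition quotient_algebra :: "('k, 'a) module \<Rightarrow> 'a set \<Rightarrow> ('k, 'a set) module" where
  "quotient_algebra A I =
    \<lparr> carrier = carrier (A Quot I),
      mult = mult (A Quot I),
      one = one (A Quot I),
      zero = zero (A Quot I),
      add = add (A Quot I),
      smult = (\<lambda>c X. \<Union>x\<in>X. I +>\<^bsub>A\<^esub> (c \<odot>\<^bsub>A\<^esub> x)) \<rparr>"

definition braid_algebra :: "nat \<Rightarrow> ('k::field, braid \<Rightarrow>\<^sub>0 'k) module" where
  "braid_algebra n = group_algebra (braid_group n)"

definition braid_gen :: "nat \<Rightarrow> nat \<Rightarrow> (braid \<Rightarrow>\<^sub>0 'k::field)" where
  "braid_gen n i = Poly_Mapping.single (braid_class n [(i, True)]) 1"


section \<open>Hecke algebras\<close>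

definition hecke_ideal :: "'k::field \<Rightarrow> nat \<Rightarrow> (braid \<Rightarrow>\<^sub>0 'k) set" where
  "hecke_ideal q n = (let B = braid_algebra n; s = braid_gen n in
    Idl\<^bsub>B\<^esub> {s i \<otimes>\<^bsub>B\<^esub> s i \<ominus>\<^bsub>B\<^esub> ((q - inverse q) \<odot>\<^bsub>B\<^esub> s i \<oplus>\<^bsub>B\<^esub> \<one>\<^bsub>B\<^esub>) | i. i \<in> {1..<n}})"

definition hecke_algebra :: "'k::field \<Rightarrow> nat \<Rightarrow> ('k, (braid \<Rightarrow>\<^sub>0 'k) set) module" where
  "hecke_algebra q n = quotient_algebra (braid_algebra n) (hecke_ideal q n)"

definition hecke_sigma :: "'k::field \<Rightarrow> nat \<Rightarrow> nat \<Rightarrow> (braid \<Rightarrow>\<^sub>0 'k) set" where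
  "hecke_sigma q n i = hecke_ideal q n +>\<^bsub>braid_algebra n\<^esub> braid_gen n i"

definition hecke_baxter :: "'k::field \<Rightarrow> nat \<Rightarrow> nat \<Rightarrow> 'k \<Rightarrow> (braid \<Rightarrow>\<^sub>0 'k) set" where
  "hecke_baxter q n i x = (let H = hecke_algebra q n; s = hecke_sigma q n in
    (1 / (q - inverse q)) \<odot>\<^bsub>H\<^esub>
      (x \<odot>\<^bsub>H\<^esub> s i \<ominus>\<^bsub>H\<^esub> inverse x \<odot>\<^bsub>H\<^esub> (inv\<^bsub>H\<^esub> (s i))))"


section \<open>Birman--Murakami--Wenzl algebras\<close>

text \<open>\<open>\<sigma>\<^sub>i - \<sigma>\<^sub>i\<inverse> = (q - q\<inverse>)(1 - \<kappa>\<^sub>i)\<close> solved for \<open>\<kappa>\<^sub>i\<close>, in any algebra \<open>A\<close> with elements \<open>s i\<close>.\<close>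

definition kappa :: "('k::field, 'a) module \<Rightarrow> (nat \<Rightarrow> 'a) \<Rightarrow> 'k \<Rightarrow> nat \<Rightarrow> 'a" where
  "kappa A s q i =
    \<one>\<^bsub>A\<^esub> \<ominus>\<^bsub>A\<^esub> (1 / (q - inverse q)) \<odot>\<^bsub>A\<^esub> (s i \<ominus>\<^bsub>A\<^esub> inv\<^bsub>A\<^esub> (s i))"

definition bmw_ideal :: "'k::field \<Rightarrow> 'k \<Rightarrow> nat \<Rightarrow> (braid \<Rightarrow>\<^sub>0 'k) set" where
  "bmw_ideal q \<nu> n = (let B = braid_algebra n; s = braid_gen n; \<kappa> = kappa B s q in
    Idl\<^bsub>B\<^esub>
      ({\<kappa> i \<otimes>\<^bsub>B\<^esub> s i \<ominus>\<^bsub>B\<^esub> \<nu> \<odot>\<^bsub>B\<^esub> \<kappa> i | i. i \<in> {1..<n}} \<union>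
       {s i \<otimes>\<^bsub>B\<^esub> \<kappa> i \<ominus>\<^bsub>B\<^esub> \<nu> \<odot>\<^bsub>B\<^esub> \<kappa> i | i. i \<in> {1..<n}} \<union>
       {\<kappa> i \<otimes>\<^bsub>B\<^esub> s (i - 1) \<otimes>\<^bsub>B\<^esub> \<kappa> i \<ominus>\<^bsub>B\<^esub> inverse \<nu> \<odot>\<^bsub>B\<^esub> \<kappa> i | i. i \<in> {2..<n}} \<union>
       {\<kappa> i \<otimes>\<^bsub>B\<^esub> inv\<^bsub>B\<^esub> (s (i - 1)) \<otimes>\<^bsub>B\<^esub> \<kappa> i \<ominus>\<^bsub>B\<^esub> \<nu> \<odot>\<^bsub>B\<^esub> \<kappa> i | i. i \<in> {2..<n}}))"

definition bmw_algebra :: "'k::field \<Rightarrow> 'k \<Rightarrow> nat \<Rightarrow> ('k, (braid \<Rightarrow>\<^sub>0 'k) set) module" where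
  "bmw_algebra q \<nu> n = quotient_algebra (braid_algebra n) (bmw_ideal q \<nu> n)"

definition bmw_sigma :: "'k::field \<Rightarrow> 'k \<Rightarrow> nat \<Rightarrow> nat \<Rightarrow> (braid \<Rightarrow>\<^sub>0 'k) set" where
  "bmw_sigma q \<nu> n i = bmw_ideal q \<nu> n +>\<^bsub>braid_algebra n\<^esub> braid_gen n i"

definition bmw_baxter :: "'k::field \<Rightarrow> 'k \<Rightarrow> nat \<Rightarrow> nat \<Rightarrow> 'k \<Rightarrow> (braid \<Rightarrow>\<^sub>0 'k) set" where
  "bmw_baxter q \<nu> n i x = (let A = bmw_algebra q \<nu> n; s = bmw_sigma q \<nu> n in
    inverse x \<odot>\<^bsub>A\<^esub>
      (\<one>\<^bsub>A\<^esub> \<oplus>\<^bsub>A\<^esub> ((x\<^sup>2 - 1) / (q - inverse q)) \<odot>\<^bsub>A\<^esub> s i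
       \<oplus>\<^bsub>A\<^esub> ((x\<^sup>2 - 1) / (1 - inverse \<nu> * inverse q * x\<^sup>2)) \<odot>\<^bsub>A\<^esub> kappa A s q i))"


section \<open>Multiplicative shuffles and symmetrizers\<close>

definition shuffle :: "('k::field, 'a) module \<Rightarrow> (nat \<Rightarrow> 'k \<Rightarrow> 'a) \<Rightarrow> 'k \<Rightarrow> nat \<Rightarrow> 'a" where
  "shuffle A bax q n = foldr (\<lambda>i y. bax i (q ^ i) \<otimes>\<^bsub>A\<^esub> y) [1..<n + 1] \<one>\<^bsub>A\<^esub>"

definition hecke_shuffle :: "'k::field \<Rightarrow> nat \<Rightarrow> (braid \<Rightarrow>\<^sub>0 'k) set" where
  "hecke_shuffle q n = shuffle (hecke_algebra q (n + 1)) (hecke_baxter q (n + 1)) q n"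

definition bmw_shuffle :: "'k::field \<Rightarrow> 'k \<Rightarrow> nat \<Rightarrow> (braid \<Rightarrow>\<^sub>0 'k) set" where
  "bmw_shuffle q \<nu> n = shuffle (bmw_algebra q \<nu> (n + 1)) (bmw_baxter q \<nu> (n + 1)) q n"

definition symmetrizer :: "('k::field, 'a) module \<Rightarrow> (nat \<Rightarrow> 'a) \<Rightarrow> 'k \<Rightarrow> nat \<Rightarrow> 'a" where
  "symmetrizer A s q n = (THE S. S \<in> carrier A \<and> S \<noteq> \<zero>\<^bsub>A\<^esub> \<and>
    (\<forall>i\<in>{1..n}. s i \<otimes>\<^bsub>A\<^esub> S = q \<odot>\<^bsub>A\<^esub> S \<and> S \<otimes>\<^bsub>A\<^esub> s i = q \<odot>\<^bsub>A\<^esub> S) \<and>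
    S \<otimes>\<^bsub>A\<^esub> S = S)"


section \<open>Minimal polynomials, semi-simplicity and multiplicities\<close>

definition poly_eval :: "('k::field, 'a) module \<Rightarrow> 'k poly \<Rightarrow> 'a \<Rightarrow> 'a" where
  "poly_eval A p a = (\<Oplus>\<^bsub>A\<^esub>i\<in>{..degree p}. poly.coeff p i \<odot>\<^bsub>A\<^esub> (a [^]\<^bsub>A\<^esub> i))"

definition is_minimal_poly :: "('k::field, 'a) module \<Rightarrow> 'a \<Rightarrow> 'k poly \<Rightarrow> bool" where
  "is_minimal_poly A a p \<longleftrightarrow> lead_coeff p = 1 \<and> poly_eval A p a = \<zero>\<^bsub>A\<^esub> \<and>
    (\<forall>r. r \<noteq> 0 \<and> poly_eval A r a = \<zero>\<^bsub>A\<^esub> \<longrightarrow> degree p \<le> degree r)"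

text \<open>An operator is semi-simple if every invariant subspace has an invariant complement; an element
  of an algebra is semi-simple if left multiplication by it is.\<close>

definition invariant_subspace :: "('k::field, 'a) module \<Rightarrow> ('a \<Rightarrow> 'a) \<Rightarrow> 'a set \<Rightarrow> bool" where
  "invariant_subspace V T W \<longleftrightarrow> subspace class_ring W V \<and> T ` W \<subseteq> W"

definition semisimple_operator :: "('k::field, 'a) module \<Rightarrow> ('a \<Rightarrow> 'a) \<Rightarrow> bool" where
  "semisimple_operator V T \<longleftrightarrow> (\<forall>W. invariant_subspace V T W \<longrightarrow>
    (\<exists>U. invariant_subspace V T U \<and> W \<inter> U = {\<zero>\<^bsub>V\<^esub>} \<and> W <+>\<^bsub>V\<^esub> U = carrier V))"

definition semisimple_element :: "('k::field, 'a) module \<Rightarrow> 'a \<Rightarrow> bool" where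
  "semisimple_element A a \<longleftrightarrow> semisimple_operator A (\<lambda>x. a \<otimes>\<^bsub>A\<^esub> x)"

definition jordan_decomposition :: "('k::field, 'a) module \<Rightarrow> 'a \<Rightarrow> 'a \<Rightarrow> 'a \<Rightarrow> bool" where
  "jordan_decomposition A a s m \<longleftrightarrow> s \<in> carrier A \<and> m \<in> carrier A \<and> a = s \<oplus>\<^bsub>A\<^esub> m \<and>
    s \<otimes>\<^bsub>A\<^esub> m = m \<otimes>\<^bsub>A\<^esub> s \<and> semisimple_element A s \<and> (\<exists>k::nat. m [^]\<^bsub>A\<^esub> k = \<zero>\<^bsub>A\<^esub>)"

text \<open>Uniqueness is part of the definition: over an imperfect field it does not follow from the
  existence of a decomposition with this notion of semi-simplicity.\<close>

definition is_semisimple_part :: "('k::field, 'a) module \<Rightarrow> 'a \<Rightarrow> 'a \<Rightarrow> bool" where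
  "is_semisimple_part A a s \<longleftrightarrow> (\<exists>m. jordan_decomposition A a s m) \<and>
    (\<forall>s' m'. jordan_decomposition A a s' m' \<longrightarrow> s' = s)"

text \<open>Algebraic multiplicity, i.e. the dimension of the generalized eigenspace.\<close>

definition generalized_eigenspace :: "('k::field, 'a) module \<Rightarrow> ('a \<Rightarrow> 'a) \<Rightarrow> 'k \<Rightarrow> 'a set" where
  "generalized_eigenspace V T c =
    {v \<in> carrier V. \<exists>k. ((\<lambda>w. T w \<ominus>\<^bsub>V\<^esub> c \<odot>\<^bsub>V\<^esub> w) ^^ k) v = \<zero>\<^bsub>V\<^esub>}"

definition eigenvalue_multiplicity :: "('k::field, 'a) module \<Rightarrow> ('a \<Rightarrow> 'a) \<Rightarrow> 'k \<Rightarrow> nat" where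
  "eigenvalue_multiplicity V T c =
    vectorspace.dim class_ring (V\<lparr>carrier := generalized_eigenspace V T c\<rparr>)"

end

theory Submission
  imports Defs
begin

text \<open>
  Write \<open>Y\<close> for the shuffle and \<open>N\<close> for \<open>[n+1]\<^sub>q!\<close>. If \<open>\<sigma>\<^sub>i x = q x\<close> for all \<open>i \<le> m\<close>, then a single instance of the
  Yang--Baxter equation moves a factor \<open>\<sigma>\<^sub>j(q)\<close> to the left end of \<open>Y x\<close> for every \<open>j \<le> m + 1\<close>, so that
  \<open>\<sigma>\<^sub>j Y x = q Y x\<close> for these \<open>j\<close>. Hence \<open>Y^n\<close> is symmetric from the left and \<open>Y Y^n = N Y^n\<close>. The relations
  are invariant under reversal of words, which gives the statement on the right, and \<open>Y^n = N^n S\<close> for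
  the symmetrizer \<open>S\<close>. In the Burau representation \<open>Y\<close> is a Hessenberg matrix with
  nonzero subdiagonal, so no polynomial of degree at most \<open>n\<close> annihilates it. Since \<open>S\<close> is an idempotent with
  \<open>Y S = S Y = N S\<close> and \<open>S x\<close> is a multiple of \<open>S\<close> for every \<open>x\<close>, the Jordan decomposition is
  \<open>Y = N S + (Y - N S)\<close>, and the eigenvalue \<open>N\<close> is simple.
\<close>

section \<open>Associative algebras over a field\<close>

text \<open>The argument runs once, in any algebra with the relations of
  \<open>bmw_relations\<close>; the Hecke algebra is the case where all \<kappa>_i vanish. The
  dimension of the Birman--Murakami--Wenzl algebra is never computed, so no basis is available:
  collapse comes from the symmetry of \<open>Y^n\<close>, the lower bound from one representation.
  Burau serves both families because \<sigma> - \<sigma>^{-1} acts there as the scalar q - q^{-1};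
  so \<kappa> acts as zero and all relators are killed, whatever \<nu> is.

  The instance of the Yang--Baxter equation is \<sigma>_i(q) \<sigma>_{i-1}(q^i) \<sigma>_i(q^{i-1})
  = \<sigma>_{i-1}(q^{i-1}) \<sigma>_i(q^i) \<sigma>_{i-1}(q). On a vector z with \<sigma>_{i-1} z =
  q z the last factor is the scalar [2]_q, and the image of \<sigma>_i(q) lies in the eigenspace of
  \<sigma>_i for q.

  Symmetry from the right needs care: reversal turns \<open>Y\<close> into the product in the
  opposite order, a different element. Its n-th power nevertheless agrees with \<open>Y^n\<close>,
  as evaluating the product of the two powers in two ways shows.\<close>

locale kalgebra = ring A for A :: "('k::field, 'a) module" (structure) +
  assumes smult_closed [simp, intro]: "x \<in> carrier A \<Longrightarrow> c \<odot> x \<in> carrier A"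
    and smult_add_left: "x \<in> carrier A \<Longrightarrow> (c + d) \<odot> x = c \<odot> x \<oplus> d \<odot> x"
    and smult_add_right: "x \<in> carrier A \<Longrightarrow> y \<in> carrier A \<Longrightarrow> c \<odot> (x \<oplus> y) = c \<odot> x \<oplus> c \<odot> y"
    and smult_smult: "x \<in> carrier A \<Longrightarrow> c \<odot> (d \<odot> x) = (c * d) \<odot> x"
    and smult_one [simp]: "x \<in> carrier A \<Longrightarrow> 1 \<odot> x = x"
    and mult_smult_left: "x \<in> carrier A \<Longrightarrow> y \<in> carrier A \<Longrightarrow> (c \<odot> x) \<otimes> y = c \<odot> (x \<otimes> y)"
    and mult_smult_right: "x \<in> carrier A \<Longrightarrow> y \<in> carrier A \<Longrightarrow> x \<otimes> (c \<odot> y) = c \<odot> (x \<otimes> y)"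
begin

lemma smult_zero_left [simp]:
  assumes "x \<in> carrier A" shows "0 \<odot> x = \<zero>"
proof -
  have "0 \<odot> x \<oplus> 0 \<odot> x = 0 \<odot> x"
    using smult_add_left[OF assms, of 0 0] by simp
  then show ?thesis
    using assms by (metis add.l_cancel_one smult_closed)
qed

lemma smult_zero_right [simp]: "c \<odot> \<zero> = \<zero>"
  using smult_smult[of \<zero> c 0] by simp

lemma smult_uminus_left:
  assumes "x \<in> carrier A" shows "(- c) \<odot> x = \<ominus> (c \<odot> x)"
proof -
  have "(- c) \<odot> x \<oplus> c \<odot> x = \<zero>"
    using smult_add_left[OF assms, of "- c" c] assms by simp
  then show ?thesis
    using assms by (simp add: minus_equality)
qed

lemma uminus_eq_smult: "x \<in> carrier A \<Longrightarrow> \<ominus> x = (- 1) \<odot> x"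
  by (simp add: smult_uminus_left)

lemma minus_eq_smult: "x \<in> carrier A \<Longrightarrow> y \<in> carrier A \<Longrightarrow> x \<ominus> y = x \<oplus> (- 1) \<odot> y"
  by (simp add: smult_uminus_left minus_eq)

lemma add_diff_left: "x \<in> carrier A \<Longrightarrow> y \<in> carrier A \<Longrightarrow> (x \<oplus> y) \<ominus> x = y"
  by algebra

lemma smult_eq_zeroD:
  assumes "c \<odot> x = \<zero>" "x \<in> carrier A" "c \<noteq> 0" shows "x = \<zero>"
proof -
  have "x = (inverse c * c) \<odot> x" using assms by simp
  also have "\<dots> = inverse c \<odot> (c \<odot> x)" using assms(2) by (rule smult_smult[symmetric])
  finally show ?thesis using assms by simp
qed

lemma smult_left_eqD:
  assumes "c \<odot> x = d \<odot> x" "x \<in> carrier A" "c \<noteq> d" shows "x = \<zero>"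
proof (rule smult_eq_zeroD)
  show "(c - d) \<odot> x = \<zero>"
    using smult_add_left[of x c "- d"] assms
    by (simp add: smult_uminus_left r_neg)
qed (use assms in auto)

lemma smult_right_cancel:
  assumes "c \<odot> x = c \<odot> y" "x \<in> carrier A" "y \<in> carrier A" "c \<noteq> 0" shows "x = y"
proof -
  have "(inverse c * c) \<odot> x = (inverse c * c) \<odot> y"
    using assms by (metis smult_smult)
  then show ?thesis using assms by simp
qed

lemmas to_smult = minus_eq_smult uminus_eq_smult
lemmas expand = l_distr r_distr smult_add_left smult_add_right smult_smult
  mult_smult_left mult_smult_right m_assoc a_assoc

lemma vectorspace: "vectorspace class_ring A"
proof -
  have "module class_ring A"
    by (rule moduleI)
      (use is_abelian_group class_field[where ?'a='k] in
        \<open>auto simp: smult_add_left smult_add_right smult_smult class_ring_simps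
          field_def domain_def\<close>)
  then show ?thesis
    by (simp add: vectorspace_def class_field)
qed

lemma subspace_iff:
  "subspace class_ring W A \<longleftrightarrow> W \<subseteq> carrier A \<and> \<zero> \<in> W \<and>
    (\<forall>x\<in>W. \<forall>y\<in>W. x \<oplus> y \<in> W) \<and> (\<forall>c. \<forall>x\<in>W. c \<odot> x \<in> W)"
  using vectorspace
  by (auto simp: subspace_def LinearCombinations.submodule_def vectorspace_def class_ring_simps)

section \<open>Commuting and nilpotent elements\<close>

definition comm :: "'a \<Rightarrow> 'a \<Rightarrow> bool" where
  "comm x y \<longleftrightarrow> x \<otimes> y = y \<otimes> x"

lemma comm_sym: "comm x y \<Longrightarrow> comm y x" by (simp add: comm_def)
lemma comm_refl [simp]: "comm x x" by (simp add: comm_def)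

lemma comm_one [simp]: "x \<in> carrier A \<Longrightarrow> comm x \<one>"
  by (simp add: comm_def)

lemma comm_mult:
  assumes "comm x y" "comm x z" "x \<in> carrier A" "y \<in> carrier A" "z \<in> carrier A"
  shows "comm x (y \<otimes> z)"
  using assms by (metis comm_def m_assoc)

lemma comm_add:
  assumes "comm x y" "comm x z" "x \<in> carrier A" "y \<in> carrier A" "z \<in> carrier A"
  shows "comm x (y \<oplus> z)"
  using assms by (simp add: comm_def l_distr r_distr)

lemma comm_smult:
  assumes "comm x y" "x \<in> carrier A" "y \<in> carrier A"
  shows "comm x (c \<odot> y)"
  using assms by (simp add: comm_def expand)

lemma comm_minus:
  assumes "comm x y" "comm x z" "x \<in> carrier A" "y \<in> carrier A" "z \<in> carrier A"
  shows "comm x (y \<ominus> z)"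
  using assms by (simp add: to_smult comm_add comm_smult)

lemma comm_pow:
  assumes "comm x y" "x \<in> carrier A" "y \<in> carrier A"
  shows "comm x (y [^] (k::nat))"
  by (induction k) (use assms in \<open>auto intro: comm_mult\<close>)

lemmas comm_intros = comm_mult comm_add comm_smult comm_minus comm_pow

definition nilpotent :: "'a \<Rightarrow> bool" where
  "nilpotent x \<longleftrightarrow> (\<exists>k::nat. x [^] k = \<zero>)"

lemma pow_zero_mono:
  assumes "x [^] (k::nat) = \<zero>" "k \<le> l" "x \<in> carrier A" shows "x [^] l = \<zero>"
proof -
  have "x [^] l = x [^] k \<otimes> x [^] (l - k)"
    using assms(2,3) nat_pow_mult[of x k "l - k"] by simp
  then show ?thesis using assms by simp
qed

lemma comm_pow_mult:
  assumes "comm x y" "x \<in> carrier A" "y \<in> carrier A"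
  shows "(x \<otimes> y) [^] (k::nat) = x [^] k \<otimes> y [^] k"
  using assms by (intro pow_mult_distrib) (auto simp: comm_def)

lemma nilpotent_mult:
  assumes "nilpotent x" "comm x y" "x \<in> carrier A" "y \<in> carrier A"
  shows "nilpotent (x \<otimes> y)"
proof -
  from assms(1) obtain k :: nat where "x [^] k = \<zero>" by (auto simp: nilpotent_def)
  then have "(x \<otimes> y) [^] k = \<zero>" using assms by (simp add: comm_pow_mult)
  then show ?thesis by (auto simp: nilpotent_def)
qed

lemma nilpotent_smult:
  assumes "nilpotent x" "x \<in> carrier A"
  shows "nilpotent (c \<odot> x)"
proof -
  have "c \<odot> x = x \<otimes> (c \<odot> \<one>)" using assms by (simp add: expand)
  then show ?thesis using nilpotent_mult[OF assms(1), of "c \<odot> \<one>"] assms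
    by (simp add: comm_smult)
qed

text \<open>An induction replaces the binomial theorem: each factor \<open>x \<oplus> y\<close>
  absorbed into the monomial \<open>x^i y^j\<close> raises one of the exponents, so
  \<open>i + j + k\<close> stays constant. When \<open>k\<close> reaches 0, one of the exponents has
  passed its nilpotency bound.\<close>

lemma nilpotent_add:
  assumes "nilpotent x" "nilpotent y" "comm x y" "x \<in> carrier A" "y \<in> carrier A"
  shows "nilpotent (x \<oplus> y)"
proof -
  from assms obtain a b :: nat where ab: "x [^] a = \<zero>" "y [^] b = \<zero>"
    by (auto simp: nilpotent_def)
  have *: "(x \<oplus> y) [^] k \<otimes> (x [^] i \<otimes> y [^] j) = \<zero>" if "i + j + k \<ge> a + b" for i j k :: nat
    using that
  proof (induction k arbitrary: i j)
    case 0
    then have "i \<ge> a \<or> j \<ge> b" by linarith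
    then show ?case
      using ab assms(4,5) pow_zero_mono[of x a i] pow_zero_mono[of y b j] by auto
  next
    case (Suc k)
    have "y \<otimes> (x [^] i \<otimes> y [^] j) = x [^] i \<otimes> y [^] Suc j"
    proof -
      have "y \<otimes> x [^] i = x [^] i \<otimes> y"
        using comm_pow[of y x i] assms by (simp add: comm_def)
      moreover have "y \<otimes> (x [^] i \<otimes> y [^] j) = (y \<otimes> x [^] i) \<otimes> y [^] j"
        using assms by (simp add: m_assoc)
      ultimately show ?thesis
        using assms nat_pow_Suc2[of y j] by (simp add: m_assoc)
    qed
    moreover have "x \<otimes> (x [^] i \<otimes> y [^] j) = x [^] Suc i \<otimes> y [^] j"
      using assms nat_pow_Suc2[of x i] by (simp add: m_assoc[symmetric])
    ultimately have "(x \<oplus> y) [^] Suc k \<otimes> (x [^] i \<otimes> y [^] j) =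
        (x \<oplus> y) [^] k \<otimes> (x [^] Suc i \<otimes> y [^] j) \<oplus> (x \<oplus> y) [^] k \<otimes> (x [^] i \<otimes> y [^] Suc j)"
      using assms by (simp add: m_assoc l_distr r_distr)
    also have "\<dots> = \<zero>"
      using Suc.IH[of "Suc i" j] Suc.IH[of i "Suc j"] Suc.prems by simp
    finally show ?case .
  qed
  from *[of 0 0 "a + b"] show ?thesis
    using assms by (auto simp: nilpotent_def intro!: exI[of _ "a + b"])
qed

text \<open>The difference \<open>d\<close> of commuting idempotents satisfies
  \<open>d^3 = d\<close> in every characteristic, so all its odd powers equal \<open>d\<close> and
  nilpotency forces \<open>d = 0\<close>.\<close>

lemma commuting_idempotents_eq:
  assumes "e \<in> carrier A" "f \<in> carrier A" "e \<otimes> e = e" "f \<otimes> f = f" "comm e f"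
    and "nilpotent (e \<ominus> f)"
  shows "e = f"
proof -
  define d where "d = e \<ominus> f"
  have d: "d \<in> carrier A" using assms by (simp add: d_def)
  have fe: "f \<otimes> e = e \<otimes> f" using assms by (simp add: comm_def)
  have ee: "e \<otimes> (e \<otimes> x) = e \<otimes> x" "f \<otimes> (f \<otimes> x) = f \<otimes> x" "f \<otimes> (e \<otimes> x) = e \<otimes> (f \<otimes> x)"
    if "x \<in> carrier A" for x
    using assms fe that by (metis m_assoc)+
  have dd: "d \<otimes> d = e \<oplus> f \<oplus> (-2) \<odot> (e \<otimes> f)"
  proof -
    have "(-2) \<odot> (e \<otimes> f) = (-1) \<odot> (e \<otimes> f) \<oplus> (-1) \<odot> (e \<otimes> f)"
      using assms smult_add_left[of "e \<otimes> f" "-1" "-1"] by simp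
    then show ?thesis
      using assms by (simp add: d_def to_smult expand fe a_ac)
  qed
  have c3: "d \<otimes> (d \<otimes> d) = d"
  proof -
    have *: "(-2) \<odot> (e \<otimes> f) \<oplus> (e \<otimes> f) = (-1) \<odot> (e \<otimes> f)" "(-1) \<odot> (e \<otimes> f) \<oplus> 2 \<odot> (e \<otimes> f) = e \<otimes> f"
      using assms smult_add_left[of "e \<otimes> f" "-2" 1] smult_add_left[of "e \<otimes> f" "-1" 2] by auto
    have "d \<otimes> (e \<oplus> f \<oplus> (-2) \<odot> (e \<otimes> f)) =
      e \<oplus> (-1) \<odot> f \<oplus> (e \<otimes> f \<oplus> (-2) \<odot> (e \<otimes> f)) \<oplus> ((-1) \<odot> (e \<otimes> f) \<oplus> 2 \<odot> (e \<otimes> f))"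
      using assms by (simp add: d_def to_smult expand fe ee a_ac)
    also have "\<dots> = e \<oplus> (-1) \<odot> f \<oplus> ((-1) \<odot> (e \<otimes> f) \<oplus> e \<otimes> f)"
      using assms * by (simp add: a_ac)
    also have "(-1) \<odot> (e \<otimes> f) \<oplus> e \<otimes> f = \<zero>"
      using assms smult_add_left[of "e \<otimes> f" "-1" 1] by simp
    finally show ?thesis using assms dd by (simp add: d_def to_smult)
  qed
  have odd: "d [^] (2 * k + 1) = d" for k :: nat
  proof (induction k)
    case (Suc k)
    have "d [^] (2 * Suc k + 1) = d [^] (2 * k + 1) \<otimes> d \<otimes> d"
      using d by simp
    then show ?case using Suc c3 d by (simp add: m_assoc)
  qed (use d in simp)
  from assms(6) obtain k :: nat where "d [^] k = \<zero>"
    by (auto simp: nilpotent_def d_def)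
  then have "d [^] (2 * k + 1) = \<zero>"
    by (rule pow_zero_mono) (use d in auto)
  then have "d = \<zero>" using odd[of k] by metis
  then show ?thesis using assms(1,2) by (simp add: d_def)
qed

text \<open>The kernel \<open>W\<close> of left multiplication by \<open>b\<close> is invariant
  under \<open>a\<close> and so has an invariant complement \<open>U\<close>. Assumption
  \<open>inv\<close>, which holds for every polynomial \<open>b\<close> in \<open>a\<close>, makes
  \<open>U\<close> stable under \<open>b\<close>; since \<open>b\<close> is nilpotent and injective
  on \<open>U\<close>, only \<open>U = {0}\<close> is left.\<close>

lemma semisimple_nilpotent_eq_zero:
  assumes ss: "semisimple_element A a" and carr: "a \<in> carrier A" "b \<in> carrier A"
    and com: "comm a b" and nil: "nilpotent b"
    and inv: "\<And>U u. invariant_subspace A (\<lambda>x. a \<otimes> x) U \<Longrightarrow> u \<in> U \<Longrightarrow> b \<otimes> u \<in> U"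
  shows "b = \<zero>"
proof -
  define W where "W = {x \<in> carrier A. b \<otimes> x = \<zero>}"
  have "invariant_subspace A (\<lambda>x. a \<otimes> x) W"
  proof -
    have "b \<otimes> (a \<otimes> x) = \<zero>" if "x \<in> carrier A" "b \<otimes> x = \<zero>" for x
      using that com carr by (metis comm_def m_assoc r_null)
    then show ?thesis using carr
      by (auto simp: invariant_subspace_def subspace_iff W_def r_distr mult_smult_right)
  qed
  then obtain U where U: "invariant_subspace A (\<lambda>x. a \<otimes> x) U" "W \<inter> U = {\<zero>}" "set_add A W U = carrier A"
    using ss by (auto simp: semisimple_element_def semisimple_operator_def)
  have UA: "U \<subseteq> carrier A"
    using U(1) by (simp add: invariant_subspace_def subspace_iff)
  obtain k :: nat where k: "b [^] k = \<zero>" using nil by (auto simp: nilpotent_def)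
  have zero: "u = \<zero>" if "u \<in> U" "b [^] j \<otimes> u = \<zero>" for u and j :: nat
    using that
  proof (induction j arbitrary: u)
    case 0
    then show ?case using UA by auto
  next
    case (Suc j)
    have uA: "u \<in> carrier A" using Suc.prems UA by auto
    have "b \<otimes> u \<in> U" using inv[OF U(1) Suc.prems(1)] .
    moreover have "b [^] j \<otimes> (b \<otimes> u) = \<zero>"
      using Suc.prems uA carr by (simp add: m_assoc)
    ultimately have "b \<otimes> u = \<zero>" using Suc.IH by blast
    then show ?case using U(2) Suc.prems uA by (auto simp: W_def)
  qed
  \<comment> \<open>Only the unit has to be decomposed: once it lies in \<open>W\<close>,
    \<open>b = b \<otimes> \<one>\<close> vanishes.\<close>
  have "\<one> \<in> set_add A W U" using U(3) by simp
  then obtain w u where wu: "w \<in> W" "u \<in> U" "\<one> = w \<oplus> u"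
    by (auto simp: set_add_def set_mult_def)
  have "u = \<zero>" by (rule zero[of u k]) (use wu(2) k UA in auto)
  then have "w = \<one>" using wu(1,3) by (simp add: W_def)
  then have "\<one> \<in> W" using wu(1) by simp
  then show ?thesis using carr by (simp add: W_def)
qed

text \<open>\<open>a(a - c)\<close> is a polynomial in \<open>a\<close> and hence respects all
  \<open>a\<close>-invariant subspaces. This serves twice: the shuffle fails to be semi-simple, and
  its semi-simple part is unique.\<close>

lemma semisimple_quadratic:
  assumes ss: "semisimple_element A a" and a: "a \<in> carrier A"
    and nil: "nilpotent (a \<otimes> (a \<ominus> c \<odot> \<one>))"
  shows "a \<otimes> (a \<ominus> c \<odot> \<one>) = \<zero>"
proof (rule semisimple_nilpotent_eq_zero[OF ss a _ _ nil])
  show "comm a (a \<otimes> (a \<ominus> c \<odot> \<one>))"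
    using a by (intro comm_intros) auto
next
  fix U u assume U: "invariant_subspace A (\<lambda>x. a \<otimes> x) U" and u: "u \<in> U"
  then have uA: "u \<in> carrier A" by (auto simp: invariant_subspace_def subspace_iff)
  have "a \<otimes> (a \<ominus> c \<odot> \<one>) \<otimes> u = a \<otimes> (a \<otimes> u) \<oplus> (- c) \<odot> (a \<otimes> u)"
    using a uA by (simp add: to_smult expand)
  also have "\<dots> \<in> U"
    using U u by (auto simp: invariant_subspace_def subspace_iff image_subset_iff)
  finally show "a \<otimes> (a \<ominus> c \<odot> \<one>) \<otimes> u \<in> U" .
qed (use a in simp)

text \<open>Zorn's lemma replaces a basis extension argument, so that no finiteness of the dimension is
  needed: a vector outside \<open>W + U\<close> has an eigenvector component outside \<open>W + U\<close>.\<close>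

lemma semisimple_idempotent:
  assumes e: "e \<in> carrier A" "e \<otimes> e = e"
  shows "semisimple_element A (c \<odot> e)"
  unfolding semisimple_element_def semisimple_operator_def
proof (intro allI impI)
  let ?T = "\<lambda>x. (c \<odot> e) \<otimes> x"
  fix W assume W: "invariant_subspace A ?T W"
  define F where "F = {U. invariant_subspace A ?T U \<and> W \<inter> U = {\<zero>}}"
  have "{\<zero>} \<in> F"
    using W e by (auto simp: F_def invariant_subspace_def subspace_iff)
  have chain: "\<exists>U\<in>F. \<forall>C\<in>\<C>. C \<subseteq> U" if ch: "subset.chain F \<C>" for \<C>
  proof (cases "\<C> = {}")
    case True
    then show ?thesis using \<open>{\<zero>} \<in> F\<close> by auto
  next
    case False
    have CF: "C \<in> F" if "C \<in> \<C>" for C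
      using ch that by (auto simp: subset.chain_def)
    have sub: "C \<subseteq> D \<or> D \<subseteq> C" if "C \<in> \<C>" "D \<in> \<C>" for C D
      using ch that by (auto simp: subset.chain_def)
    have add: "x \<oplus> y \<in> \<Union>\<C>" if xy: "x \<in> \<Union>\<C>" "y \<in> \<Union>\<C>" for x y
    proof -
      from xy obtain C D where CD: "C \<in> \<C>" "D \<in> \<C>" "x \<in> C" "y \<in> D" by auto
      with sub[of C D] obtain E where "E \<in> \<C>" "x \<in> E" "y \<in> E" by auto
      with CF[of E] show ?thesis
        by (auto simp: F_def invariant_subspace_def subspace_iff)
    qed
    have C: "C \<subseteq> carrier A" "\<zero> \<in> C" "W \<inter> C = {\<zero>}"
      "x \<in> C \<Longrightarrow> d \<odot> x \<in> C" "x \<in> C \<Longrightarrow> ?T x \<in> C" if "C \<in> \<C>" for C d x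
      using CF[OF that] by (auto simp: F_def invariant_subspace_def subspace_iff)
    have "\<Union>\<C> \<in> F"
      unfolding F_def invariant_subspace_def subspace_iff mem_Collect_eq
    proof (intro conjI ballI allI)
      show "\<Union>\<C> \<subseteq> carrier A" "\<zero> \<in> \<Union>\<C>" "W \<inter> \<Union>\<C> = {\<zero>}"
        using C(1-3) False by blast+
      show "?T ` \<Union>\<C> \<subseteq> \<Union>\<C>"
        using C(5) by blast
    next
      fix d x assume "x \<in> \<Union>\<C>"
      then show "d \<odot> x \<in> \<Union>\<C>" using C(4) by blast
    qed (use add in auto)
    then show ?thesis by auto
  qed
  have "\<exists>U\<in>F. \<forall>X\<in>F. U \<subseteq> X \<longrightarrow> X = U"
    by (rule subset_Zorn) (rule chain)
  then obtain U where U: "U \<in> F" and max: "\<And>X. X \<in> F \<Longrightarrow> U \<subseteq> X \<Longrightarrow> X = U"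
    by blast
  have Us: "subspace class_ring U A" "?T ` U \<subseteq> U" "W \<inter> U = {\<zero>}"
    and Ws: "subspace class_ring W A" "?T ` W \<subseteq> W"
    using U W by (auto simp: F_def invariant_subspace_def)
  note sU = Us(1)[unfolded subspace_iff] and sW = Ws(1)[unfolded subspace_iff]
  have UA: "\<And>u. u \<in> U \<Longrightarrow> u \<in> carrier A" and WA: "\<And>w. w \<in> W \<Longrightarrow> w \<in> carrier A"
    using sU sW by auto
  have mem: "x \<in> set_add A W U \<longleftrightarrow> (\<exists>w\<in>W. \<exists>u\<in>U. x = w \<oplus> u)" for x
    by (auto simp: set_add_def set_mult_def)
  have sum: "x \<oplus> y \<in> set_add A W U" if xy: "x \<in> set_add A W U" "y \<in> set_add A W U" for x y
  proof -
    from xy obtain w u w' u' where *: "w \<in> W" "u \<in> U" "x = w \<oplus> u" "w' \<in> W" "u' \<in> U" "y = w' \<oplus> u'"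
      by (auto simp: mem)
    then have "x \<oplus> y = (w \<oplus> w') \<oplus> (u \<oplus> u')"
      using UA WA by (simp add: a_ac)
    then show ?thesis unfolding mem using * sU sW by blast
  qed
  \<comment> \<open>Otherwise the line through \<open>v\<close> could be added to \<open>U\<close>:
    a vector of \<open>W\<close> with a nonzero \<open>v\<close>-component would put
    \<open>v\<close> into \<open>W + U\<close>, so the enlarged space still meets \<open>W\<close>
    only in zero, against maximality.\<close>
  have eigen: "v \<in> set_add A W U" if v: "v \<in> carrier A" "?T v = l \<odot> v" for v l
  proof (rule ccontr)
    assume nv: "v \<notin> set_add A W U"
    define U' where "U' = {u \<oplus> d \<odot> v | u d. u \<in> U}"
    have "U' \<in> F"
      unfolding F_def invariant_subspace_def subspace_iff mem_Collect_eq
    proof (intro conjI ballI allI)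
      show "U' \<subseteq> carrier A" using UA v by (auto simp: U'_def)
      have "\<zero> = \<zero> \<oplus> 0 \<odot> v" using v by simp
      then show "\<zero> \<in> U'" unfolding U'_def using sU by blast
    next
      fix x y assume "x \<in> U'" "y \<in> U'"
      then obtain u d u' d' where *: "x = u \<oplus> d \<odot> v" "u \<in> U" "y = u' \<oplus> d' \<odot> v" "u' \<in> U"
        by (auto simp: U'_def)
      then have "x \<oplus> y = (u \<oplus> u') \<oplus> (d + d') \<odot> v"
        using UA v by (simp add: smult_add_left a_ac)
      then show "x \<oplus> y \<in> U'" unfolding U'_def using sU * by blast
    next
      fix b x assume "x \<in> U'"
      then obtain u d where *: "x = u \<oplus> d \<odot> v" "u \<in> U" by (auto simp: U'_def)
      then have "b \<odot> x = b \<odot> u \<oplus> (b * d) \<odot> v"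
        using UA v by (simp add: smult_add_right smult_smult)
      then show "b \<odot> x \<in> U'" unfolding U'_def using sU * by blast
    next
      show "?T ` U' \<subseteq> U'"
      proof
        fix y assume "y \<in> ?T ` U'"
        then obtain u d where *: "y = ?T (u \<oplus> d \<odot> v)" "u \<in> U" by (auto simp: U'_def)
        then have "y = ?T u \<oplus> d \<odot> ?T v"
          using UA v(1) e by (simp add: r_distr mult_smult_right)
        also have "\<dots> = ?T u \<oplus> (d * l) \<odot> v"
          using v by (simp add: smult_smult)
        finally show "y \<in> U'" unfolding U'_def using Us(2) * by blast
      qed
    next
      have "x = \<zero>" if x: "x \<in> W" "x \<in> U'" for x
      proof -
        from x obtain u d where *: "x = u \<oplus> d \<odot> v" "u \<in> U" by (auto simp: U'_def)
        show ?thesis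
        proof (cases "d = 0")
          case True
          then show ?thesis using * x UA v Us(3) by auto
        next
          case False
          have "d \<odot> v = x \<oplus> (- 1) \<odot> u"
            unfolding *(1) using add_diff_left[OF UA[OF *(2)], of "d \<odot> v"] UA[OF *(2)] v(1)
            by (simp add: minus_eq_smult)
          then have "inverse d \<odot> (d \<odot> v) = inverse d \<odot> x \<oplus> (- inverse d) \<odot> u"
            using UA[OF *(2)] WA[OF x(1)] by (simp add: smult_add_right smult_smult)
          then have "v = inverse d \<odot> x \<oplus> (- inverse d) \<odot> u"
            using v False by (simp add: smult_smult)
          then have "v \<in> set_add A W U" unfolding mem using sU sW * x by blast
          then show ?thesis using nv by simp
        qed
      qed
      moreover have "\<zero> = \<zero> \<oplus> 0 \<odot> v" using v by simp
      then have "\<zero> \<in> U'" unfolding U'_def using sU by blast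
      ultimately show "W \<inter> U' = {\<zero>}" using sW by auto
    qed
    moreover have "U \<subseteq> U'"
    proof
      fix u assume "u \<in> U"
      then have "u = u \<oplus> 0 \<odot> v" using UA v by simp
      then show "u \<in> U'" unfolding U'_def using \<open>u \<in> U\<close> by blast
    qed
    ultimately have "U' = U" by (rule max)
    moreover have "v = \<zero> \<oplus> 1 \<odot> v" using v by simp
    then have "v \<in> U'" unfolding U'_def using sU by blast
    ultimately have "v \<in> U" by simp
    moreover have "v = \<zero> \<oplus> v" using v by simp
    ultimately show False using nv sW unfolding mem by blast
  qed
  \<comment> \<open>\<open>v\<close> is the sum of \<open>e v\<close> and \<open>v - e v\<close>,
    eigenvectors for the eigenvalues \<open>c\<close> and 0.\<close>
  have "v \<in> set_add A W U" if v: "v \<in> carrier A" for v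
  proof -
    have ee: "e \<otimes> (e \<otimes> v) = e \<otimes> v" using e v by (metis m_assoc)
    have "e \<otimes> v \<in> set_add A W U"
      by (rule eigen[of _ c]) (use e v ee in \<open>auto simp: mult_smult_left m_assoc\<close>)
    moreover have "v \<ominus> e \<otimes> v \<in> set_add A W U"
      by (rule eigen[of _ 0])
        (use e v ee in \<open>auto simp: mult_smult_left m_assoc minus_eq r_distr r_minus r_neg\<close>)
    ultimately have "e \<otimes> v \<oplus> (v \<ominus> e \<otimes> v) \<in> set_add A W U" by (rule sum)
    moreover have "e \<otimes> v \<oplus> (v \<ominus> e \<otimes> v) = v"
      using e v by algebra
    ultimately show ?thesis by simp
  qed
  moreover have "set_add A W U \<subseteq> carrier A" using UA WA by (auto simp: mem)
  ultimately have "set_add A W U = carrier A" by auto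
  then show "\<exists>U. invariant_subspace A ?T U \<and> W \<inter> U = {\<zero>} \<and> set_add A W U = carrier A"
    using U by (auto simp: F_def)
qed

end

section \<open>Quantum integers\<close>

lemma q_minus_inverse_nonzero:
  fixes q :: "'k::field" assumes "q \<noteq> 0" "q\<^sup>2 \<noteq> 1" shows "q - inverse q \<noteq> 0"
proof
  assume "q - inverse q = 0"
  then have "q * q = q * inverse q" by simp
  then show False using assms by (simp add: power2_eq_square)
qed

text \<open>The eigenvalue of \<sigma>_i(q^m) on a vector on which \<sigma>_i acts by q and
  \<kappa>_i by zero.\<close>

lemma qnum_Suc_eq:
  fixes q :: "'k::field" assumes "q \<noteq> 0" "q - inverse q \<noteq> 0"
  shows "inverse (q ^ m) * (1 + ((q ^ m)\<^sup>2 - 1) / (q - inverse q) * q) = qnum q (m + 1)"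
proof -
  have "inverse (q ^ m) * ((q - inverse q) + ((q ^ m)\<^sup>2 - 1) * q) = q ^ (m + 1) - inverse q ^ (m + 1)"
    using assms(1) by (simp add: field_simps power2_eq_square)
  moreover have "1 + ((q ^ m)\<^sup>2 - 1) / (q - inverse q) * q =
      ((q - inverse q) + ((q ^ m)\<^sup>2 - 1) * q) / (q - inverse q)"
    using assms(2) by (simp add: add_divide_distrib)
  ultimately show ?thesis by (simp add: qnum_def)
qed

text \<open>The coefficient of \<sigma>_i in \<sigma>_i(q^m), which supplies the subdiagonal entries
  in the Burau representation.\<close>

lemma qnum_eq:
  fixes q :: "'k::field" assumes "q \<noteq> 0"
  shows "inverse (q ^ m) * (((q ^ m)\<^sup>2 - 1) / (q - inverse q)) = qnum q m"
proof -
  have "inverse (q ^ m) * ((q ^ m)\<^sup>2 - 1) = q ^ m - inverse q ^ m"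
    using assms by (simp add: field_simps power2_eq_square)
  then show ?thesis by (simp add: qnum_def)
qed


section \<open>Opposite algebras\<close>

text \<open>Encodes reversal of words without constructing an anti-automorphism: a statement about
  right multiplication is the left-handed statement read in this algebra.\<close>

definition opalg :: "('k, 'a) module \<Rightarrow> ('k, 'a) module" where
  "opalg A = A\<lparr>mult := (\<lambda>x y. y \<otimes>\<^bsub>A\<^esub> x)\<rparr>"

lemma opalg_simps [simp]:
  "carrier (opalg A) = carrier A" "x \<otimes>\<^bsub>opalg A\<^esub> y = y \<otimes>\<^bsub>A\<^esub> x"
  "\<one>\<^bsub>opalg A\<^esub> = \<one>\<^bsub>A\<^esub>" "\<zero>\<^bsub>opalg A\<^esub> = \<zero>\<^bsub>A\<^esub>" "x \<oplus>\<^bsub>opalg A\<^esub> y = x \<oplus>\<^bsub>A\<^esub> y"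
  "c \<odot>\<^bsub>opalg A\<^esub> x = c \<odot>\<^bsub>A\<^esub> x" "opalg (opalg A) = A"
  by (simp_all add: opalg_def)

lemma (in kalgebra) kalgebra_opalg: "kalgebra (opalg A)"
proof (intro kalgebra.intro kalgebra_axioms.intro)
  show "ring (opalg A)"
  proof (rule ringI)
    show "abelian_group (opalg A)"
      by (rule abelian_groupI) (auto simp: a_ac intro: add.l_inv_ex)
    show "monoid (opalg A)"
      by unfold_locales (auto simp: m_assoc)
  qed (auto simp: l_distr r_distr)
qed (auto simp: smult_add_left smult_add_right smult_smult mult_smult_left mult_smult_right)


section \<open>Algebras with Birman--Murakami--Wenzl generators\<close>

text \<open>The second alternative of \<open>nondegenerate\<close> excludes the poles of the Baxterized elements. In a
  quotient with \<open>k = 0\<close>, such as the Hecke algebra, the parameter \<open>\<nu>\<close> does not matter.\<close>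

locale bmw_relations = kalgebra A for A :: "('k::field, 'a) module" (structure) +
  fixes s t k :: "nat \<Rightarrow> 'a" and q \<nu> :: 'k and n :: nat
  assumes n_pos: "n \<ge> 1" and q_nonzero: "q \<noteq> 0" and q2: "q\<^sup>2 \<noteq> 1" and nu_nonzero: "\<nu> \<noteq> 0"
    and qnum_nonzero: "i \<in> {2..n + 1} \<Longrightarrow> qnum q i \<noteq> 0"
    and s_closed: "i \<in> {1..n} \<Longrightarrow> s i \<in> carrier A"
    and t_closed: "i \<in> {1..n} \<Longrightarrow> t i \<in> carrier A"
    and k_closed: "i \<in> {1..n} \<Longrightarrow> k i \<in> carrier A"
    and s_t: "i \<in> {1..n} \<Longrightarrow> s i \<otimes> t i = \<one>"
    and t_s: "i \<in> {1..n} \<Longrightarrow> t i \<otimes> s i = \<one>"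
    and skein: "i \<in> {1..n} \<Longrightarrow> t i = s i \<oplus> (- (q - inverse q)) \<odot> \<one> \<oplus> (q - inverse q) \<odot> k i"
    and k_s: "i \<in> {1..n} \<Longrightarrow> k i \<otimes> s i = \<nu> \<odot> k i"
    and s_k: "i \<in> {1..n} \<Longrightarrow> s i \<otimes> k i = \<nu> \<odot> k i"
    and ksk: "i \<in> {2..n} \<Longrightarrow> k i \<otimes> (s (i - 1) \<otimes> k i) = inverse \<nu> \<odot> k i"
    and ktk: "i \<in> {2..n} \<Longrightarrow> k i \<otimes> (t (i - 1) \<otimes> k i) = \<nu> \<odot> k i"
    and braid: "i \<in> {2..n} \<Longrightarrow>
      s i \<otimes> (s (i - 1) \<otimes> s i) = s (i - 1) \<otimes> (s i \<otimes> s (i - 1))"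
    and far: "i \<in> {1..n} \<Longrightarrow> j \<in> {1..n} \<Longrightarrow> i + 1 < j \<Longrightarrow> s i \<otimes> s j = s j \<otimes> s i"
    and nondegenerate: "(\<forall>i\<in>{1..n}. k i = \<zero>) \<or> (\<forall>j\<in>{1..n}. \<nu> \<noteq> q ^ (2 * j - 1))"
begin

definition bax :: "nat \<Rightarrow> 'k \<Rightarrow> 'a" where
  "bax i x = inverse x \<odot> (\<one> \<oplus> ((x\<^sup>2 - 1) / (q - inverse q)) \<odot> s i
    \<oplus> ((x\<^sup>2 - 1) / (1 - inverse \<nu> * inverse q * x\<^sup>2)) \<odot> k i)"

definition Y :: 'a where "Y = shuffle A bax q n"

lemma h_nonzero: "q - inverse q \<noteq> 0"
  using q_nonzero q2 by (rule q_minus_inverse_nonzero)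

lemma bax_closed [simp]: "i \<in> {1..n} \<Longrightarrow> bax i x \<in> carrier A"
  using s_closed k_closed by (simp add: bax_def)

lemma s_s:
  assumes "i \<in> {1..n}" "x \<in> carrier A"
  shows "s i \<otimes> (s i \<otimes> x) =
    x \<oplus> (q - inverse q) \<odot> (s i \<otimes> x) \<oplus> (- (q - inverse q) * \<nu>) \<odot> (k i \<otimes> x)"
proof -
  let ?h = "q - inverse q"
  note cl [simp] = s_closed[OF assms(1)] k_closed[OF assms(1)] t_closed[OF assms(1)] assms(2)
  have "x = s i \<otimes> (t i \<otimes> x)"
    using s_t[OF assms(1)] by (simp add: m_assoc[symmetric])
  also have "\<dots> = s i \<otimes> (s i \<otimes> x) \<oplus> (- ?h) \<odot> (s i \<otimes> x) \<oplus> ?h \<odot> ((s i \<otimes> k i) \<otimes> x)"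
    unfolding skein[OF assms(1)] by (simp add: expand)
  also have "\<dots> = s i \<otimes> (s i \<otimes> x) \<oplus> (- ?h) \<odot> (s i \<otimes> x) \<oplus> (?h * \<nu>) \<odot> (k i \<otimes> x)"
    unfolding s_k[OF assms(1)] by (simp add: expand)
  finally have x: "x = s i \<otimes> (s i \<otimes> x) \<oplus> (- ?h) \<odot> (s i \<otimes> x) \<oplus> (?h * \<nu>) \<odot> (k i \<otimes> x)" .
  have zero: "(- ?h) \<odot> (s i \<otimes> x) \<oplus> ?h \<odot> (s i \<otimes> x) = \<zero>"
    "(?h * \<nu>) \<odot> (k i \<otimes> x) \<oplus> (- ?h * \<nu>) \<odot> (k i \<otimes> x) = \<zero>"
    by (simp_all add: smult_add_left[symmetric] left_diff_distrib)
  have "x \<oplus> ?h \<odot> (s i \<otimes> x) \<oplus> (- ?h * \<nu>) \<odot> (k i \<otimes> x) =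
    s i \<otimes> (s i \<otimes> x) \<oplus> ((- ?h) \<odot> (s i \<otimes> x) \<oplus> ?h \<odot> (s i \<otimes> x))
      \<oplus> ((?h * \<nu>) \<odot> (k i \<otimes> x) \<oplus> (- ?h * \<nu>) \<odot> (k i \<otimes> x))"
    by (subst x) (simp add: a_ac)
  then show ?thesis unfolding zero by simp
qed

lemma h_k:
  assumes "i \<in> {1..n}"
  shows "(q - inverse q) \<odot> k i = t i \<oplus> (- 1) \<odot> s i \<oplus> (q - inverse q) \<odot> \<one>"
proof -
  let ?h = "q - inverse q"
  note cl [simp] = s_closed[OF assms(1)] k_closed[OF assms(1)] t_closed[OF assms(1)]
  have zero: "s i \<oplus> (- 1) \<odot> s i = \<zero>" "(- ?h) \<odot> \<one> \<oplus> ?h \<odot> \<one> = \<zero>"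
    using smult_add_left[of "s i" 1 "-1"] smult_add_left[of "\<one>" "- ?h" ?h] by auto
  have "t i \<oplus> (- 1) \<odot> s i \<oplus> ?h \<odot> \<one> =
    (s i \<oplus> (- 1) \<odot> s i) \<oplus> ((- ?h) \<odot> \<one> \<oplus> ?h \<odot> \<one>) \<oplus> ?h \<odot> k i"
    unfolding skein[OF assms] by (simp add: a_ac)
  then show ?thesis unfolding zero by simp
qed

text \<open>\<open>k i\<close> is a linear combination of \<open>s i\<close>, its inverse and the
  unit, so whatever intertwines \<open>s i\<close> with \<open>s j\<close> also intertwines the
  inverses and then \<open>k i\<close> with \<open>k j\<close>.\<close>

lemma intertwine_k:
  assumes i: "i \<in> {1..n}" and j: "j \<in> {1..n}" and u: "u \<in> carrier A"
    and us: "u \<otimes> s i = s j \<otimes> u"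
  shows "u \<otimes> k i = k j \<otimes> u"
proof -
  let ?h = "q - inverse q"
  note [simp] = s_closed[OF i] k_closed[OF i] t_closed[OF i] s_closed[OF j] k_closed[OF j]
    t_closed[OF j] u
  have "u \<otimes> t i = t j \<otimes> (s j \<otimes> u) \<otimes> t i"
    using t_s[OF j] by (simp add: m_assoc[symmetric])
  also have "\<dots> = t j \<otimes> (u \<otimes> (s i \<otimes> t i))"
    unfolding us[symmetric] by (simp add: m_assoc)
  finally have ut: "u \<otimes> t i = t j \<otimes> u" using s_t[OF i] by simp
  have "?h \<odot> (u \<otimes> k i) = u \<otimes> (?h \<odot> k i)" by (simp add: mult_smult_right)
  also have "\<dots> = (?h \<odot> k j) \<otimes> u"
    unfolding h_k[OF i] h_k[OF j] by (simp add: expand us ut)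
  also have "\<dots> = ?h \<odot> (k j \<otimes> u)" by (simp add: mult_smult_left)
  finally show ?thesis
    by (rule smult_right_cancel) (use h_nonzero in auto)
qed

lemma comm_s_bax:
  assumes i: "i \<in> {1..n}" and j: "j \<in> {1..n}" and ij: "i + 1 < j \<or> j + 1 < i"
  shows "comm (s i) (bax j x)"
proof -
  have c: "comm (s i) (s j)" using far[OF i j] far[OF j i] ij by (auto simp: comm_def)
  then have "comm (s i) (k j)"
    using intertwine_k[OF j j s_closed[OF i]] by (simp add: comm_def)
  then show ?thesis unfolding bax_def
    using c s_closed[OF i] s_closed[OF j] k_closed[OF j] by (intro comm_intros) auto
qed

section \<open>Elements symmetric under the first generators\<close>

definition lsym :: "nat \<Rightarrow> 'a \<Rightarrow> bool" where
  "lsym m x \<longleftrightarrow> x \<in> carrier A \<and> (\<forall>i\<in>{1..m}. s i \<otimes> x = q \<odot> x)"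

definition rsym :: "nat \<Rightarrow> 'a \<Rightarrow> bool" where
  "rsym m x \<longleftrightarrow> x \<in> carrier A \<and> (\<forall>i\<in>{1..m}. x \<otimes> s i = q \<odot> x)"

text \<open>\<open>k i \<otimes> s i \<otimes> x\<close> is both \<open>\<nu>\<close> and
  \<open>q\<close> times \<open>k i \<otimes> x\<close>. Unless \<open>k i\<close> is zero itself,
  the two scalars differ: \<open>\<nu> \<noteq> q\<close> is the case \<open>j = 1\<close> of
  \<open>nondegenerate\<close>.\<close>

lemma k_lsym:
  assumes i: "i \<in> {1..n}" and x: "x \<in> carrier A" and sx: "s i \<otimes> x = q \<odot> x"
  shows "k i \<otimes> x = \<zero>"
proof (cases "k i = \<zero>")
  case True
  then show ?thesis using x by simp
next
  case False
  then have "\<nu> \<noteq> q" using nondegenerate i n_pos by force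
  have "\<nu> \<odot> (k i \<otimes> x) = (k i \<otimes> s i) \<otimes> x"
    using k_s[OF i] k_closed[OF i] x by (simp add: mult_smult_left)
  also have "\<dots> = q \<odot> (k i \<otimes> x)"
    using sx k_closed[OF i] s_closed[OF i] x by (simp add: m_assoc mult_smult_right)
  finally show ?thesis
    by (rule smult_left_eqD) (use \<open>\<nu> \<noteq> q\<close> k_closed[OF i] x in auto)
qed

lemma bax_lsym:
  assumes i: "i \<in> {1..n}" and x: "x \<in> carrier A" and sx: "s i \<otimes> x = q \<odot> x"
  shows "bax i (q ^ m) \<otimes> x = qnum q (m + 1) \<odot> x"
proof -
  have "bax i (q ^ m) \<otimes> x =
      (inverse (q ^ m) * (1 + ((q ^ m)\<^sup>2 - 1) / (q - inverse q) * q)) \<odot> x"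
    using s_closed[OF i] k_closed[OF i] x
    by (simp add: bax_def expand sx k_lsym[OF assms] algebra_simps)
  also note qnum_Suc_eq[OF q_nonzero h_nonzero]
  finally show ?thesis .
qed

text \<open>At the parameter \<open>q\<close> the Baxterized generator is \<open>[2]_q\<close> times
  the projector onto the eigenvalue \<open>q\<close> of \<open>s i\<close>; its coefficient
  \<open>d\<close> of \<open>k i\<close> is exactly the one for which the \<open>k i\<close> terms
  of both sides match.\<close>

lemma s_bax_q:
  assumes i: "i \<in> {1..n}"
  shows "s i \<otimes> bax i q = q \<odot> bax i q"
proof -
  let ?h = "q - inverse q"
  note [simp] = s_closed[OF i] k_closed[OF i]
  define d where "d = (q\<^sup>2 - 1) / (1 - inverse \<nu> * inverse q * q\<^sup>2)"
  have qh: "(q\<^sup>2 - 1) / ?h = q"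
    using h_nonzero q_nonzero by (simp add: field_simps power2_eq_square)
  have ss: "s i \<otimes> s i = \<one> \<oplus> ?h \<odot> s i \<oplus> (- ?h * \<nu>) \<odot> k i"
    using s_s[OF i, of \<one>] by simp
  have kk: "(d * \<nu> - q * ?h * \<nu>) \<odot> k i = (q * d) \<odot> k i"
  proof (cases "k i = \<zero>")
    case False
    then have "\<nu> \<noteq> q" using nondegenerate i n_pos by force
    have "d = \<nu> * (q\<^sup>2 - 1) / (\<nu> - q)"
      using \<open>\<nu> \<noteq> q\<close> nu_nonzero q_nonzero by (simp add: d_def field_simps power2_eq_square)
    moreover have "q * ?h = q\<^sup>2 - 1"
      using q_nonzero by (simp add: algebra_simps power2_eq_square)
    ultimately have "d * (\<nu> - q) = \<nu> * (q * ?h)"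
      using \<open>\<nu> \<noteq> q\<close> by simp
    then have "d * \<nu> - q * ?h * \<nu> = q * d"
      by (simp add: algebra_simps)
    then show ?thesis by simp
  qed simp
  have "s i \<otimes> (\<one> \<oplus> q \<odot> s i \<oplus> d \<odot> k i) =
      s i \<oplus> q \<odot> (\<one> \<oplus> ?h \<odot> s i \<oplus> (- ?h * \<nu>) \<odot> k i) \<oplus> (d * \<nu>) \<odot> k i"
    by (simp add: expand ss s_k[OF i])
  also have "\<dots> = q \<odot> \<one> \<oplus> (1 + q * ?h) \<odot> s i \<oplus> (d * \<nu> - q * ?h * \<nu>) \<odot> k i"
  proof -
    have "(d * \<nu> - q * ?h * \<nu>) \<odot> k i = (d * \<nu>) \<odot> k i \<oplus> (q * (- ?h * \<nu>)) \<odot> k i"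
      by (simp add: smult_add_left[symmetric] algebra_simps)
    moreover have "(1 + q * ?h) \<odot> s i = s i \<oplus> (q * ?h) \<odot> s i"
      by (simp add: smult_add_left)
    ultimately show ?thesis
      by (simp add: smult_add_right smult_smult a_ac)
  qed
  also have "1 + q * ?h = q * q" using q_nonzero by (simp add: field_simps)
  also note kk
  also have "q \<odot> \<one> \<oplus> (q * q) \<odot> s i \<oplus> (q * d) \<odot> k i = q \<odot> (\<one> \<oplus> q \<odot> s i \<oplus> d \<odot> k i)"
    by (simp add: expand)
  finally have "s i \<otimes> (\<one> \<oplus> q \<odot> s i \<oplus> d \<odot> k i) = q \<odot> (\<one> \<oplus> q \<odot> s i \<oplus> d \<odot> k i)" .
  then show ?thesis
    by (simp add: bax_def qh d_def[symmetric] mult_smult_right smult_smult mult.commute)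
qed

text \<open>The scalar content of \<open>s_bax_bax\<close>. \<open>B\<close> is the square of
  \<open>q^(i - 1)\<close>; \<open>al\<close>, \<open>be\<close> belong to \<sigma>_{i-1}(q^{i-1})
  and \<open>ga\<close>, \<open>de\<close> to \<sigma>_i(q^i). The two equations compare the
  coordinates \<open>v5\<close> and \<open>v3\<close> there, and \<open>nz\<close> keeps
  \<open>\<nu>\<close> off the poles of \<open>be\<close> and \<open>de\<close>, so that
  denominators can be cleared.\<close>

lemma baxter_coefficients:
  fixes B al be ga de c :: 'k
  assumes al: "al = (B - 1) / (q - inverse q)" and be: "be = (B - 1) / (1 - inverse \<nu> * inverse q * B)"
    and ga: "ga = (B * q\<^sup>2 - 1) / (q - inverse q)"
    and de: "de = (B * q\<^sup>2 - 1) / (1 - inverse \<nu> * inverse q * (B * q\<^sup>2))"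
    and c: "c = be * (ga / q) + be * de"
    and nz: "\<nu> * q \<noteq> B" "\<nu> \<noteq> B * q"
  shows "c = q * (al * de)" "de * \<nu> - ga * (q - inverse q) * \<nu> - c * (q - inverse q) = q * de"
proof -
  define h where "h = q - inverse q"
  have h: "h \<noteq> 0" "q * h = q * q - 1" using h_nonzero q_nonzero by (auto simp: h_def algebra_simps)
  have be': "be * (\<nu> * q - B) = (B - 1) * (\<nu> * q)"
    using nz q_nonzero nu_nonzero unfolding be by (simp add: field_simps)
  have de': "de * (\<nu> - B * q) = (B * q\<^sup>2 - 1) * \<nu>"
    using nz q_nonzero nu_nonzero unfolding de by (simp add: field_simps power2_eq_square)
  have al': "al * h = B - 1" and ga': "ga * h = B * q\<^sup>2 - 1"
    using h unfolding al ga h_def[symmetric] by auto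
  have "(\<nu> * q - B) * h * \<nu> * q * c = (be * (\<nu> * q - B)) * \<nu> * ((ga * h) + q * h * de)"
    unfolding c using q_nonzero by (simp add: field_simps)
  also have "\<dots> = (B - 1) * (\<nu> * q) * ((ga * h) * \<nu> + q * h * de * \<nu>)"
    unfolding be' by (simp add: algebra_simps)
  also have "\<dots> = (B - 1) * (\<nu> * q) * (de * (\<nu> - B * q) + (q * q - 1) * de * \<nu>)"
    unfolding ga' de' h by simp
  also have "\<dots> = (al * h) * (\<nu> * q) * (q * de * (\<nu> * q - B))"
    unfolding al' by (simp add: algebra_simps)
  also have "\<dots> = (\<nu> * q - B) * h * \<nu> * q * (q * (al * de))" by simp
  finally show c': "c = q * (al * de)" using h nz q_nonzero nu_nonzero by simp
  have "de * \<nu> - (ga * h) * \<nu> - q * (al * h) * de = q * de"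
    unfolding al' ga' using de' by (simp add: algebra_simps)
  then show "de * \<nu> - ga * (q - inverse q) * \<nu> - c * (q - inverse q) = q * de"
    unfolding c' h_def[symmetric] by (simp add: algebra_simps)
qed

text \<open>With \<open>s (i - 1) \<otimes> z = q \<odot> z\<close>, the left ideal generated by \<open>z\<close> over the two strands is spanned
  by \<open>z, Tz, Fz, STz, SFz, EFz\<close>, where \<open>S, T\<close> are the two braid generators and \<open>E, F\<close> the
  corresponding \<open>k\<close>'s; the identity is checked on these coordinates. It replaces the full
  Yang--Baxter equation.\<close>

lemma s_bax_bax:
  assumes i: "i \<in> {2..n}" and z: "z \<in> carrier A" and sz: "s (i - 1) \<otimes> z = q \<odot> z"
  shows "s i \<otimes> (bax (i - 1) (q ^ (i - 1)) \<otimes> (bax i (q ^ i) \<otimes> z)) =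
    q \<odot> (bax (i - 1) (q ^ (i - 1)) \<otimes> (bax i (q ^ i) \<otimes> z))"
proof -
  have i1: "i \<in> {1..n}" and i2: "i - 1 \<in> {1..n}" using i by auto
  define h where "h = q - inverse q"
  define S T E F S' where defs: "S = s (i - 1)" "T = s i" "E = k (i - 1)" "F = k i" "S' = t (i - 1)"
  have cl [simp]: "S \<in> carrier A" "T \<in> carrier A" "E \<in> carrier A" "F \<in> carrier A" "S' \<in> carrier A"
      "z \<in> carrier A"
    using s_closed k_closed t_closed i1 i2 z by (auto simp: defs)
  have Sz: "S \<otimes> z = q \<odot> z" using sz by (simp add: defs)
  have Ez: "E \<otimes> z = \<zero>" using k_lsym[OF i2 z sz] by (simp add: defs)
  have br: "T \<otimes> (S \<otimes> T) = S \<otimes> (T \<otimes> S)" using braid[OF i] by (simp add: defs)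
  have TSF: "T \<otimes> S \<otimes> F = E \<otimes> (T \<otimes> S)"
    by (rule intertwine_k[OF i1 i2, of "T \<otimes> S", folded defs]) (use br in \<open>simp_all add: m_assoc\<close>)
  have STE: "S \<otimes> T \<otimes> E = F \<otimes> (S \<otimes> T)"
    by (rule intertwine_k[OF i2 i1, of "S \<otimes> T", folded defs]) (use br in \<open>simp_all add: m_assoc\<close>)
  have TF: "T \<otimes> F = \<nu> \<odot> F" and FT: "F \<otimes> T = \<nu> \<odot> F"
    using s_k[OF i1] k_s[OF i1] by (auto simp: defs)
  have FSF: "F \<otimes> (S \<otimes> F) = inverse \<nu> \<odot> F" and FS'F: "F \<otimes> (S' \<otimes> F) = \<nu> \<odot> F"
    using ksk[OF i] ktk[OF i] by (auto simp: defs)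
  have SS': "S \<otimes> S' = \<one>" and S'S: "S' \<otimes> S = \<one>" using s_t[OF i2] t_s[OF i2] by (auto simp: defs)
  \<comment> \<open>Both sides arise from \<open>T S F S' F\<close>: \<open>F S' F = \<nu> F\<close>
    gives one, while \<open>T S F = E T S\<close> with \<open>S S' = 1\<close> and
    \<open>T F = \<nu> F\<close> gives the other.\<close>
  have TSF': "T \<otimes> S \<otimes> F = E \<otimes> F"
  proof (rule smult_right_cancel)
    have "\<nu> \<odot> (T \<otimes> S \<otimes> F) = (T \<otimes> S \<otimes> F) \<otimes> (S' \<otimes> F)"
      by (simp add: m_assoc FS'F mult_smult_right)
    also have "\<dots> = E \<otimes> (T \<otimes> ((S \<otimes> S') \<otimes> F))"
      unfolding TSF by (simp add: m_assoc)
    also have "\<dots> = \<nu> \<odot> (E \<otimes> F)"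
      by (simp add: SS' TF mult_smult_right)
    finally show "\<nu> \<odot> (T \<otimes> S \<otimes> F) = \<nu> \<odot> (E \<otimes> F)" .
  qed (use nu_nonzero in auto)
  \<comment> \<open>After multiplication by \<open>S\<close> from the left, \<open>STE\<close>
    applies and \<open>F S T F = \<nu> F S F = F\<close>.\<close>
  have TEF: "T \<otimes> (E \<otimes> F) = S' \<otimes> F"
  proof -
    have "S \<otimes> (T \<otimes> (E \<otimes> F)) = (S \<otimes> T \<otimes> E) \<otimes> F" by (simp add: m_assoc)
    also have "\<dots> = F \<otimes> (S \<otimes> (T \<otimes> F))" unfolding STE by (simp add: m_assoc)
    also have "\<dots> = F" using nu_nonzero by (simp add: TF mult_smult_right FSF smult_smult)
    finally have "S' \<otimes> (S \<otimes> (T \<otimes> (E \<otimes> F))) = S' \<otimes> F" by simp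
    then show ?thesis by (simp add: m_assoc[symmetric] S'S)
  qed
  define v2 v3 v4 v5 v6 where
    v: "v2 = T \<otimes> z" "v3 = F \<otimes> z" "v4 = S \<otimes> (T \<otimes> z)" "v5 = S \<otimes> (F \<otimes> z)" "v6 = E \<otimes> (F \<otimes> z)"
  have vcl [simp]: "v2 \<in> carrier A" "v3 \<in> carrier A" "v4 \<in> carrier A" "v5 \<in> carrier A" "v6 \<in> carrier A"
    by (auto simp: v)
  have T2: "T \<otimes> v2 = z \<oplus> h \<odot> v2 \<oplus> (- h * \<nu>) \<odot> v3"
    using s_s[OF i1 z] by (simp add: v h_def defs)
  have T3: "T \<otimes> v3 = \<nu> \<odot> v3"
    unfolding v by (simp add: m_assoc[symmetric] TF mult_smult_left)
  have T4: "T \<otimes> v4 = q \<odot> v4"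
  proof -
    have "T \<otimes> v4 = (T \<otimes> (S \<otimes> T)) \<otimes> z" by (simp add: v m_assoc)
    then show ?thesis unfolding br by (simp add: v m_assoc Sz mult_smult_right)
  qed
  have T5: "T \<otimes> v5 = v6"
  proof -
    have "T \<otimes> v5 = (T \<otimes> S \<otimes> F) \<otimes> z" by (simp add: v m_assoc)
    then show ?thesis unfolding TSF' by (simp add: v m_assoc)
  qed
  have T6: "T \<otimes> v6 = v5 \<oplus> (- h) \<odot> v3 \<oplus> h \<odot> v6"
  proof -
    have "T \<otimes> v6 = (T \<otimes> (E \<otimes> F)) \<otimes> z" by (simp add: v m_assoc)
    also have "\<dots> = S' \<otimes> v3" unfolding TEF by (simp add: v m_assoc)
    also have "S' = S \<oplus> (- h) \<odot> \<one> \<oplus> h \<odot> E"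
      using skein[OF i2] by (simp add: defs h_def)
    also have "\<dots> \<otimes> v3 = v5 \<oplus> (- h) \<odot> v3 \<oplus> h \<odot> v6"
      by (simp add: l_distr mult_smult_left v)
    finally show ?thesis .
  qed
  \<comment> \<open>\<open>E T z\<close> is no further coordinate: writing \<open>q z\<close> as
    \<open>S z\<close> gives \<open>E T S z = T S F z = E F z\<close>.\<close>
  have E2: "E \<otimes> v2 = inverse q \<odot> v6"
  proof (rule smult_right_cancel)
    have "q \<odot> (E \<otimes> v2) = (E \<otimes> (T \<otimes> S)) \<otimes> z"
      by (simp add: v m_assoc Sz mult_smult_right)
    also have "\<dots> = q \<odot> (inverse q \<odot> v6)"
      unfolding TSF[symmetric] TSF' using q_nonzero by (simp add: v m_assoc smult_smult)
    finally show "q \<odot> (E \<otimes> v2) = q \<odot> (inverse q \<odot> v6)" .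
  qed (use q_nonzero in auto)
  define B where "B = (q ^ (i - 1))\<^sup>2"
  have Bq: "(q ^ i)\<^sup>2 = B * q\<^sup>2"
  proof -
    have "q ^ i = q ^ (i - 1) * q" using i by (metis i1 atLeastAtMost_iff le_add_diff_inverse2 power_add power_one_right)
    then show ?thesis by (simp add: B_def power_mult_distrib)
  qed
  define al be ga de where
    co: "al = (B - 1) / (q - inverse q)" "be = (B - 1) / (1 - inverse \<nu> * inverse q * B)"
      "ga = (B * q\<^sup>2 - 1) / (q - inverse q)"
      "de = (B * q\<^sup>2 - 1) / (1 - inverse \<nu> * inverse q * (B * q\<^sup>2))"
  \<comment> \<open>\<open>v6\<close> arises twice in \<open>y\<close>: from
    \<open>E T z = v6 / q\<close> and from \<open>E F z = v6\<close>.\<close>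
  define c where "c = be * (ga / q) + be * de"
  define y where "y = (\<one> \<oplus> al \<odot> S \<oplus> be \<odot> E) \<otimes> ((\<one> \<oplus> ga \<odot> T \<oplus> de \<odot> F) \<otimes> z)"
  have ycl [simp]: "y \<in> carrier A" by (simp add: y_def)
  have y: "y = (1 + al * q) \<odot> z \<oplus> ga \<odot> v2 \<oplus> de \<odot> v3 \<oplus> (al * ga) \<odot> v4 \<oplus> (al * de) \<odot> v5 \<oplus> c \<odot> v6"
  proof -
    have *: "(\<one> \<oplus> ga \<odot> T \<oplus> de \<odot> F) \<otimes> z = z \<oplus> ga \<odot> v2 \<oplus> de \<odot> v3"
      by (simp add: l_distr mult_smult_left v)
    have "(be * (ga * inverse q) + be * de) \<odot> v6 = (be * (ga * inverse q)) \<odot> v6 \<oplus> (be * de) \<odot> v6"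
      by (simp add: smult_add_left)
    moreover have "(1 + al * q) \<odot> z = z \<oplus> (al * q) \<odot> z"
      by (simp add: smult_add_left)
    moreover have "S \<otimes> v2 = v4" "S \<otimes> v3 = v5" "E \<otimes> v3 = v6" by (simp_all add: v)
    ultimately show ?thesis
      unfolding y_def * c_def divide_inverse
      by (simp add: l_distr r_distr mult_smult_left mult_smult_right smult_smult smult_add_right
          Sz Ez E2 a_ac mult_ac)
  qed
  have q1: "ga = q * (1 + al * q)"
    unfolding co using h_nonzero q_nonzero by (simp add: field_simps power2_eq_square)
  then have q2: "1 + al * q + ga * h = q * ga"
    using q_nonzero unfolding h_def by (simp add: field_simps)
  have coef: "c = q * (al * de) \<and> de * \<nu> - ga * h * \<nu> - c * h = q * de"
    if "\<not> (\<forall>i\<in>{1..n}. k i = \<zero>)"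
  proof -
    have nu: "\<nu> \<noteq> q ^ (2 * j - 1)" if "j \<in> {1..n}" for j
      using nondegenerate that \<open>\<not> (\<forall>i\<in>{1..n}. k i = \<zero>)\<close> by blast
    obtain j where j: "i = j + 2" using i by (metis atLeastAtMost_iff le_Suc_ex add.commute)
    \<comment> \<open>The two poles are excluded by nondegeneracy at \<open>i - 1\<close> and at
      \<open>i\<close>; the index \<open>j = i - 2\<close> removes the truncated
      subtractions.\<close>
    have "q ^ (2 * (i - 1) - 1) * q = B" "q ^ (2 * i - 1) = B * q"
      by (simp_all add: B_def j power_add power2_eq_square mult_ac power_mult)
    then have "\<nu> * q \<noteq> B" and "\<nu> \<noteq> B * q"
      using nu[OF i1] nu[OF i2] q_nonzero by (metis mult_right_cancel, metis)
    then show ?thesis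
      using baxter_coefficients[OF co c_def] by (simp add: h_def)
  qed
  \<comment> \<open>In this case \<open>\<nu>\<close> may sit at a pole and the scalar identities
    may fail, but only the coordinates \<open>z\<close>, \<open>v2\<close>, \<open>v4\<close>
    survive.\<close>
  have fvan: "v3 = \<zero> \<and> v5 = \<zero> \<and> v6 = \<zero>" if "\<forall>i\<in>{1..n}. k i = \<zero>"
  proof -
    have "F = \<zero>" using that i1 by (simp add: defs(4))
    then show ?thesis by (simp add: v)
  qed
  have "T \<otimes> y = (1 + al * q) \<odot> v2 \<oplus> ga \<odot> (z \<oplus> h \<odot> v2 \<oplus> (- h * \<nu>) \<odot> v3) \<oplus> de \<odot> (\<nu> \<odot> v3)
      \<oplus> (al * ga) \<odot> (q \<odot> v4) \<oplus> (al * de) \<odot> v6 \<oplus> c \<odot> (v5 \<oplus> (- h) \<odot> v3 \<oplus> h \<odot> v6)"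
    unfolding y by (simp add: r_distr mult_smult_right T2 T3 T4 T5 T6 v(1)[symmetric])
  also have "\<dots> = ga \<odot> z \<oplus> (1 + al * q + ga * h) \<odot> v2 \<oplus> (de * \<nu> - ga * h * \<nu> - c * h) \<odot> v3
      \<oplus> (q * (al * ga)) \<odot> v4 \<oplus> c \<odot> v5 \<oplus> (al * de + c * h) \<odot> v6"
  proof -
    have 1: "(1 + al * q + ga * h) \<odot> v2 = (1 + al * q) \<odot> v2 \<oplus> (ga * h) \<odot> v2"
      by (simp only: smult_add_left vcl)
    have 2: "(de * \<nu> - ga * h * \<nu> - c * h) \<odot> v3 = (de * \<nu>) \<odot> v3 \<oplus> (ga * (- h * \<nu>)) \<odot> v3 \<oplus> (c * (- h)) \<odot> v3"
      by (simp add: smult_add_left[symmetric] algebra_simps)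
    have 3: "(al * de + c * h) \<odot> v6 = (al * de) \<odot> v6 \<oplus> (c * h) \<odot> v6"
      by (simp only: smult_add_left vcl)
    have 4: "q * (al * ga) = al * ga * q" by simp
    show ?thesis unfolding 1 2 3 4
      by (simp add: smult_add_right smult_smult a_ac)
  qed
  also have "\<dots> = (q * (1 + al * q)) \<odot> z \<oplus> (q * ga) \<odot> v2 \<oplus> (q * de) \<odot> v3
      \<oplus> (q * (al * ga)) \<odot> v4 \<oplus> (q * (al * de)) \<odot> v5 \<oplus> (q * c) \<odot> v6"
  proof (cases "\<forall>i\<in>{1..n}. k i = \<zero>")
    case True
    then show ?thesis using fvan q1 q2 by simp
  next
    case False
    then have c: "c = q * (al * de)" "de * \<nu> - ga * h * \<nu> - c * h = q * de" using coef by auto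
    have "al * de + c * h = q * c"
      unfolding c(1) h_def using q_nonzero by (simp add: field_simps)
    then show ?thesis using c q1 q2 by metis
  qed
  also have "\<dots> = q \<odot> y"
    unfolding y by (simp add: smult_add_right smult_smult)
  finally have Ty: "T \<otimes> y = q \<odot> y" .
  have "bax (i - 1) (q ^ (i - 1)) \<otimes> (bax i (q ^ i) \<otimes> z) =
      (inverse (q ^ (i - 1)) * inverse (q ^ i)) \<odot> y"
    unfolding bax_def B_def[symmetric] Bq co[symmetric] defs[symmetric] y_def
    by (simp add: mult_smult_left mult_smult_right smult_smult mult.commute)
  then show ?thesis
    using Ty by (simp add: defs[symmetric] mult_smult_right smult_smult mult.commute)
qed


section \<open>One more symmetry for each multiplication by the shuffle\<close>

abbreviation bax_prod :: "nat list \<Rightarrow> 'a \<Rightarrow> 'a" where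
  "bax_prod is x \<equiv> foldr (\<lambda>i y. bax i (q ^ i) \<otimes> y) is x"

lemma bax_prod_closed [simp]:
  "set is \<subseteq> {1..n} \<Longrightarrow> x \<in> carrier A \<Longrightarrow> bax_prod is x \<in> carrier A"
  by (induction "is") auto

lemma bax_prod_mult:
  "set is \<subseteq> {1..n} \<Longrightarrow> x \<in> carrier A \<Longrightarrow> y \<in> carrier A \<Longrightarrow>
    bax_prod is x \<otimes> y = bax_prod is (x \<otimes> y)"
  by (induction "is") (auto simp: m_assoc)

lemma Y_closed [simp]: "Y \<in> carrier A"
  unfolding Y_def shuffle_def by (rule bax_prod_closed) auto

lemma Y_mult:
  assumes "x \<in> carrier A" shows "Y \<otimes> x = bax_prod [1..<n + 1] x"
proof -
  have "set [1..<n + 1] \<subseteq> {1..n}" by auto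
  from bax_prod_mult[OF this, of \<one> x] show ?thesis
    using assms by (simp add: Y_def shuffle_def)
qed

lemma s_bax_prod:
  assumes j: "j \<in> {1..n}" and x: "x \<in> carrier A" "s j \<otimes> x = q \<odot> x"
    and "set is \<subseteq> {1..n}" "\<And>i. i \<in> set is \<Longrightarrow> i + 1 < j \<or> j + 1 < i"
  shows "s j \<otimes> bax_prod is x = q \<odot> bax_prod is x"
  using assms(4,5)
proof (induction "is")
  case Nil
  then show ?case using x by simp
next
  case (Cons i "is")
  have i: "i \<in> {1..n}" using Cons.prems by simp
  have cl [simp]: "s j \<in> carrier A" "bax i (q ^ i) \<in> carrier A" "bax_prod is x \<in> carrier A"
    using i j s_closed Cons.prems x by auto
  have com: "s j \<otimes> bax i (q ^ i) = bax i (q ^ i) \<otimes> s j"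
    using comm_s_bax[OF j i] Cons.prems(2)[of i] by (auto simp: comm_def)
  have "s j \<otimes> (bax i (q ^ i) \<otimes> bax_prod is x) = bax i (q ^ i) \<otimes> (s j \<otimes> bax_prod is x)"
    by (simp add: m_assoc[symmetric] com)
  then show ?case
    using Cons by (simp add: mult_smult_right)
qed

text \<open>For \<open>j = 1\<close> the leftmost factor is already a multiple of the projector for
  \<open>s 1\<close>. For \<open>j > 1\<close> the factors to the right of \<open>bax j\<close>
  commute with \<open>s (j - 1)\<close>, which fixes \<open>x\<close> up to \<open>q\<close> because
  \<open>j - 1 \<le> m\<close>; \<open>s_bax_bax\<close> converts this into symmetry under
  \<open>s j\<close>, which in turn commutes with the factors to the left of
  \<open>bax (j - 1)\<close>.\<close>

lemma lsym_Y_mult: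
  assumes m: "m < n" and x: "lsym m x"
  shows "lsym (Suc m) (Y \<otimes> x)"
  unfolding lsym_def
proof (intro conjI ballI)
  have xA: "x \<in> carrier A" using x by (simp add: lsym_def)
  then show "Y \<otimes> x \<in> carrier A" by simp
  fix j assume j: "j \<in> {1..Suc m}"
  then have jn: "j \<in> {1..n}" using m by auto
  show "s j \<otimes> (Y \<otimes> x) = q \<odot> (Y \<otimes> x)"
  proof (cases "j = 1")
    case True
    define z where "z = bax_prod [2..<n + 1] x"
    have z: "z \<in> carrier A" unfolding z_def using xA by (intro bax_prod_closed) auto
    have "[1..<n + 1] = 1 # [2..<n + 1]"
      using n_pos by (simp add: upt_conv_Cons numeral_2_eq_2)
    then have Yx: "Y \<otimes> x = bax 1 q \<otimes> z"
      using Y_mult[OF xA] by (simp add: z_def)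
    have "1 \<in> {1..n}" using n_pos by simp
    note cl = s_closed[OF this] bax_closed[OF this, of q]
    have "s 1 \<otimes> (bax 1 q \<otimes> z) = (s 1 \<otimes> bax 1 q) \<otimes> z"
      by (rule m_assoc[OF cl z, symmetric])
    also have "\<dots> = q \<odot> (bax 1 q \<otimes> z)"
      unfolding s_bax_q[OF \<open>1 \<in> {1..n}\<close>] by (rule mult_smult_left[OF cl(2) z])
    finally show ?thesis using Yx True by simp
  next
    case False
    then have j2: "j \<in> {2..n}" and j1: "j - 1 \<in> {1..n}" "j - 1 \<in> {1..m}" using j jn by auto
    define z where "z = bax_prod [j + 1..<n + 1] x"
    define w where "w = bax (j - 1) (q ^ (j - 1)) \<otimes> (bax j (q ^ j) \<otimes> z)"
    have z: "z \<in> carrier A" unfolding z_def using xA by (intro bax_prod_closed) auto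
    have w: "w \<in> carrier A" unfolding w_def using z j1 jn by simp
    have "s (j - 1) \<otimes> z = q \<odot> z"
      unfolding z_def using x j1 by (intro s_bax_prod) (auto simp: lsym_def)
    then have sw: "s j \<otimes> w = q \<odot> w"
      unfolding w_def by (rule s_bax_bax[OF j2 z])
    have "[1..<n + 1] = [1..<j - 1] @ [j - 1..<n + 1]"
    proof -
      have "1 \<le> j - 1" using j2 by auto
      from upt_add_eq_append[OF this, of "n + 1 - (j - 1)"] show ?thesis
        using j2 by (simp del: upt_Suc)
    qed
    moreover have "[j - 1..<n + 1] = (j - 1) # j # [j + 1..<n + 1]"
    proof -
      have "j - 1 < n + 1" "j < n + 1" "Suc (j - 1) = j" using j2 by auto
      then show ?thesis by (metis upt_conv_Cons Suc_eq_plus1)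
    qed
    ultimately have "Y \<otimes> x = bax_prod [1..<j - 1] w"
      using Y_mult[OF xA] by (simp add: z_def w_def)
    moreover have "s j \<otimes> bax_prod [1..<j - 1] w = q \<odot> bax_prod [1..<j - 1] w"
      using j2 by (intro s_bax_prod[OF jn w sw]) auto
    ultimately show ?thesis by simp
  qed
qed

lemma lsym_Y_pow: "m \<le> n \<Longrightarrow> lsym m (Y [^] m)"
proof (induction m)
  case (Suc m)
  then have "lsym (Suc m) (Y \<otimes> Y [^] m)" by (intro lsym_Y_mult) auto
  then show ?case by (simp only: nat_pow_Suc2[OF Y_closed])
qed (simp add: lsym_def)

section \<open>The eigenvalue on fully symmetric elements\<close>

definition N :: 'k where "N = qfact q (n + 1)"

lemma N_nonzero: "N \<noteq> 0"
proof -
  have "qnum q 1 = 1" using h_nonzero by (simp add: qnum_def)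
  moreover have "qnum q i \<noteq> 0" if "i \<in> {1..n + 1}" for i
    using qnum_nonzero[of i] that calculation by (cases "i = 1") auto
  ultimately show ?thesis by (simp add: N_def qfact_def)
qed

text \<open>The factors of the shuffle contribute \<open>[2]_q, ..., [m + 1]_q\<close>; the missing
  \<open>[1]_q\<close> equals 1.\<close>

lemma qfact_eq: "m \<le> n \<Longrightarrow> (\<Prod>i\<leftarrow>[1..<m + 1]. qnum q (i + 1)) = qfact q (m + 1)"
proof (induction m)
  case 0
  then show ?case using h_nonzero by (simp add: qfact_def qnum_def)
next
  case (Suc m)
  then show ?case by (simp add: qfact_def)
qed

lemma bax_prod_lsym:
  assumes x: "lsym n x"
  shows "set is \<subseteq> {1..n} \<Longrightarrow> bax_prod is x = (\<Prod>i\<leftarrow>is. qnum q (i + 1)) \<odot> x"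
proof (induction "is")
  case (Cons i "is")
  then have "bax i (q ^ i) \<otimes> x = qnum q (i + 1) \<odot> x"
    using x by (intro bax_lsym) (auto simp: lsym_def)
  then show ?case using Cons x
    by (simp add: lsym_def mult_smult_right smult_smult mult.commute)
qed (use x in \<open>simp add: lsym_def\<close>)

lemma Y_lsym:
  assumes x: "lsym n x"
  shows "Y \<otimes> x = N \<odot> x"
proof -
  have "Y \<otimes> x = bax_prod [1..<n + 1] x" using x by (intro Y_mult) (simp add: lsym_def)
  also have "\<dots> = (\<Prod>i\<leftarrow>[1..<n + 1]. qnum q (i + 1)) \<odot> x"
    by (rule bax_prod_lsym[OF x]) auto
  finally show ?thesis using qfact_eq[of n] by (simp add: N_def)
qed

text \<open>Each relation is a palindrome, has sides that reversal exchanges, or is paired with its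
  mirror image, as \<open>s_t\<close> with \<open>t_s\<close> and \<open>k_s\<close> with
  \<open>s_k\<close>.\<close>

lemma opposite: "bmw_relations (opalg A) s t k q \<nu> n"
proof (intro bmw_relations.intro bmw_relations_axioms.intro)
  show "kalgebra (opalg A)" by (rule kalgebra_opalg)
next
  fix i j assume "i \<in> {1..n}" "j \<in> {1..n}" "i + 1 < j"
  then show "s i \<otimes>\<^bsub>opalg A\<^esub> s j = s j \<otimes>\<^bsub>opalg A\<^esub> s i" using far[of i j] by simp
next
  fix i assume i: "i \<in> {2..n}"
  define p where "p = i - 1"
  have i1: "i \<in> {1..n}" "p \<in> {1..n}" using i by (auto simp: p_def)
  note [simp] = s_closed[OF i1(1)] k_closed[OF i1(1)] s_closed[OF i1(2)] t_closed[OF i1(2)]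
  show "k i \<otimes>\<^bsub>opalg A\<^esub> (s (i - 1) \<otimes>\<^bsub>opalg A\<^esub> k i) = inverse \<nu> \<odot>\<^bsub>opalg A\<^esub> k i"
    "k i \<otimes>\<^bsub>opalg A\<^esub> (t (i - 1) \<otimes>\<^bsub>opalg A\<^esub> k i) = \<nu> \<odot>\<^bsub>opalg A\<^esub> k i"
    "s i \<otimes>\<^bsub>opalg A\<^esub> (s (i - 1) \<otimes>\<^bsub>opalg A\<^esub> s i) = s (i - 1) \<otimes>\<^bsub>opalg A\<^esub> (s i \<otimes>\<^bsub>opalg A\<^esub> s (i - 1))"
    using ksk[OF i] ktk[OF i] braid[OF i] unfolding p_def[symmetric] by (simp_all add: m_assoc)
qed (use n_pos q_nonzero q2 nu_nonzero qnum_nonzero s_closed t_closed k_closed s_t t_s skein k_s s_k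
      nondegenerate in \<open>simp_all\<close>)

end

section \<open>Symmetry from the right through the opposite algebra\<close>

context bmw_relations
begin

interpretation op: bmw_relations "opalg A" s t k q \<nu> n
  by (rule opposite)

lemma op_bax: "op.bax = bax"
  by (intro ext) (simp add: op.bax_def bax_def)

lemma op_lsym: "op.lsym = rsym"
  by (intro ext) (simp add: op.lsym_def rsym_def)

lemma bax_rsym:
  assumes "rsym n x" "i \<in> {1..n}"
  shows "x \<otimes> bax i (q ^ m) = qnum q (m + 1) \<odot> x"
  using op.bax_lsym[of i x m] assms by (simp add: op_bax rsym_def)

text \<open>The mirror image of \<open>Y_lsym\<close> would concern \<open>op.Y\<close>, where the
  factors stand in reverse order. For \<open>Y\<close> itself the scalars are collected from the
  leftmost factor onwards, and their product does not depend on the order.\<close>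

lemma Y_rsym:
  assumes x: "rsym n x"
  shows "x \<otimes> Y = N \<odot> x"
proof -
  have xA: "x \<in> carrier A" using x by (simp add: rsym_def)
  have *: "set is \<subseteq> {1..n} \<Longrightarrow> x \<otimes> bax_prod is \<one> = (\<Prod>i\<leftarrow>is. qnum q (i + 1)) \<odot> x" for "is"
  proof (induction "is")
    case (Cons i "is")
    have "x \<otimes> (bax i (q ^ i) \<otimes> bax_prod is \<one>) = (x \<otimes> bax i (q ^ i)) \<otimes> bax_prod is \<one>"
      using Cons.prems xA by (simp add: m_assoc)
    also have "\<dots> = qnum q (i + 1) \<odot> (x \<otimes> bax_prod is \<one>)"
      using Cons.prems xA bax_rsym[OF x, of i i] by (simp add: mult_smult_left)
    finally show ?case using Cons xA by (simp add: smult_smult)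
  qed (use xA in simp)
  have "x \<otimes> bax_prod [1..<n + 1] \<one> = (\<Prod>i\<leftarrow>[1..<n + 1]. qnum q (i + 1)) \<odot> x"
    by (rule *) auto
  then show ?thesis unfolding qfact_eq[OF order_refl] Y_def shuffle_def N_def .
qed

end

context bmw_relations
begin

interpretation op: bmw_relations "opalg A" s t k q \<nu> n
  by (rule opposite)

lemma op_Y_closed: "op.Y \<in> carrier A"
  using op.Y_closed by simp

text \<open>\<open>Y_rsym\<close> read in the opposite algebra. The interpretation is repeated in a
  new context so that \<open>Y_rsym\<close> is among its facts.\<close>

lemma op_Y_lsym: "lsym n x \<Longrightarrow> op.Y \<otimes> x = N \<odot> x"
proof -
  assume x: "lsym n x"
  have "op.rsym n x" using x by (simp add: op.rsym_def lsym_def)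
  from op.Y_rsym[OF this] show ?thesis by simp
qed

text \<open>\<open>P\<close>, the power of the reversed shuffle, is symmetric from the right and
  \<open>Y^n\<close> from the left. Hence \<open>P Y^n\<close> equals \<open>N^n P\<close> when
  \<open>Y^n\<close> is absorbed and \<open>N^n Y^n\<close> when \<open>P\<close> is absorbed, and
  \<open>N \<noteq> 0\<close> gives \<open>P = Y^n\<close>.\<close>

lemma rsym_Y_pow: "rsym n (Y [^] n)"
proof -
  define P where "P = op.Y [^]\<^bsub>opalg A\<^esub> n"
  have P: "rsym n P" using op.lsym_Y_pow[of n] by (simp add: P_def op_lsym)
  have PA: "P \<in> carrier A" using P by (simp add: rsym_def)
  have Y: "lsym n (Y [^] n)" by (rule lsym_Y_pow) simp
  have YA: "Y [^] n \<in> carrier A" by simp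
  have "P \<otimes> Y [^] m = N ^ m \<odot> P" for m
  proof (induction m)
    case (Suc m)
    have "P \<otimes> Y [^] Suc m = (P \<otimes> Y [^] m) \<otimes> Y" using PA by (simp add: m_assoc)
    then show ?case using Suc Y_rsym[OF P] PA by (simp add: mult_smult_left smult_smult mult.commute)
  qed (use PA in simp)
  moreover have "(op.Y [^]\<^bsub>opalg A\<^esub> m) \<otimes> Y [^] n = N ^ m \<odot> Y [^] n" for m
  proof (induction m)
    case (Suc m)
    have c: "op.Y [^]\<^bsub>opalg A\<^esub> m \<in> carrier A" using op.nat_pow_closed[OF op.Y_closed, of m] by simp
    have "(op.Y [^]\<^bsub>opalg A\<^esub> Suc m) \<otimes> Y [^] n = op.Y \<otimes> ((op.Y [^]\<^bsub>opalg A\<^esub> m) \<otimes> Y [^] n)"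
      using c op_Y_closed by (simp add: m_assoc)
    then show ?case
      using Suc op_Y_lsym[OF Y] op_Y_closed by (simp add: mult_smult_right smult_smult mult.commute)
  qed simp
  ultimately have "N ^ n \<odot> P = N ^ n \<odot> Y [^] n"
    unfolding P_def by metis
  then have "P = Y [^] n"
    by (rule smult_right_cancel) (use PA N_nonzero in auto)
  then show ?thesis using P by simp
qed

end

section \<open>Polynomials in an algebra element\<close>

context kalgebra
begin

lemma poly_eval_upto:
  assumes a: "a \<in> carrier A" and "degree p \<le> m"
  shows "poly_eval A p a = (\<Oplus>i\<in>{..m}. poly.coeff p i \<odot> (a [^] i))"
  unfolding poly_eval_def
  by (rule add.finprod_mono_neutral_cong_left)
    (use assms in \<open>auto simp: coeff_eq_0\<close>)

lemma poly_eval_add: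
  assumes a: "a \<in> carrier A"
  shows "poly_eval A (p + r) a = poly_eval A p a \<oplus> poly_eval A r a"
proof -
  define m where "m = max (degree p) (degree r)"
  have "degree p \<le> m" "degree r \<le> m" "degree (p + r) \<le> m"
    by (auto simp: m_def degree_add_le_max)
  note e = this[THEN poly_eval_upto[OF a]]
  show ?thesis unfolding e
    using a by (simp add: smult_add_left finsum_addf)
qed

lemma poly_eval_monom:
  assumes a: "a \<in> carrier A"
  shows "poly_eval A (monom c i) a = c \<odot> (a [^] i)"
proof -
  have "poly_eval A (monom c i) a = (\<Oplus>j\<in>{..i}. poly.coeff (monom c i) j \<odot> (a [^] j))"
    using a by (rule poly_eval_upto) (rule degree_monom_le)
  also have "\<dots> = (\<Oplus>j\<in>{..i}. if i = j then c \<odot> (a [^] j) else \<zero>)"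
    using a by (intro finsum_cong') auto
  also have "\<dots> = c \<odot> (a [^] i)"
    using a by (intro add.finprod_singleton) auto
  finally show ?thesis .
qed

end

lemma min_poly_eq:
  "[:0, 1:] ^ n * ([:0, 1:] - [:c:]) = monom 1 (Suc n) + monom (- c) n" for c :: "'k::field"
proof -
  have "[:0, 1:] ^ n * ([:0, 1:] - [:c:]) = monom 1 n * (monom 1 1 + monom (- c) 0)"
    by (simp add: monom_altdef)
  also have "\<dots> = monom 1 (Suc n) + monom (- c) n"
    by (simp only: distrib_left mult_monom) simp
  finally show ?thesis .
qed

lemma degree_min_poly:
  fixes c :: "'k::field"
  shows "degree (monom 1 (Suc n) + monom c n) = Suc n" "lead_coeff (monom 1 (Suc n) + monom c n) = 1"
proof -
  have "degree (monom c n) < degree (monom (1::'k) (Suc n))"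
    using degree_monom_le[of c n] by (simp add: degree_monom_eq)
  then show *: "degree (monom 1 (Suc n) + monom c n) = Suc n"
    by (simp add: degree_add_eq_left degree_monom_eq)
  show "lead_coeff (monom 1 (Suc n) + monom c n) = 1" unfolding * by simp
qed


section \<open>The shuffle in an algebra generated by the braid generators\<close>

text \<open>\<open>generated\<close> is the spanning of the algebra by words, as an induction
  principle that prepends letters. \<open>independent\<close> isolates the only fact that needs a
  representation; everything in this locale is formal from these two.\<close>

locale bmw_generated = bmw_relations +
  assumes generated: "\<And>M. \<lbrakk>\<one> \<in> M; \<And>x y. \<lbrakk>x \<in> carrier A; y \<in> carrier A; x \<in> M; y \<in> M\<rbrakk> \<Longrightarrow> x \<oplus> y \<in> M;
      \<And>c x. \<lbrakk>x \<in> carrier A; x \<in> M\<rbrakk> \<Longrightarrow> c \<odot> x \<in> M;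
      \<And>i x. \<lbrakk>i \<in> {1..n}; x \<in> carrier A; x \<in> M\<rbrakk> \<Longrightarrow> s i \<otimes> x \<in> M;
      \<And>i x. \<lbrakk>i \<in> {1..n}; x \<in> carrier A; x \<in> M\<rbrakk> \<Longrightarrow> t i \<otimes> x \<in> M\<rbrakk> \<Longrightarrow> carrier A \<subseteq> M"
    and independent: "\<And>r. r \<noteq> 0 \<Longrightarrow> poly_eval A r Y = \<zero> \<Longrightarrow> n + 1 \<le> degree r"
begin

section \<open>The symmetrizer\<close>

definition S :: 'a where "S = inverse (N ^ n) \<odot> Y [^] n"

lemma S_closed [simp]: "S \<in> carrier A" by (simp add: S_def)

lemma Y_pow_eq: "Y [^] n = N ^ n \<odot> S"
  using N_nonzero by (simp add: S_def smult_smult)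

lemma lsym_S: "lsym n S" and rsym_S: "rsym n S"
  using lsym_Y_pow[of n] rsym_Y_pow s_closed
  by (auto simp: lsym_def rsym_def S_def mult_smult_left mult_smult_right smult_smult mult.commute)

lemma Y_S: "Y \<otimes> S = N \<odot> S" by (rule Y_lsym[OF lsym_S])
lemma S_Y: "S \<otimes> Y = N \<odot> S" by (rule Y_rsym[OF rsym_S])

lemma comm_S_Y: "comm S Y" by (simp add: comm_def Y_S S_Y)

lemma Y_pow_lsym:
  assumes x: "lsym n x" shows "Y [^] m \<otimes> x = N ^ m \<odot> x"
proof (induction m)
  case (Suc m)
  have xA: "x \<in> carrier A" using x by (simp add: lsym_def)
  have "Y [^] Suc m \<otimes> x = Y [^] m \<otimes> (Y \<otimes> x)" using xA by (simp add: m_assoc)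
  then show ?case using Suc xA by (simp add: Y_lsym[OF x] mult_smult_right smult_smult)
qed (use x in \<open>simp add: lsym_def\<close>)

lemma S_lsym:
  assumes x: "lsym n x" shows "S \<otimes> x = x"
  using Y_pow_lsym[OF x, of n] x N_nonzero
  by (simp add: S_def lsym_def mult_smult_left smult_smult)

lemma S_S: "S \<otimes> S = S" by (rule S_lsym[OF lsym_S])

text \<open>Otherwise \<open>t^n\<close>, whose degree is below the bound of
  \<open>independent\<close>, would annihilate \<open>Y\<close>.\<close>

lemma S_nonzero: "S \<noteq> \<zero>"
proof
  assume "S = \<zero>"
  then have "poly_eval A (monom 1 n) Y = \<zero>"
    using Y_pow_eq by (simp add: poly_eval_monom)
  moreover have "monom (1::'b) n \<noteq> 0" by simp
  ultimately have "n + 1 \<le> degree (monom (1::'b) n)" using independent by blast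
  then show False by (simp add: degree_monom_eq)
qed

text \<open>\<open>S\<close> absorbs generators and their inverses on its right at the cost of the
  factors \<open>q\<close> and \<open>q^{-1}\<close>, so the right ideal it generates is a line.
  Uniqueness of the symmetrizer and simplicity of the eigenvalue both rest on this.\<close>

lemma S_mult:
  assumes "x \<in> carrier A" shows "\<exists>c. S \<otimes> x = c \<odot> S"
proof -
  let ?M = "{x. \<exists>c. S \<otimes> x = c \<odot> S}"
  have "carrier A \<subseteq> ?M"
  proof (rule generated)
    show "\<one> \<in> ?M" by (auto intro!: exI[of _ 1])
  next
    fix x y assume "x \<in> carrier A" "y \<in> carrier A" "x \<in> ?M" "y \<in> ?M"
    then obtain c d where "S \<otimes> (x \<oplus> y) = (c + d) \<odot> S"
      by (auto simp: r_distr smult_add_left)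
    then show "x \<oplus> y \<in> ?M" by auto
  next
    fix c x assume "x \<in> carrier A" "x \<in> ?M"
    then obtain d where "S \<otimes> (c \<odot> x) = (c * d) \<odot> S"
      by (auto simp: mult_smult_right smult_smult)
    then show "c \<odot> x \<in> ?M" by auto
  next
    fix i x assume i: "i \<in> {1..n}" and x: "x \<in> carrier A" "x \<in> ?M"
    then obtain c where c: "S \<otimes> x = c \<odot> S" by auto
    note [simp] = s_closed[OF i] t_closed[OF i] x(1)
    have Ss: "S \<otimes> s i = q \<odot> S" using rsym_S i by (simp add: rsym_def)
    have "S \<otimes> (s i \<otimes> x) = (S \<otimes> s i) \<otimes> x" by (simp add: m_assoc)
    also have "\<dots> = (q * c) \<odot> S" by (simp add: Ss mult_smult_left c smult_smult)
    finally show "s i \<otimes> x \<in> ?M" by auto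
    have "q \<odot> (S \<otimes> t i) = (S \<otimes> s i) \<otimes> t i" by (simp add: Ss mult_smult_left)
    also have "\<dots> = q \<odot> (inverse q \<odot> S)"
      using s_t[OF i] q_nonzero by (simp add: m_assoc smult_smult)
    finally have St: "S \<otimes> t i = inverse q \<odot> S"
      by (rule smult_right_cancel) (use q_nonzero in auto)
    have "S \<otimes> (t i \<otimes> x) = (S \<otimes> t i) \<otimes> x" by (simp add: m_assoc)
    also have "\<dots> = (inverse q * c) \<odot> S" by (simp add: St mult_smult_left c smult_smult)
    finally show "t i \<otimes> x \<in> ?M" by auto
  qed
  then show ?thesis using assms by auto
qed

text \<open>For a competitor \<open>S'\<close>, left symmetry gives \<open>S' = S S'\<close>, which
  is a multiple \<open>c S\<close>; idempotence gives \<open>c^2 = c\<close>, and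
  \<open>c = 0\<close> is excluded.\<close>

lemma symmetrizer_eq: "symmetrizer A s q n = S"
  unfolding symmetrizer_def
proof (rule the_equality)
  show "S \<in> carrier A \<and> S \<noteq> \<zero> \<and>
    (\<forall>i\<in>{1..n}. s i \<otimes> S = q \<odot> S \<and> S \<otimes> s i = q \<odot> S) \<and> S \<otimes> S = S"
    using lsym_S rsym_S S_nonzero S_S by (simp add: lsym_def rsym_def)
next
  fix S' assume S': "S' \<in> carrier A \<and> S' \<noteq> \<zero> \<and>
    (\<forall>i\<in>{1..n}. s i \<otimes> S' = q \<odot> S' \<and> S' \<otimes> s i = q \<odot> S') \<and> S' \<otimes> S' = S'"
  then have "S \<otimes> S' = S'" by (intro S_lsym) (simp add: lsym_def)
  with S' S_mult[of S'] obtain c where c: "S' = c \<odot> S" by auto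
  have "c \<noteq> 0" using S' c by auto
  have "(c * c) \<odot> S = c \<odot> S"
    using S' by (simp add: c mult_smult_left mult_smult_right smult_smult S_S)
  then have "c * c = c" using smult_left_eqD[of "c * c" S c] S_nonzero by auto
  then show "S' = S" using \<open>c \<noteq> 0\<close> c by simp
qed

theorem shuffle_annihilated: "Y [^] n \<otimes> (Y \<ominus> N \<odot> \<one>) = \<zero>"
proof -
  have "Y [^] n \<otimes> Y = N \<odot> Y [^] n"
    by (simp add: Y_pow_eq mult_smult_left S_Y smult_smult mult.commute)
  then show ?thesis by (simp add: minus_eq r_distr r_minus mult_smult_right r_neg)
qed

theorem shuffle_minimal_poly: "is_minimal_poly A Y ([:0, 1:] ^ n * ([:0, 1:] - [:N:]))"
proof -
  have "poly_eval A (monom 1 (Suc n) + monom (- N) n) Y = Y [^] n \<otimes> Y \<oplus> (- N) \<odot> Y [^] n"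
    by (simp add: poly_eval_add poly_eval_monom)
  also have "\<dots> = Y [^] n \<otimes> (Y \<ominus> N \<odot> \<one>)"
    by (simp add: to_smult r_distr mult_smult_right smult_smult)
  finally show ?thesis
    unfolding is_minimal_poly_def min_poly_eq degree_min_poly
    using independent by (simp add: shuffle_annihilated)
qed

section \<open>Semi-simplicity and the Jordan decomposition of the shuffle\<close>

lemma nilpotent_shuffle_quadratic: "nilpotent (Y \<otimes> (Y \<ominus> N \<odot> \<one>))"
proof -
  define Z where "Z = Y \<ominus> N \<odot> \<one>"
  have Z: "Z \<in> carrier A" by (simp add: Z_def)
  have "comm Y Z" unfolding Z_def by (intro comm_intros) auto
  then have "(Y \<otimes> Z) [^] n = Y [^] n \<otimes> Z [^] n"
    using Z by (simp add: comm_pow_mult)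
  also have "Z [^] n = Z \<otimes> Z [^] (n - 1)"
    using n_pos nat_pow_Suc2[OF Z, of "n - 1"] by simp
  also have "Y [^] n \<otimes> (Z \<otimes> Z [^] (n - 1)) = (Y [^] n \<otimes> Z) \<otimes> Z [^] (n - 1)"
    using Z by (simp add: m_assoc)
  also have "\<dots> = \<zero>" using shuffle_annihilated Z by (simp add: Z_def)
  finally show ?thesis by (auto simp: nilpotent_def Z_def)
qed

text \<open>Semi-simplicity would make \<open>t(t - N)\<close> an annihilating polynomial, whose
  degree 2 is less than \<open>n + 1\<close>.\<close>

theorem shuffle_not_semisimple:
  assumes "n > 1" shows "\<not> semisimple_element A Y"
proof
  assume "semisimple_element A Y"
  then have "Y \<otimes> (Y \<ominus> N \<odot> \<one>) = \<zero>"
    using semisimple_quadratic[OF _ Y_closed nilpotent_shuffle_quadratic] by blast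
  moreover have "poly_eval A (monom 1 (Suc 1) + monom (- N) 1) Y = Y \<otimes> (Y \<ominus> N \<odot> \<one>)"
    by (simp add: poly_eval_add poly_eval_monom to_smult r_distr mult_smult_right smult_smult)
  moreover have "degree (monom (1::'b) (Suc 1) + monom (- N) 1) = Suc 1"
    by (rule degree_min_poly)
  ultimately have "n + 1 \<le> Suc 1"
    using independent by (metis Suc_neq_Zero degree_0)
  then show False using assms by simp
qed

text \<open>All mixed terms collapse because \<open>Y S = S Y = N S\<close>. The induction starts at
  1, as the zeroth power would be the unit on the left but \<open>\<one> - S\<close> on the right.
  At \<open>m = n\<close> the right-hand side vanishes.\<close>

lemma shuffle_nilpotent_part:
  "m \<ge> 1 \<Longrightarrow> (Y \<ominus> N \<odot> S) [^] m = Y [^] m \<oplus> (- (N ^ m)) \<odot> S"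
proof (induction m rule: nat_induct_at_least)
  case base
  then show ?case by (simp add: to_smult smult_smult)
next
  case (Suc m)
  have SY: "S \<otimes> Y = N \<odot> S" "Y [^] m \<otimes> S = N ^ m \<odot> S"
    by (rule S_Y, rule Y_pow_lsym[OF lsym_S])
  have z: "(N * N ^ m) \<odot> S \<oplus> (- (N * N ^ m)) \<odot> S = \<zero>"
    by (simp add: smult_add_left[symmetric])
  have "(Y [^] m \<oplus> (- (N ^ m)) \<odot> S) \<otimes> (Y \<oplus> (- N) \<odot> S) =
    Y [^] m \<otimes> Y \<oplus> (- (N ^ m * N)) \<odot> S \<oplus> ((N ^ m * N) \<odot> S \<oplus> (- (N ^ m * N)) \<odot> S)"
    by (simp add: expand SY S_S a_ac mult.commute)
  then show ?case using Suc by (simp add: z to_smult smult_smult mult.commute)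
qed

lemma jordan_decomposition_shuffle: "jordan_decomposition A Y (N \<odot> S) (Y \<ominus> N \<odot> S)"
proof -
  have "(Y \<ominus> N \<odot> S) [^] n = \<zero>"
    unfolding shuffle_nilpotent_part[OF n_pos] Y_pow_eq
    by (simp add: smult_add_left[symmetric])
  moreover have "N \<odot> S \<oplus> (Y \<ominus> N \<odot> S) = Y"
    using S_closed Y_closed smult_closed[OF S_closed, of N] by algebra
  moreover have "comm (N \<odot> S) (Y \<ominus> N \<odot> S)"
    by (intro comm_intros comm_sym[OF comm_smult] comm_sym[OF comm_S_Y] comm_refl) auto
  ultimately show ?thesis
    unfolding jordan_decomposition_def comm_def
    using semisimple_idempotent[OF S_closed S_S] by auto
qed

text \<open>Uniqueness works over any field: for another decomposition \<open>Y = a + m\<close>, the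
  element \<open>a(a - N)\<close> differs from the nilpotent \<open>Y(Y - N)\<close> by a multiple
  of \<open>m\<close>, hence is nilpotent, hence zero by semi-simplicity of \<open>a\<close>. So
  \<open>a / N\<close> is an idempotent; it commutes with \<open>S\<close> and differs from it by a
  nilpotent element.\<close>

theorem shuffle_semisimple_part: "is_semisimple_part A Y (N \<odot> S)"
  unfolding is_semisimple_part_def
proof (intro conjI allI impI)
  show "\<exists>m. jordan_decomposition A Y (N \<odot> S) m" using jordan_decomposition_shuffle by blast
next
  fix a m assume "jordan_decomposition A Y a m"
  then have a [simp]: "a \<in> carrier A" and m [simp]: "m \<in> carrier A" and Yam: "Y = a \<oplus> m"
    and am: "comm a m" and ss: "semisimple_element A a" and nil: "nilpotent m"
    by (auto simp: jordan_decomposition_def comm_def nilpotent_def)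
  have aY: "comm a Y" and mY: "comm m Y"
    unfolding Yam using am comm_sym[OF am] by (auto intro: comm_add)
  \<comment> \<open>\<open>S\<close> is a multiple of a power of \<open>Y\<close>, and
    \<open>Y = a + m\<close> commutes with both summands.\<close>
  have aS: "comm a S" and mS: "comm m S"
    unfolding S_def using aY mY by (auto intro!: comm_intros)
  have a_eq: "a = Y \<oplus> (- 1) \<odot> m"
    unfolding Yam using smult_add_left[of m 1 "-1"] by (simp add: a_assoc)
  have nil': "nilpotent (a \<otimes> (a \<ominus> N \<odot> \<one>))"
  proof -
    \<comment> \<open>Obtained by substituting \<open>a = Y - m\<close> into the two factors of
      \<open>a(a - N)\<close> one after the other and collecting the multiples of
      \<open>m\<close>.\<close>
    define W where "W = (- 1) \<odot> (a \<ominus> N \<odot> \<one>) \<oplus> (- 1) \<odot> Y"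
    have "a \<otimes> (a \<ominus> N \<odot> \<one>) = Y \<otimes> (Y \<ominus> N \<odot> \<one>) \<oplus> m \<otimes> W"
    proof -
      have "m \<otimes> Y = Y \<otimes> m" using mY by (simp add: comm_def)
      moreover have "a \<ominus> N \<odot> \<one> = (Y \<ominus> N \<odot> \<one>) \<oplus> (- 1) \<odot> m"
        unfolding a_eq by (simp add: to_smult a_ac)
      moreover have "a \<otimes> (a \<ominus> N \<odot> \<one>) = Y \<otimes> (a \<ominus> N \<odot> \<one>) \<oplus> (- 1) \<odot> (m \<otimes> (a \<ominus> N \<odot> \<one>))"
        by (subst a_eq) (simp add: l_distr mult_smult_left)
      ultimately show ?thesis
        by (simp add: W_def r_distr mult_smult_right a_ac)
    qed
    moreover have Wcl: "W \<in> carrier A" by (simp add: W_def)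
    moreover have mW: "comm m W"
      unfolding W_def using mY comm_sym[OF am] by (intro comm_intros) auto
    moreover have "comm m (Y \<otimes> (Y \<ominus> N \<odot> \<one>))"
      using mY by (intro comm_intros) auto
    moreover have "comm Y W"
      unfolding W_def using comm_sym[OF aY] by (intro comm_intros) auto
    then have "comm W (Y \<otimes> (Y \<ominus> N \<odot> \<one>))"
      using Wcl comm_sym[of Y W] by (intro comm_intros) auto
    ultimately show ?thesis
      using nilpotent_shuffle_quadratic nil
      by (auto intro!: nilpotent_add nilpotent_mult comm_mult intro: comm_sym)
  qed
  have "a \<otimes> (a \<ominus> N \<odot> \<one>) = \<zero>"
    using semisimple_quadratic[OF ss a nil'] .
  then have "a \<otimes> a \<oplus> (- N) \<odot> a = \<zero>"
    by (simp add: to_smult r_distr mult_smult_right smult_smult)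
  then have aa: "a \<otimes> a = N \<odot> a"
    by (metis a m_closed minus_equality minus_minus smult_closed smult_uminus_left)
  define e where "e = inverse N \<odot> a"
  have e: "e \<in> carrier A" by (simp add: e_def)
  have "e = S"
  proof (rule commuting_idempotents_eq[OF e S_closed _ S_S])
    show "e \<otimes> e = e"
      using N_nonzero by (simp add: e_def mult_smult_left mult_smult_right smult_smult aa)
    show "comm e S" unfolding e_def using comm_sym[OF aS] by (intro comm_sym[OF comm_smult]) auto
    have "nilpotent ((Y \<ominus> N \<odot> S) \<oplus> (- 1) \<odot> m)"
    proof (rule nilpotent_add)
      show "nilpotent (Y \<ominus> N \<odot> S)"
        using jordan_decomposition_shuffle by (auto simp: jordan_decomposition_def nilpotent_def)
      show "nilpotent ((- 1) \<odot> m)" using nil by (rule nilpotent_smult) simp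
      have "comm m (Y \<ominus> N \<odot> S)" using mY mS by (intro comm_intros) auto
      then show "comm (Y \<ominus> N \<odot> S) ((- 1) \<odot> m)" by (intro comm_smult) (auto intro: comm_sym)
    qed auto
    then have "nilpotent (inverse N \<odot> ((Y \<ominus> N \<odot> S) \<oplus> (- 1) \<odot> m))" by (rule nilpotent_smult) simp
    \<comment> \<open>Since \<open>a + m = Y\<close>, the difference of the semi-simple parts is
      that of the nilpotent parts up to sign, and these commute.\<close>
    moreover have "inverse N \<odot> ((Y \<ominus> N \<odot> S) \<oplus> (- 1) \<odot> m) = e \<ominus> S"
    proof -
      have "(Y \<ominus> N \<odot> S) \<oplus> (- 1) \<odot> m = a \<oplus> (- N) \<odot> S"
        unfolding a_eq by (simp add: to_smult smult_smult a_ac)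
      then show ?thesis
        using N_nonzero by (simp add: e_def to_smult smult_add_right smult_smult)
    qed
    ultimately show "nilpotent (e \<ominus> S)" by simp
  qed
  moreover have "a = N \<odot> e" using N_nonzero by (simp add: e_def smult_smult)
  ultimately show "a = N \<odot> S" by simp
qed

text \<open>\<open>S\<close> commutes with \<open>D = Y - N\<close>, so a generalized eigenvector
  \<open>v\<close> splits into \<open>S v\<close>, a multiple of \<open>S\<close>, and a generalized
  eigenvector \<open>w\<close> with \<open>S w = 0\<close>; the latter must vanish.\<close>

lemma generalized_eigenspace_eq:
  "generalized_eigenspace A (\<lambda>x. Y \<otimes> x) N = range (\<lambda>c. c \<odot> S)"
proof
  define D where "D = Y \<oplus> (- N) \<odot> \<one>"
  have D [simp]: "D \<in> carrier A" by (simp add: D_def)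
  have Dx: "Y \<otimes> x \<ominus> N \<odot> x = D \<otimes> x" if "x \<in> carrier A" for x
    using that by (simp add: D_def to_smult smult_smult l_distr mult_smult_left)
  have pow: "((\<lambda>w. Y \<otimes> w \<ominus> N \<odot> w) ^^ j) x = D [^] j \<otimes> x" if x: "x \<in> carrier A" for x j
  proof (induction j)
    case (Suc j)
    have "Y \<otimes> (D [^] j \<otimes> x) \<ominus> N \<odot> (D [^] j \<otimes> x) = D \<otimes> (D [^] j \<otimes> x)"
      using x by (intro Dx) simp
    also have "\<dots> = D [^] Suc j \<otimes> x"
      unfolding nat_pow_Suc2[OF D] using x by (simp add: m_assoc)
    finally show ?case using Suc by simp
  qed (use x in simp)
  have comD: "comm D Y" "comm D S"
    unfolding D_def using comm_S_Y by (auto intro!: comm_sym[OF comm_add] comm_smult comm_one)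
  show "range (\<lambda>c. c \<odot> S) \<subseteq> generalized_eigenspace A (\<lambda>x. Y \<otimes> x) N"
  proof clarify
    fix c
    have "((\<lambda>w. Y \<otimes> w \<ominus> N \<odot> w) ^^ 1) (c \<odot> S) = \<zero>"
      by (simp add: mult_smult_right Y_S smult_smult mult.commute)
    then show "c \<odot> S \<in> generalized_eigenspace A (\<lambda>x. Y \<otimes> x) N"
      unfolding generalized_eigenspace_def using S_closed by blast
  qed
  show "generalized_eigenspace A (\<lambda>x. Y \<otimes> x) N \<subseteq> range (\<lambda>c. c \<odot> S)"
  proof
    fix v assume "v \<in> generalized_eigenspace A (\<lambda>x. Y \<otimes> x) N"
    then obtain j :: nat where v [simp]: "v \<in> carrier A" and j: "D [^] j \<otimes> v = \<zero>"
      using pow by (auto simp: generalized_eigenspace_def)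
    define w where "w = v \<ominus> S \<otimes> v"
    have w [simp]: "w \<in> carrier A" by (simp add: w_def)
    have Sw: "S \<otimes> w = \<zero>"
    proof -
      have "S \<otimes> w = S \<otimes> v \<ominus> (S \<otimes> S) \<otimes> v"
        by (simp add: w_def minus_eq r_distr r_minus m_assoc)
      then show ?thesis by (simp add: S_S minus_eq r_neg)
    qed
    \<comment> \<open>\<open>N\<close> is no eigenvalue on the kernel of \<open>S\<close>: from
      \<open>Y x = N x\<close> follows \<open>N^n x = Y^n x = N^n S x = 0\<close>.\<close>
    have zero: "x = \<zero>" if "x \<in> carrier A" "S \<otimes> x = \<zero>" "D [^] j \<otimes> x = \<zero>" for x and j :: nat
      using that
    proof (induction j arbitrary: x)
      case (Suc j)
      have "S \<otimes> (D \<otimes> x) = D \<otimes> (S \<otimes> x)"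
        using comD(2) Suc.prems(1) by (simp add: comm_def m_assoc[symmetric])
      then have "S \<otimes> (D \<otimes> x) = \<zero>" "D [^] j \<otimes> (D \<otimes> x) = \<zero>"
        using Suc.prems by (auto simp: m_assoc)
      then have "D \<otimes> x = \<zero>" using Suc.IH[of "D \<otimes> x"] Suc.prems(1) by simp
      then have Yx: "Y \<otimes> x = N \<odot> x"
        using Dx[OF Suc.prems(1)] Suc.prems(1) by simp
      have "Y [^] i \<otimes> x = N ^ i \<odot> x" for i :: nat
      proof (induction i)
        case (Suc i)
        then show ?case
          using \<open>x \<in> carrier A\<close> by (simp add: m_assoc Yx mult_smult_right smult_smult)
      qed (use Suc.prems in simp)
      from this[of n] have "N ^ n \<odot> x = \<zero>"
        using Suc.prems by (simp add: Y_pow_eq mult_smult_left)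
      then show ?case by (rule smult_eq_zeroD) (use Suc.prems N_nonzero in auto)
    qed simp
    have "D [^] j \<otimes> w = D [^] j \<otimes> v \<ominus> (D [^] j \<otimes> S) \<otimes> v"
      by (simp add: w_def minus_eq r_distr r_minus m_assoc)
    also have "D [^] j \<otimes> S = S \<otimes> D [^] j"
      using comm_pow[OF comm_sym[OF comD(2)], of j] by (simp add: comm_def)
    also have "(S \<otimes> D [^] j) \<otimes> v = \<zero>" using j by (simp add: m_assoc)
    finally have "D [^] j \<otimes> w = \<zero>" using j by simp
    with Sw have "w = \<zero>" using zero[of w j] by simp
    then have "S \<otimes> v = v" by (simp add: w_def)
    moreover obtain c where "S \<otimes> v = c \<odot> S" using S_mult[OF v] by blast
    ultimately have "v = c \<odot> S" by (rule subst)
    then show "v \<in> range (\<lambda>c. c \<odot> S)" by blast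
  qed
qed

theorem shuffle_multiplicity: "eigenvalue_multiplicity A (\<lambda>x. Y \<otimes> x) N = 1"
proof -
  define E where "E = range (\<lambda>c. c \<odot> S)"
  have sub: "subspace class_ring E A"
    unfolding subspace_iff
  proof (intro conjI ballI allI)
    show "E \<subseteq> carrier A" by (auto simp: E_def)
    have "\<zero> = 0 \<odot> S" by simp
    then show "\<zero> \<in> E" unfolding E_def by blast
    show "x \<oplus> y \<in> E" if "x \<in> E" "y \<in> E" for x y
      using that by (auto simp: E_def smult_add_left[symmetric])
    show "c \<odot> x \<in> E" if "x \<in> E" for c x
      using that by (auto simp: E_def smult_smult)
  qed
  interpret E: vectorspace class_ring "A\<lparr>carrier := E\<rparr>"
    by (rule vectorspace.subspace_is_vs[OF vectorspace sub])
  have S_E: "S \<in> E" unfolding E_def by (rule range_eqI[of _ _ 1]) simp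
  have "E.gen_set {S}"
  proof
    show "E.span {S} \<subseteq> carrier (A\<lparr>carrier := E\<rparr>)"
      using E.span_is_subset2[of "{S}"] S_E by simp
    have subm: "LinearCombinations.submodule class_ring (E.span {S}) (A\<lparr>carrier := E\<rparr>)"
      using S_E by (intro E.span_is_submodule) simp
    have "S \<in> E.span {S}" using E.in_own_span[of "{S}"] S_E by simp
    then have "c \<odot> S \<in> E.span {S}" for c
      using LinearCombinations.submodule.smult_closed[OF subm, of c S] by (simp add: class_ring_simps)
    then show "carrier (A\<lparr>carrier := E\<rparr>) \<subseteq> E.span {S}" by (auto simp: E_def)
  qed
  then have "E.dim = 1"
    by (rule E.dim1I) (use S_nonzero S_E in auto)
  then show ?thesis
    by (simp add: eigenvalue_multiplicity_def generalized_eigenspace_eq E_def)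
qed

end

section \<open>Algebra homomorphisms\<close>

locale kalgebra_hom = A: kalgebra A + B: kalgebra B
  for A :: "('k::field, 'a) module" and B :: "('k, 'b) module" +
  fixes f :: "'a \<Rightarrow> 'b"
  assumes closed [simp]: "x \<in> carrier A \<Longrightarrow> f x \<in> carrier B"
    and add: "x \<in> carrier A \<Longrightarrow> y \<in> carrier A \<Longrightarrow> f (x \<oplus>\<^bsub>A\<^esub> y) = f x \<oplus>\<^bsub>B\<^esub> f y"
    and mult: "x \<in> carrier A \<Longrightarrow> y \<in> carrier A \<Longrightarrow> f (x \<otimes>\<^bsub>A\<^esub> y) = f x \<otimes>\<^bsub>B\<^esub> f y"
    and smult: "x \<in> carrier A \<Longrightarrow> f (c \<odot>\<^bsub>A\<^esub> x) = c \<odot>\<^bsub>B\<^esub> f x"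
    and one: "f \<one>\<^bsub>A\<^esub> = \<one>\<^bsub>B\<^esub>"
begin

lemma minus: "x \<in> carrier A \<Longrightarrow> y \<in> carrier A \<Longrightarrow> f (x \<ominus>\<^bsub>A\<^esub> y) = f x \<ominus>\<^bsub>B\<^esub> f y"
  by (simp add: A.minus_eq_smult B.minus_eq_smult add smult)

lemma pow: "x \<in> carrier A \<Longrightarrow> f (x [^]\<^bsub>A\<^esub> (i::nat)) = f x [^]\<^bsub>B\<^esub> i"
  by (induction i) (auto simp: one mult)

lemma zero: "f \<zero>\<^bsub>A\<^esub> = \<zero>\<^bsub>B\<^esub>"
  using smult[of "\<zero>\<^bsub>A\<^esub>" 0] by simp

lemma ring_hom_ring: "ring_hom_ring A B f"
  by (intro ring_hom_ringI2 ring_hom_memI A.ring_axioms B.ring_axioms) (auto simp: add mult one)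

lemma finsum_hom:
  "g \<in> S \<rightarrow> carrier A \<Longrightarrow> f (\<Oplus>\<^bsub>A\<^esub>i\<in>S. g i) = (\<Oplus>\<^bsub>B\<^esub>i\<in>S. f (g i))"
  by (induction S rule: infinite_finite_induct) (auto simp: zero add Pi_def)

lemma poly_eval_hom:
  assumes "a \<in> carrier A" shows "f (poly_eval A p a) = poly_eval B p (f a)"
proof -
  have "f (poly_eval A p a) = (\<Oplus>\<^bsub>B\<^esub>i\<in>{..degree p}. f (poly.coeff p i \<odot>\<^bsub>A\<^esub> (a [^]\<^bsub>A\<^esub> i)))"
    unfolding poly_eval_def using assms by (intro finsum_hom) auto
  also have "\<dots> = poly_eval B p (f a)"
    unfolding poly_eval_def using assms by (intro B.finsum_cong') (auto simp: smult pow)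
  finally show ?thesis .
qed

lemma foldr_hom:
  assumes "\<And>i. i \<in> set is \<Longrightarrow> b i \<in> carrier A"
  shows "foldr (\<lambda>i y. b i \<otimes>\<^bsub>A\<^esub> y) is \<one>\<^bsub>A\<^esub> \<in> carrier A \<and>
    f (foldr (\<lambda>i y. b i \<otimes>\<^bsub>A\<^esub> y) is \<one>\<^bsub>A\<^esub>) = foldr (\<lambda>i y. f (b i) \<otimes>\<^bsub>B\<^esub> y) is \<one>\<^bsub>B\<^esub>"
  using assms by (induction "is") (auto simp: one mult)

text \<open>Exhibiting a two-sided inverse pins down the value of \<open>inv\<close> in both
  algebras; \<open>kappa\<close> contains \<open>inv\<close>, so its transport along homomorphisms
  depends on this.\<close>

lemma inv_hom:
  assumes "x \<in> carrier A" "y \<in> carrier A" "x \<otimes>\<^bsub>A\<^esub> y = \<one>\<^bsub>A\<^esub>" "y \<otimes>\<^bsub>A\<^esub> x = \<one>\<^bsub>A\<^esub>"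
  shows "inv\<^bsub>A\<^esub> x = y" "inv\<^bsub>B\<^esub> (f x) = f y"
proof -
  show "inv\<^bsub>A\<^esub> x = y" using A.inv_unique'[of x y] assms by simp
  have "f x \<otimes>\<^bsub>B\<^esub> f y = \<one>\<^bsub>B\<^esub>" "f y \<otimes>\<^bsub>B\<^esub> f x = \<one>\<^bsub>B\<^esub>"
    using assms mult[of x y] mult[of y x] one by auto
  then show "inv\<^bsub>B\<^esub> (f x) = f y" using B.inv_unique'[of "f x" "f y"] assms by simp
qed

lemma kappa_hom:
  assumes "s i \<in> carrier A" "y \<in> carrier A" "s i \<otimes>\<^bsub>A\<^esub> y = \<one>\<^bsub>A\<^esub>" "y \<otimes>\<^bsub>A\<^esub> s i = \<one>\<^bsub>A\<^esub>"
  shows "kappa A s q i \<in> carrier A" "f (kappa A s q i) = kappa B (\<lambda>i. f (s i)) q i"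
  using inv_hom[OF assms] assms by (simp_all add: kappa_def minus smult one)

end


section \<open>Group algebras\<close>

text \<open>The linear functional on the group algebra that extends \<open>\<phi>\<close>. Testing
  against all such functionals (\<open>eq_by_lift\<close>) replaces the manipulation of double sums
  over supports.\<close>

definition lift :: "('g \<Rightarrow> 'k::field) \<Rightarrow> ('g \<Rightarrow>\<^sub>0 'k) \<Rightarrow> 'k" where
  "lift \<phi> f = (\<Sum>a\<in>Poly_Mapping.keys f. Poly_Mapping.lookup f a * \<phi> a)"

lemma lift_superset:
  assumes "finite S" "Poly_Mapping.keys f \<subseteq> S"
  shows "lift \<phi> f = (\<Sum>a\<in>S. Poly_Mapping.lookup f a * \<phi> a)"
  unfolding lift_def using assms
  by (intro sum.mono_neutral_left) (auto simp: in_keys_iff)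

lemma lift_add: "lift \<phi> (f + g) = lift \<phi> f + lift \<phi> g"
proof -
  let ?S = "Poly_Mapping.keys f \<union> Poly_Mapping.keys g"
  have "finite ?S" by simp
  note l = lift_superset[OF this, of _ \<phi>]
  show ?thesis
    using l[of f] l[of g] l[of "f + g"] Poly_Mapping.keys_add[of f g]
    by (simp add: lookup_add distrib_right sum.distrib)
qed

lemma lift_zero [simp]: "lift \<phi> 0 = 0"
  by (simp add: lift_def)

lemma lift_single [simp]: "lift \<phi> (Poly_Mapping.single a c) = c * \<phi> a"
  by (simp add: lift_def)

lemma lift_sum: "lift \<phi> (sum F S) = (\<Sum>x\<in>S. lift \<phi> (F x))"
  by (induction S rule: infinite_finite_induct) (auto simp: lift_add)

lemma lookup_smult: "Poly_Mapping.lookup (Poly_Mapping.map ((*) c) f) x = c * Poly_Mapping.lookup f x"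
  for f :: "'g \<Rightarrow>\<^sub>0 'k::field"
  by (simp add: Poly_Mapping.map.rep_eq when_def)

lemma keys_smult: "Poly_Mapping.keys (Poly_Mapping.map ((*) c) f) \<subseteq> Poly_Mapping.keys f"
  for f :: "'g \<Rightarrow>\<^sub>0 'k::field"
  by (auto simp: in_keys_iff lookup_smult)

lemma lift_smult: "lift \<phi> (Poly_Mapping.map ((*) c) f) = c * lift \<phi> f"
  by (subst lift_superset[OF finite_keys keys_smult])
    (simp add: lift_def lookup_smult sum_distrib_left mult.assoc)

lemma lift_cong: "(\<And>a. a \<in> Poly_Mapping.keys f \<Longrightarrow> \<phi> a = \<psi> a) \<Longrightarrow> lift \<phi> f = lift \<psi> f"
  by (simp add: lift_def)

lemma lift_delta: "lift (\<lambda>a. if a = x then 1 else 0) f = Poly_Mapping.lookup f x"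
  by (simp add: lift_def if_distrib in_keys_iff cong: if_cong)

lemma eq_by_lift: "(\<And>\<phi>. lift \<phi> f = lift \<phi> g) \<Longrightarrow> f = g"
  by (rule poly_mapping_eqI) (metis lift_delta)

lemma group_algebra_simps [simp]:
  "carrier (group_algebra G) = {f. Poly_Mapping.keys f \<subseteq> carrier G}"
  "\<one>\<^bsub>group_algebra G\<^esub> = Poly_Mapping.single \<one>\<^bsub>G\<^esub> 1"
  "\<zero>\<^bsub>group_algebra G\<^esub> = 0"
  "x \<oplus>\<^bsub>group_algebra G\<^esub> y = x + y"
  "c \<odot>\<^bsub>group_algebra G\<^esub> x = Poly_Mapping.map ((*) c) x"
  by (simp_all add: group_algebra_def)

text \<open>A product is tested by an iterated functional, so associativity and the unit laws of the
  group algebra reduce pointwise to those of \<open>G\<close>.\<close>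

lemma lift_mult:
  "lift \<phi> (f \<otimes>\<^bsub>group_algebra G\<^esub> g) = lift (\<lambda>a. lift (\<lambda>b. \<phi> (a \<otimes>\<^bsub>G\<^esub> b)) g) f"
  by (simp add: group_algebra_def lift_sum)
    (simp add: lift_def sum_distrib_left mult.assoc)

lemma single_mult:
  "Poly_Mapping.single a 1 \<otimes>\<^bsub>group_algebra G\<^esub> Poly_Mapping.single b (1::'k::field)
    = Poly_Mapping.single (a \<otimes>\<^bsub>G\<^esub> b) 1"
  by (rule eq_by_lift) (simp add: lift_mult)

lemma keys_mult:
  assumes "monoid G" "Poly_Mapping.keys f \<subseteq> carrier G" "Poly_Mapping.keys g \<subseteq> carrier G"
  shows "Poly_Mapping.keys (f \<otimes>\<^bsub>group_algebra G\<^esub> g) \<subseteq> carrier G"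
proof (rule subsetI, rule ccontr)
  fix x assume x: "x \<in> Poly_Mapping.keys (f \<otimes>\<^bsub>group_algebra G\<^esub> g)" "x \<notin> carrier G"
  have "lift (\<lambda>a. if a = x then 1 else 0) (f \<otimes>\<^bsub>group_algebra G\<^esub> g) = lift (\<lambda>a. 0) f"
    unfolding lift_mult
  proof (rule lift_cong)
    fix a assume a: "a \<in> Poly_Mapping.keys f"
    have "lift (\<lambda>b. if a \<otimes>\<^bsub>G\<^esub> b = x then 1 else 0) g = lift (\<lambda>b. 0) g"
    proof (rule lift_cong)
      fix b assume "b \<in> Poly_Mapping.keys g"
      then have "a \<otimes>\<^bsub>G\<^esub> b \<in> carrier G" using a assms by (auto intro: monoid.m_closed)
      then show "(if a \<otimes>\<^bsub>G\<^esub> b = x then 1 else 0) = 0" using x by auto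
    qed
    then show "lift (\<lambda>b. if a \<otimes>\<^bsub>G\<^esub> b = x then 1 else 0) g = 0" by (simp add: lift_def)
  qed
  then have "Poly_Mapping.lookup (f \<otimes>\<^bsub>group_algebra G\<^esub> g) x = 0"
    unfolding lift_delta by (simp add: lift_def)
  then show False using x by (simp add: in_keys_iff)
qed

lemma lift_add_fun: "lift (\<lambda>a. \<phi> a + \<psi> a) f = lift \<phi> f + lift \<psi> f"
  by (simp add: lift_def distrib_left sum.distrib)

lemma lift_smult_fun: "lift (\<lambda>a. c * \<phi> a) f = c * lift \<phi> f"
  by (simp add: lift_def sum_distrib_left mult_ac)

lemma kalgebra_group_algebra:
  assumes "monoid G"
  shows "kalgebra (group_algebra G :: ('k::field, _) module)"
proof (intro kalgebra.intro kalgebra_axioms.intro)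
  interpret G: monoid G by fact
  let ?A = "group_algebra G :: ('k, _) module"
  show "ring ?A"
  proof (rule ringI)
    show "abelian_group ?A"
    proof (rule abelian_groupI)
      fix x assume "x \<in> carrier ?A"
      then have "- x \<in> carrier ?A" "- x \<oplus>\<^bsub>?A\<^esub> x = \<zero>\<^bsub>?A\<^esub>" by auto
      then show "\<exists>y\<in>carrier ?A. y \<oplus>\<^bsub>?A\<^esub> x = \<zero>\<^bsub>?A\<^esub>" by blast
    qed (use Poly_Mapping.keys_add in \<open>force simp: add_ac\<close>)+
    show "monoid ?A"
    proof (rule monoidI)
      fix x y z assume xyz: "x \<in> carrier ?A" "y \<in> carrier ?A" "z \<in> carrier ?A"
      show "x \<otimes>\<^bsub>?A\<^esub> y \<in> carrier ?A" using keys_mult[OF assms, of x y] xyz by simp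
      show "x \<otimes>\<^bsub>?A\<^esub> y \<otimes>\<^bsub>?A\<^esub> z = x \<otimes>\<^bsub>?A\<^esub> (y \<otimes>\<^bsub>?A\<^esub> z)"
      proof (rule eq_by_lift)
        fix \<phi>
        show "lift \<phi> (x \<otimes>\<^bsub>?A\<^esub> y \<otimes>\<^bsub>?A\<^esub> z) = lift \<phi> (x \<otimes>\<^bsub>?A\<^esub> (y \<otimes>\<^bsub>?A\<^esub> z))"
          unfolding lift_mult using xyz
          by (intro lift_cong) (auto simp: G.m_assoc subset_eq)
      qed
    next
      fix x assume x: "x \<in> carrier ?A"
      show "\<one>\<^bsub>?A\<^esub> \<otimes>\<^bsub>?A\<^esub> x = x" "x \<otimes>\<^bsub>?A\<^esub> \<one>\<^bsub>?A\<^esub> = x"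
        using x by (auto intro!: eq_by_lift lift_cong simp: lift_mult subset_eq)
    qed simp
  qed (auto intro!: eq_by_lift simp: lift_mult lift_add lift_add_fun)
qed (use keys_smult in \<open>force intro!: eq_by_lift
      simp: lift_mult lift_add lift_smult lift_smult_fun algebra_simps\<close>)+

lemma sum_single_eq: "(\<Sum>a\<in>Poly_Mapping.keys f. Poly_Mapping.single a (Poly_Mapping.lookup f a)) = f"
  for f :: "'g \<Rightarrow>\<^sub>0 'k::field"
  by (rule eq_by_lift) (simp add: lift_sum, simp add: lift_def)


section \<open>Braid groups\<close>

lemma braid_class_eqI: "braid_eq n u v \<Longrightarrow> braid_class n u = braid_class n v"
  by (auto simp: braid_class_def intro: braid_eq.sym braid_eq.trans)

lemma braid_class_self: "w \<in> braid_words n \<Longrightarrow> w \<in> braid_class n w"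
  by (simp add: braid_class_def braid_eq.refl)

lemma braid_words_simps [simp]:
  "[] \<in> braid_words n" "u @ v \<in> braid_words n \<longleftrightarrow> u \<in> braid_words n \<and> v \<in> braid_words n"
  "(i, b) # w \<in> braid_words n \<longleftrightarrow> i \<in> {1..<n} \<and> w \<in> braid_words n"
  by (auto simp: braid_words_def)

lemma braid_group_simps [simp]:
  "carrier (braid_group n) = braid_class n ` braid_words n"
  "\<one>\<^bsub>braid_group n\<^esub> = braid_class n []"
  by (simp_all add: braid_group_def)

lemma braid_group_mult [simp]:
  assumes "u \<in> braid_words n" "v \<in> braid_words n"
  shows "braid_class n u \<otimes>\<^bsub>braid_group n\<^esub> braid_class n v = braid_class n (u @ v)"
proof -
  have eq: "braid_class n (u' @ v') = braid_class n (u @ v)"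
    if "u' \<in> braid_class n u" "v' \<in> braid_class n v" for u' v'
    using that by (intro braid_class_eqI braid_eq.append) (auto simp: braid_class_def intro: braid_eq.sym)
  have "braid_class n u \<otimes>\<^bsub>braid_group n\<^esub> braid_class n v =
      (\<Union>u'\<in>braid_class n u. \<Union>v'\<in>braid_class n v. braid_class n (u' @ v'))"
    by (simp add: braid_group_def)
  also have "\<dots> = (\<Union>u'\<in>braid_class n u. \<Union>v'\<in>braid_class n v. braid_class n (u @ v))"
    by (simp only: eq cong: SUP_cong)
  also have "\<dots> = braid_class n (u @ v)"
    using braid_class_self[OF assms(1)] braid_class_self[OF assms(2)] by blast
  finally show ?thesis .
qed

lemma monoid_braid_group: "monoid (braid_group n)"
  by (rule monoidI) auto


section \<open>Quotient algebras\<close>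

lemma quotient_algebra_simps [simp]:
  "carrier (quotient_algebra A I) = carrier (A Quot I)"
  "x \<otimes>\<^bsub>quotient_algebra A I\<^esub> y = x \<otimes>\<^bsub>A Quot I\<^esub> y"
  "\<one>\<^bsub>quotient_algebra A I\<^esub> = \<one>\<^bsub>A Quot I\<^esub>"
  "\<zero>\<^bsub>quotient_algebra A I\<^esub> = \<zero>\<^bsub>A Quot I\<^esub>"
  "x \<oplus>\<^bsub>quotient_algebra A I\<^esub> y = x \<oplus>\<^bsub>A Quot I\<^esub> y"
  by (simp_all add: quotient_algebra_def)

context kalgebra
begin

text \<open>Scalars act through multiples of the unit, so ring ideals are automatically
  subspaces.\<close>

lemma ideal_smult_closed:
  assumes "ideal I A" "x \<in> I" shows "c \<odot> x \<in> I"
proof -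
  have x: "x \<in> carrier A" using assms by (simp add: ideal.Icarr)
  have "c \<odot> x = (c \<odot> \<one>) \<otimes> x" using x by (simp add: mult_smult_left)
  then show ?thesis using ideal.I_l_closed[OF assms] by simp
qed

lemma quotient_smult:
  assumes I: "ideal I A" and x: "x \<in> carrier A"
  shows "c \<odot>\<^bsub>quotient_algebra A I\<^esub> (I +> x) = I +> (c \<odot> x)"
proof -
  interpret I: ideal I A by fact
  have eq: "I +> (c \<odot> y) = I +> (c \<odot> x)" if y: "y \<in> I +> x" for y
  proof -
    obtain i where i: "i \<in> I" "y = i \<oplus> x" using y by (auto simp: a_r_coset_def')
    have iA: "i \<in> carrier A" using i(1) I by (simp add: ideal.Icarr)
    have "c \<odot> y \<ominus> c \<odot> x = c \<odot> i"
      using iA x i(2) smult_closed[OF iA, of c] smult_closed[OF x, of c]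
        add_diff_left[of "c \<odot> x" "c \<odot> i"]
      by (simp add: smult_add_right a_comm)
    then have "c \<odot> y \<ominus> c \<odot> x \<in> I" using ideal_smult_closed[OF I i(1)] by simp
    then show ?thesis
      using quotient_eq_iff_same_a_r_cos[OF I] iA x i(2) by simp
  qed
  have "c \<odot>\<^bsub>quotient_algebra A I\<^esub> (I +> x) = (\<Union>y\<in>I +> x. I +> (c \<odot> y))"
    by (simp add: quotient_algebra_def)
  also have "\<dots> = (\<Union>y\<in>I +> x. I +> (c \<odot> x))"
    by (simp only: eq cong: SUP_cong)
  also have "\<dots> = I +> (c \<odot> x)"
    using I.a_rcos_self[OF x] by blast
  finally show ?thesis .
qed

lemma kalgebra_hom_quotient:
  assumes I: "ideal I A"
  shows "kalgebra_hom A (quotient_algebra A I) (\<lambda>x. I +> x)"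
proof -
  interpret I: ideal I A by fact
  let ?Q = "quotient_algebra A I"
  interpret Q: ring "A Quot I" by (rule I.quotient_is_ring)
  have surj: "\<exists>x\<in>carrier A. X = I +> x" if "X \<in> carrier (A Quot I)" for X
    using that by (auto simp: FactRing_def A_RCOSETS_def')
  have hom: "I +> x \<in> carrier (A Quot I)" "(I +> x) \<oplus>\<^bsub>A Quot I\<^esub> (I +> y) = I +> (x \<oplus> y)"
    "(I +> x) \<otimes>\<^bsub>A Quot I\<^esub> (I +> y) = I +> (x \<otimes> y)" if "x \<in> carrier A" "y \<in> carrier A" for x y
    using that ring_hom_closed[OF I.rcos_ring_hom] ring_hom_add[OF I.rcos_ring_hom]
      ring_hom_mult[OF I.rcos_ring_hom] by auto
  note sm = quotient_smult[OF I]
  have "ring ?Q"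
  proof (rule ringI)
    show "abelian_group ?Q"
      by (rule abelian_groupI) (auto simp: Q.a_ac intro: Q.add.l_inv_ex)
    show "monoid ?Q"
      by unfold_locales (auto simp: Q.m_assoc)
  qed (simp_all add: Q.l_distr Q.r_distr)
  moreover have "kalgebra_axioms ?Q"
  proof (rule kalgebra_axioms.intro, simp_all only: quotient_algebra_simps)
    fix X c d assume "X \<in> carrier (A Quot I)"
    then obtain x where x: "x \<in> carrier A" "X = I +> x" using surj by blast
    show "c \<odot>\<^bsub>?Q\<^esub> X \<in> carrier (A Quot I)" "1 \<odot>\<^bsub>?Q\<^esub> X = X"
      "(c + d) \<odot>\<^bsub>?Q\<^esub> X = c \<odot>\<^bsub>?Q\<^esub> X \<oplus>\<^bsub>A Quot I\<^esub> d \<odot>\<^bsub>?Q\<^esub> X"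
      "c \<odot>\<^bsub>?Q\<^esub> (d \<odot>\<^bsub>?Q\<^esub> X) = (c * d) \<odot>\<^bsub>?Q\<^esub> X"
      using x by (simp_all add: sm hom smult_add_left smult_smult)
    fix Y assume "Y \<in> carrier (A Quot I)"
    then obtain y where y: "y \<in> carrier A" "Y = I +> y" using surj by blast
    show "c \<odot>\<^bsub>?Q\<^esub> (X \<oplus>\<^bsub>A Quot I\<^esub> Y) = c \<odot>\<^bsub>?Q\<^esub> X \<oplus>\<^bsub>A Quot I\<^esub> c \<odot>\<^bsub>?Q\<^esub> Y"
      "(c \<odot>\<^bsub>?Q\<^esub> X) \<otimes>\<^bsub>A Quot I\<^esub> Y = c \<odot>\<^bsub>?Q\<^esub> (X \<otimes>\<^bsub>A Quot I\<^esub> Y)"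
      "X \<otimes>\<^bsub>A Quot I\<^esub> (c \<odot>\<^bsub>?Q\<^esub> Y) = c \<odot>\<^bsub>?Q\<^esub> (X \<otimes>\<^bsub>A Quot I\<^esub> Y)"
      using x y by (simp_all add: sm hom smult_add_right mult_smult_left mult_smult_right)
  qed
  ultimately have "kalgebra ?Q" by (simp add: kalgebra_def)
  then show ?thesis
    unfolding kalgebra_hom_def kalgebra_hom_axioms_def
    using kalgebra_axioms hom sm by (auto simp: FactRing_def)
qed

lemma quotient_surj:
  assumes "X \<in> carrier (quotient_algebra A I)" shows "\<exists>x\<in>carrier A. X = I +> x"
  using assms by (auto simp: FactRing_def A_RCOSETS_def')

lemma quotient_zero_iff:
  assumes "ideal I A" "x \<in> carrier A"
  shows "I +> x = \<zero>\<^bsub>quotient_algebra A I\<^esub> \<longleftrightarrow> x \<in> I"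
  using a_rcos_zero[OF assms(1)] ideal.rcos_const_imp_mem[OF assms(1,2)] by (auto simp: FactRing_def)

end

section \<open>Generators of the braid algebra\<close>

definition braid_gen_inv :: "nat \<Rightarrow> nat \<Rightarrow> (braid \<Rightarrow>\<^sub>0 'k::field)" where
  "braid_gen_inv n i = Poly_Mapping.single (braid_class n [(i, False)]) 1"

lemma kalgebra_braid_algebra: "kalgebra (braid_algebra n)"
  unfolding braid_algebra_def by (rule kalgebra_group_algebra[OF monoid_braid_group])

lemma braid_gen_closed:
  assumes "i \<in> {1..<n}"
  shows "braid_gen n i \<in> carrier (braid_algebra n)" "braid_gen_inv n i \<in> carrier (braid_algebra n)"
  using assms by (auto simp: braid_gen_def braid_gen_inv_def braid_algebra_def)

lemma single_braid_mult:
  assumes "u \<in> braid_words n" "v \<in> braid_words n"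
  shows "Poly_Mapping.single (braid_class n u) (1::'k::field) \<otimes>\<^bsub>braid_algebra n\<^esub>
    Poly_Mapping.single (braid_class n v) 1 = Poly_Mapping.single (braid_class n (u @ v)) 1"
  using assms by (simp add: braid_algebra_def single_mult)

lemma braid_algebra_one: "\<one>\<^bsub>braid_algebra n\<^esub> = Poly_Mapping.single (braid_class n []) 1"
  by (simp add: braid_algebra_def)

lemma braid_gen_inverse:
  assumes "i \<in> {1..<n}"
  shows "braid_gen n i \<otimes>\<^bsub>braid_algebra n\<^esub> braid_gen_inv n i = \<one>\<^bsub>braid_algebra n\<^esub>"
    "braid_gen_inv n i \<otimes>\<^bsub>braid_algebra n\<^esub> braid_gen n i = \<one>\<^bsub>braid_algebra n\<^esub>"
  using assms braid_class_eqI[OF braid_eq.cancel[OF assms, of True]]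
    braid_class_eqI[OF braid_eq.cancel[OF assms, of False]]
  by (simp_all add: braid_gen_def braid_gen_inv_def single_braid_mult braid_algebra_one)

lemma braid_gen_braid:
  assumes "i \<in> {1..<n}" "j \<in> {1..<n}" "\<bar>int i - int j\<bar> = 1"
  shows "braid_gen n i \<otimes>\<^bsub>braid_algebra n\<^esub> (braid_gen n j \<otimes>\<^bsub>braid_algebra n\<^esub> braid_gen n i) =
    braid_gen n j \<otimes>\<^bsub>braid_algebra n\<^esub> (braid_gen n i \<otimes>\<^bsub>braid_algebra n\<^esub> braid_gen n j)"
  using assms braid_class_eqI[OF braid_eq.braid[OF assms]]
  by (simp add: braid_gen_def single_braid_mult)

lemma braid_gen_far:
  assumes "i \<in> {1..<n}" "j \<in> {1..<n}" "\<bar>int i - int j\<bar> > 1"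
  shows "braid_gen n i \<otimes>\<^bsub>braid_algebra n\<^esub> braid_gen n j =
    braid_gen n j \<otimes>\<^bsub>braid_algebra n\<^esub> braid_gen n i"
  using assms braid_class_eqI[OF braid_eq.far[OF assms]]
  by (simp add: braid_gen_def single_braid_mult)

text \<open>Words grow by prepending a letter, so closure under left multiplication by generators
  and their inverses reaches all group elements; finite support and linearity do the rest.\<close>

lemma braid_algebra_generated:
  fixes M :: "(braid \<Rightarrow>\<^sub>0 'k::field) set"
  assumes one: "\<one>\<^bsub>braid_algebra n\<^esub> \<in> M"
    and add: "\<And>x y. \<lbrakk>x \<in> carrier (braid_algebra n); y \<in> carrier (braid_algebra n); x \<in> M; y \<in> M\<rbrakk>
      \<Longrightarrow> x \<oplus>\<^bsub>braid_algebra n\<^esub> y \<in> M"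
    and smult: "\<And>c x. \<lbrakk>x \<in> carrier (braid_algebra n); x \<in> M\<rbrakk> \<Longrightarrow> c \<odot>\<^bsub>braid_algebra n\<^esub> x \<in> M"
    and gen: "\<And>i x. \<lbrakk>i \<in> {1..<n}; x \<in> carrier (braid_algebra n); x \<in> M\<rbrakk>
      \<Longrightarrow> braid_gen n i \<otimes>\<^bsub>braid_algebra n\<^esub> x \<in> M"
    and inv: "\<And>i x. \<lbrakk>i \<in> {1..<n}; x \<in> carrier (braid_algebra n); x \<in> M\<rbrakk>
      \<Longrightarrow> braid_gen_inv n i \<otimes>\<^bsub>braid_algebra n\<^esub> x \<in> M"
  shows "carrier (braid_algebra n) \<subseteq> M"
proof
  let ?B = "braid_algebra n :: ('k, _) module"
  interpret B: kalgebra ?B by (rule kalgebra_braid_algebra)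
  have closed: "Poly_Mapping.single (braid_class n w) c \<in> carrier ?B" if "w \<in> braid_words n" for w c
    using that by (auto simp: braid_algebra_def)
  have word: "Poly_Mapping.single (braid_class n w) 1 \<in> M" if "w \<in> braid_words n" for w
    using that
  proof (induction w)
    case Nil
    then show ?case using one by (simp add: braid_algebra_one)
  next
    case (Cons l w)
    obtain i b where l: "l = (i, b)" by (cases l)
    have iw: "i \<in> {1..<n}" "w \<in> braid_words n" "[(i, b)] \<in> braid_words n"
      using Cons.prems by (auto simp: l)
    have "Poly_Mapping.single (braid_class n (l # w)) (1::'k) =
        Poly_Mapping.single (braid_class n [(i, b)]) 1 \<otimes>\<^bsub>?B\<^esub> Poly_Mapping.single (braid_class n w) 1"
      using single_braid_mult[OF iw(3,2), where ?'k = 'k] by (simp add: l)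
    also have "\<dots> \<in> M"
      using gen[OF iw(1) closed[OF iw(2)] Cons.IH[OF iw(2)]]
        inv[OF iw(1) closed[OF iw(2)] Cons.IH[OF iw(2)]]
      by (cases b) (simp_all add: braid_gen_def braid_gen_inv_def)
    finally show ?case .
  qed
  have single: "Poly_Mapping.single (braid_class n w) c \<in> M" if "w \<in> braid_words n" for w c
    using smult[OF closed[OF that] word[OF that], of c] by (simp add: braid_algebra_def)
  fix f assume f: "f \<in> carrier ?B"
  have "(\<Sum>a\<in>K. Poly_Mapping.single a (Poly_Mapping.lookup f a)) \<in> carrier ?B \<inter> M"
    if "finite K" "K \<subseteq> carrier (braid_group n)" for K
    using that
  proof (induction K)
    case empty
    show ?case using smult[OF _ one, of 0] B.zero_closed by (simp add: braid_algebra_def)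
  next
    case (insert a K)
    then obtain w where w: "w \<in> braid_words n" "a = braid_class n w" by auto
    have plus: "x + y = x \<oplus>\<^bsub>?B\<^esub> y" for x y by (simp add: braid_algebra_def)
    have "Poly_Mapping.single a (Poly_Mapping.lookup f a) \<in> carrier ?B \<inter> M"
      using closed[OF w(1)] single[OF w(1)] w(2) by simp
    then show ?case
      using insert add unfolding sum.insert[OF insert(1,2)] plus by auto
  qed
  from this[of "Poly_Mapping.keys f"] have "f \<in> carrier ?B \<inter> M"
    using f unfolding sum_single_eq by (simp add: braid_algebra_def)
  then show "f \<in> M" by simp
qed


section \<open>Representations of group algebras on sequences\<close>

text \<open>Operators on infinite sequences take the place of matrices, so that one type serves all
  numbers of strands; the Burau generators merely scale the remaining coordinates.\<close>

definition seq_linear :: "((nat \<Rightarrow> 'k::field) \<Rightarrow> nat \<Rightarrow> 'k) \<Rightarrow> bool" where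
  "seq_linear T \<longleftrightarrow> (\<forall>u v. T (\<lambda>j. u j + v j) = (\<lambda>j. T u j + T v j)) \<and>
    (\<forall>c v. T (\<lambda>j. c * v j) = (\<lambda>j. c * T v j))"

definition op_algebra :: "('k::field, (nat \<Rightarrow> 'k) \<Rightarrow> nat \<Rightarrow> 'k) module" where
  "op_algebra = \<lparr> carrier = Collect seq_linear, mult = (\<circ>), one = id, zero = (\<lambda>v j. 0),
    add = (\<lambda>S T v j. S v j + T v j), smult = (\<lambda>c T v j. c * T v j) \<rparr>"

lemma op_algebra_simps [simp]:
  "carrier op_algebra = Collect seq_linear" "S \<otimes>\<^bsub>op_algebra\<^esub> T = S \<circ> T" "\<one>\<^bsub>op_algebra\<^esub> = id"
  "\<zero>\<^bsub>op_algebra\<^esub> = (\<lambda>v j. 0)" "S \<oplus>\<^bsub>op_algebra\<^esub> T = (\<lambda>v j. S v j + T v j)"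
  "c \<odot>\<^bsub>op_algebra\<^esub> T = (\<lambda>v j. c * T v j)"
  by (simp_all add: op_algebra_def)

lemma seq_linearD:
  assumes "seq_linear T"
  shows "T (\<lambda>j. u j + v j) = (\<lambda>j. T u j + T v j)" "T (\<lambda>j. c * v j) = (\<lambda>j. c * T v j)"
  using assms by (auto simp: seq_linear_def)

lemma seq_linear_sum:
  assumes "seq_linear T"
  shows "T (\<lambda>j. \<Sum>a\<in>K. c a * w a j) = (\<lambda>j. \<Sum>a\<in>K. c a * T (w a) j)"
proof (induction K rule: infinite_finite_induct)
  case (insert a K)
  then show ?case by (simp add: seq_linearD[OF assms])
qed (use seq_linearD(2)[OF assms, of 0] in simp_all)

lemma seq_linear_add:
  assumes "seq_linear S" "seq_linear T" shows "seq_linear (\<lambda>v j. S v j + T v j)"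
  unfolding seq_linear_def by (simp add: seq_linearD[OF assms(1)] seq_linearD[OF assms(2)] algebra_simps)

lemma seq_linear_smult:
  assumes "seq_linear T" shows "seq_linear (\<lambda>v j. c * T v j)"
  unfolding seq_linear_def by (simp add: seq_linearD[OF assms] algebra_simps)

lemma seq_linear_zero: "seq_linear (\<lambda>v j. 0)" and seq_linear_id: "seq_linear id"
  by (simp_all add: seq_linear_def)

lemma seq_linear_comp: "seq_linear S \<Longrightarrow> seq_linear T \<Longrightarrow> seq_linear (S \<circ> T)"
  by (simp add: seq_linear_def)

lemmas seq_linear_intros = seq_linear_add seq_linear_smult seq_linear_zero seq_linear_id seq_linear_comp

lemma kalgebra_op_algebra: "kalgebra (op_algebra :: ('k::field, _) module)"
proof (intro kalgebra.intro kalgebra_axioms.intro)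
  let ?E = "op_algebra :: ('k, _) module"
  show "ring ?E"
  proof (rule ringI)
    show "abelian_group ?E"
    proof (rule abelian_groupI)
      fix T assume "T \<in> carrier ?E"
      then have "(\<lambda>v j. - T v j) \<in> carrier ?E" using seq_linear_smult[of T "-1"] by simp
      moreover have "(\<lambda>v j. - T v j) \<oplus>\<^bsub>?E\<^esub> T = \<zero>\<^bsub>?E\<^esub>" by simp
      ultimately show "\<exists>S\<in>carrier ?E. S \<oplus>\<^bsub>?E\<^esub> T = \<zero>\<^bsub>?E\<^esub>" by blast
    qed (auto simp: seq_linear_intros add_ac)
    show "monoid ?E"
      by (rule monoidI) (auto simp: seq_linear_intros)
  qed (auto simp: seq_linearD fun_eq_iff)
qed (auto simp: seq_linearD fun_eq_iff algebra_simps seq_linear_intros)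

lemma op_algebra_finsum:
  fixes T :: "'i \<Rightarrow> (nat \<Rightarrow> 'k::field) \<Rightarrow> nat \<Rightarrow> 'k"
  shows "finite K \<Longrightarrow> T \<in> K \<rightarrow> carrier op_algebra \<Longrightarrow>
    (\<Oplus>\<^bsub>op_algebra\<^esub>i\<in>K. T i) v j = (\<Sum>i\<in>K. T i v j)"
proof (induction K rule: finite_induct)
  case empty
  interpret E: kalgebra "op_algebra :: ('k, _) module" by (rule kalgebra_op_algebra)
  show ?case by simp
next
  case (insert i K)
  interpret E: kalgebra "op_algebra :: ('k, _) module" by (rule kalgebra_op_algebra)
  show ?case using insert by (subst E.finsum_insert) (auto simp: Pi_def)
qed

lemma kalgebra_hom_group_algebra:
  fixes \<phi> :: "'g \<Rightarrow> (nat \<Rightarrow> 'k::field) \<Rightarrow> nat \<Rightarrow> 'k"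
  assumes G: "monoid G" and lin: "\<And>a. a \<in> carrier G \<Longrightarrow> seq_linear (\<phi> a)"
    and one: "\<phi> \<one>\<^bsub>G\<^esub> = id"
    and mult: "\<And>a b. a \<in> carrier G \<Longrightarrow> b \<in> carrier G \<Longrightarrow> \<phi> (a \<otimes>\<^bsub>G\<^esub> b) = \<phi> a \<circ> \<phi> b"
  shows "kalgebra_hom (group_algebra G) op_algebra (\<lambda>f v j. lift (\<lambda>a. \<phi> a v j) f)"
proof (intro kalgebra_hom.intro kalgebra_group_algebra[OF G] kalgebra_op_algebra
    kalgebra_hom_axioms.intro)
  let ?A = "group_algebra G :: ('k, _) module"
  fix f g assume f: "f \<in> carrier ?A"
  have add: "lift (\<lambda>a. \<phi> a (\<lambda>j. u j + v j) j) f = lift (\<lambda>a. \<phi> a u j) f + lift (\<lambda>a. \<phi> a v j) f" for u v j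
  proof -
    have "lift (\<lambda>a. \<phi> a (\<lambda>j. u j + v j) j) f = lift (\<lambda>a. \<phi> a u j + \<phi> a v j) f"
      using f by (intro lift_cong) (auto simp: seq_linearD[OF lin] subset_eq)
    then show ?thesis by (simp add: lift_add_fun)
  qed
  have smult: "lift (\<lambda>a. \<phi> a (\<lambda>j. c * v j) j) f = c * lift (\<lambda>a. \<phi> a v j) f" for c v j
  proof -
    have "lift (\<lambda>a. \<phi> a (\<lambda>j. c * v j) j) f = lift (\<lambda>a. c * \<phi> a v j) f"
      using f by (intro lift_cong) (auto simp: seq_linearD[OF lin] subset_eq)
    then show ?thesis by (simp add: lift_smult_fun)
  qed
  show "(\<lambda>v j. lift (\<lambda>a. \<phi> a v j) f) \<in> carrier op_algebra"
    using add smult by (simp add: seq_linear_def)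
  show "(\<lambda>v j. lift (\<lambda>a. \<phi> a v j) (c \<odot>\<^bsub>?A\<^esub> f)) = c \<odot>\<^bsub>op_algebra\<^esub> (\<lambda>v j. lift (\<lambda>a. \<phi> a v j) f)" for c
    by (simp add: lift_smult)
  assume g: "g \<in> carrier ?A"
  show "(\<lambda>v j. lift (\<lambda>a. \<phi> a v j) (f \<oplus>\<^bsub>?A\<^esub> g)) =
    (\<lambda>v j. lift (\<lambda>a. \<phi> a v j) f) \<oplus>\<^bsub>op_algebra\<^esub> (\<lambda>v j. lift (\<lambda>a. \<phi> a v j) g)"
    by (simp add: lift_add)
  have "lift (\<lambda>a. lift (\<lambda>b. \<phi> (a \<otimes>\<^bsub>G\<^esub> b) v j) g) f =
      lift (\<lambda>a. \<phi> a (\<lambda>i. lift (\<lambda>b. \<phi> b v i) g) j) f" for v j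
  proof (rule lift_cong)
    fix a assume "a \<in> Poly_Mapping.keys f"
    then have a: "a \<in> carrier G" using f by auto
    have "lift (\<lambda>b. \<phi> (a \<otimes>\<^bsub>G\<^esub> b) v j) g = lift (\<lambda>b. \<phi> a (\<phi> b v) j) g"
      using a g by (intro lift_cong) (auto simp: mult subset_eq)
    \<comment> \<open>Linearity moves the fixed operator \<open>\<phi> a\<close> past the finite sum
      over the support of \<open>g\<close>.\<close>
    also have "\<dots> = \<phi> a (\<lambda>i. lift (\<lambda>b. \<phi> b v i) g) j"
      unfolding lift_def seq_linear_sum[OF lin[OF a]] ..
    finally show "lift (\<lambda>b. \<phi> (a \<otimes>\<^bsub>G\<^esub> b) v j) g = \<phi> a (\<lambda>i. lift (\<lambda>b. \<phi> b v i) g) j" .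
  qed
  then show "(\<lambda>v j. lift (\<lambda>a. \<phi> a v j) (f \<otimes>\<^bsub>?A\<^esub> g)) =
    (\<lambda>v j. lift (\<lambda>a. \<phi> a v j) f) \<otimes>\<^bsub>op_algebra\<^esub> (\<lambda>v j. lift (\<lambda>a. \<phi> a v j) g)"
    by (intro ext) (simp add: lift_mult)
qed (simp add: one id_def)


section \<open>The Burau representation\<close>

text \<open>In coordinates, the action \<open>\<sigma>\<^sub>i e\<^sub>i = e\<^sub>i\<^sub>+\<^sub>1\<close>, \<open>\<sigma>\<^sub>i e\<^sub>i\<^sub>+\<^sub>1 = e\<^sub>i + (q - q\<inverse>) e\<^sub>i\<^sub>+\<^sub>1\<close>, \<open>\<sigma>\<^sub>i e\<^sub>j = q e\<^sub>j\<close> otherwise.\<close>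

definition burau :: "'k::field \<Rightarrow> nat \<times> bool \<Rightarrow> (nat \<Rightarrow> 'k) \<Rightarrow> nat \<Rightarrow> 'k" where
  "burau q l v = (\<lambda>j. let i = fst l; h = q - inverse q in
    if snd l then (if j = i then v (i + 1) else if j = i + 1 then v i + h * v (i + 1) else q * v j)
    else (if j = i then v (i + 1) - h * v i else if j = i + 1 then v i else inverse q * v j))"

definition burau_word :: "'k::field \<Rightarrow> braid_word \<Rightarrow> (nat \<Rightarrow> 'k) \<Rightarrow> nat \<Rightarrow> 'k" where
  "burau_word q w = foldr (\<lambda>l T. burau q l \<circ> T) w id"

text \<open>The chosen representative is immaterial by \<open>burau_word_cong\<close>.\<close>

definition burau_braid :: "'k::field \<Rightarrow> braid \<Rightarrow> (nat \<Rightarrow> 'k) \<Rightarrow> nat \<Rightarrow> 'k" where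
  "burau_braid q X = burau_word q (SOME w. w \<in> X)"

definition burau_rep :: "'k::field \<Rightarrow> (braid \<Rightarrow>\<^sub>0 'k) \<Rightarrow> (nat \<Rightarrow> 'k) \<Rightarrow> nat \<Rightarrow> 'k" where
  "burau_rep q f = (\<lambda>v j. lift (\<lambda>a. burau_braid q a v j) f)"

lemma burau_word_simps [simp]:
  "burau_word q [] = id" "burau_word q (l # w) = burau q l \<circ> burau_word q w"
  by (simp_all add: burau_word_def)

lemma burau_word_append: "burau_word q (u @ v) = burau_word q u \<circ> burau_word q v"
  by (induction u) (simp_all add: comp_assoc)

lemma seq_linear_burau: "seq_linear (burau q l)"
  by (auto simp: seq_linear_def burau_def Let_def fun_eq_iff algebra_simps)

lemma seq_linear_burau_word: "seq_linear (burau_word q w)"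
  by (induction w) (simp_all only: burau_word_simps seq_linear_id seq_linear_comp seq_linear_burau)

lemma burau_word_cong:
  assumes q: "q \<noteq> 0" and "braid_eq n u v"
  shows "burau_word q u = burau_word q v"
  using assms(2)
proof (induction rule: braid_eq.induct)
  case (append u u' v v')
  then show ?case by (simp add: burau_word_append)
next
  case (cancel i b)
  show ?case using q by (cases b) (auto simp: burau_def Let_def fun_eq_iff algebra_simps)
next
  case (braid i j)
  have h: "q * (q - inverse q) = q * q - 1" using q by (simp add: algebra_simps)
  \<comment> \<open>The last of the three affected coordinates of the braid relation reduces to
    \<open>q^2 = 1 + q h\<close> times \<open>h x\<close>, where
    \<open>h = q - inverse q\<close>.\<close>
  have third: "q * (q * (x * (q - inverse q))) =
    x * (q - inverse q) + q * (x * ((q - inverse q) * (q - inverse q)))" for x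
  proof -
    have "q * (q * (x * (q - inverse q))) = (q * (q - inverse q)) * (q * x)" by (simp add: mult_ac)
    also have "\<dots> = x * (q - inverse q) + (q * (q - inverse q)) * (x * (q - inverse q))"
      unfolding h using q by (simp add: algebra_simps)
    finally show ?thesis by (simp add: mult_ac)
  qed
  from braid consider "j = i + 1" | "i = j + 1" by linarith
  then show ?case
    by cases (auto simp: burau_def Let_def fun_eq_iff distrib_left mult_ac intro: third third[symmetric])
next
  case (far i j)
  then show ?case
    by (auto simp: burau_def Let_def fun_eq_iff algebra_simps)
qed auto

lemma burau_braid_class:
  assumes q: "q \<noteq> 0" and w: "w \<in> braid_words n"
  shows "burau_braid q (braid_class n w) = burau_word q w"
proof -
  have "(SOME v. v \<in> braid_class n w) \<in> braid_class n w"
    using braid_class_self[OF w] by (rule someI)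
  then have "braid_eq n w (SOME v. v \<in> braid_class n w)" by (simp add: braid_class_def)
  from burau_word_cong[OF q this] show ?thesis by (simp add: burau_braid_def)
qed

lemma kalgebra_hom_burau:
  assumes q: "q \<noteq> 0"
  shows "kalgebra_hom (braid_algebra n) op_algebra (burau_rep q)"
  unfolding braid_algebra_def burau_rep_def
  by (rule kalgebra_hom_group_algebra[OF monoid_braid_group])
    (auto simp: burau_braid_class[OF q] seq_linear_burau_word burau_word_append)

lemma burau_rep_gen:
  assumes q: "q \<noteq> 0" and i: "i \<in> {1..<n}"
  shows "burau_rep q (braid_gen n i) = burau q (i, True)"
    "burau_rep q (braid_gen_inv n i) = burau q (i, False)"
  using i by (simp_all add: burau_rep_def braid_gen_def braid_gen_inv_def burau_braid_class[OF q])

section \<open>A cyclic vector for the shuffle\<close>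

text \<open>The image of both Baxterized elements at \<open>q^i\<close>: the \<kappa> term is absent
  because \<kappa> acts as zero (\<open>burau_kappa\<close>).\<close>

definition burau_bax :: "'k::field \<Rightarrow> nat \<Rightarrow> (nat \<Rightarrow> 'k) \<Rightarrow> nat \<Rightarrow> 'k" where
  "burau_bax q i v = (\<lambda>j. inverse (q ^ i) * (v j + ((q ^ i)\<^sup>2 - 1) / (q - inverse q) * burau q (i, True) v j))"

definition burau_shuffle :: "'k::field \<Rightarrow> nat \<Rightarrow> (nat \<Rightarrow> 'k) \<Rightarrow> nat \<Rightarrow> 'k" where
  "burau_shuffle q n = foldr (\<lambda>i T. burau_bax q i \<circ> T) [1..<n + 1] id"

lemma seq_linear_burau_bax: "seq_linear (burau_bax q i)"
  unfolding burau_bax_def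
  by (intro seq_linear_smult seq_linear_add seq_linear_burau) (use seq_linear_id in \<open>simp add: id_def\<close>)

lemma seq_linear_burau_shuffle: "seq_linear (burau_shuffle q n)"
proof -
  have "seq_linear (foldr (\<lambda>i T. burau_bax q i \<circ> T) is id)" for "is"
  proof (induction "is")
    case (Cons i "is")
    from seq_linear_comp[OF seq_linear_burau_bax Cons] show ?case by (simp add: comp_def)
  qed (simp add: seq_linear_id[unfolded id_def])
  then show ?thesis by (simp only: burau_shuffle_def)
qed

text \<open>\<open>w m\<close> is the vector after the factors \<open>n\<close> down to
  \<open>m\<close> have acted. Factors beyond \<open>j\<close> scale the leading coordinate
  \<open>j\<close>, factor \<open>j\<close> moves it to \<open>j + 1\<close> with coefficient
  \<open>[j]_q\<close>, and the later factors \<open>m < j\<close> scale it by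
  \<open>[m + 1]_q\<close>; none of these scalars vanishes.\<close>

lemma burau_shuffle_hessenberg:
  fixes q :: "'k::field"
  assumes q: "q \<noteq> 0" "q - inverse q \<noteq> 0" and qn: "\<And>i. i \<in> {1..n + 1} \<Longrightarrow> qnum q i \<noteq> 0"
    and j: "j \<in> {1..n}" and v: "v j \<noteq> 0" "\<And>l. l > j \<Longrightarrow> v l = 0"
  shows "burau_shuffle q n v (j + 1) \<noteq> 0" "\<And>l. l > j + 1 \<Longrightarrow> burau_shuffle q n v l = 0"
proof -
  define w where "w m = foldr (\<lambda>i T. burau_bax q i \<circ> T) [m..<n + 1] id v" for m
  have w_step: "w m = burau_bax q m (w (Suc m))" if "m \<le> n" for m
    using that by (simp add: w_def upt_conv_Cons del: upt_Suc)
  have other: "burau_bax q i u l = qnum q (i + 1) * u l" if "l \<noteq> i" "l \<noteq> i + 1" for i u l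
    using that unfolding qnum_Suc_eq[OF q, symmetric] by (simp add: burau_bax_def burau_def algebra_simps)
  have here: "burau_bax q i u i = inverse (q ^ i) * (u i + ((q ^ i)\<^sup>2 - 1) / (q - inverse q) * u (Suc i))"
    for i u by (simp add: burau_bax_def burau_def)
  have nxt: "burau_bax q i u (Suc i) = qnum q i * u i" if "u (Suc i) = 0" for i u
    unfolding qnum_eq[OF q(1), symmetric] using that by (simp add: burau_bax_def burau_def Let_def)
  have "(j < m \<longrightarrow> w m j \<noteq> 0 \<and> (\<forall>l>j. w m l = 0)) \<and>
      (m \<le> j \<longrightarrow> w m (j + 1) \<noteq> 0 \<and> (\<forall>l>j + 1. w m l = 0))" if "m \<le> n + 1" "1 \<le> m" for m
    using that
  proof (induction m rule: inc_induct)
    case base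
    then show ?case using v j by (simp add: w_def)
  next
    case (step m)
    then have m: "m \<le> n" "qnum q m \<noteq> 0" "qnum q (m + 1) \<noteq> 0" using qn by auto
    note ws = w_step[OF m(1)]
    have IH: "j < Suc m \<Longrightarrow> w (Suc m) j \<noteq> 0 \<and> (\<forall>l>j. w (Suc m) l = 0)"
      "Suc m \<le> j \<Longrightarrow> w (Suc m) (j + 1) \<noteq> 0 \<and> (\<forall>l>j + 1. w (Suc m) l = 0)"
      using step.IH step.prems by auto
    consider "j < m" | "j = m" | "m < j" by linarith
    then show ?case
    proof cases
      case 1
      then have I: "w (Suc m) j \<noteq> 0" "\<And>l. l > j \<Longrightarrow> w (Suc m) l = 0" using IH by auto
      have "w m j \<noteq> 0" unfolding ws using 1 I m by (subst other) auto
      moreover have "w m l = 0" if "l > j" for l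
      proof -
        consider "l = m" | "l = m + 1" | "l \<noteq> m" "l \<noteq> m + 1" by blast
        then show ?thesis
          by cases (use that 1 I(2) in \<open>auto simp: ws here nxt other\<close>)
      qed
      ultimately show ?thesis using 1 by auto
    next
      case 2
      then have I: "w (Suc m) m \<noteq> 0" "\<And>l. l > m \<Longrightarrow> w (Suc m) l = 0" using IH by auto
      have "w m (Suc m) \<noteq> 0" unfolding ws using I m by (subst nxt) auto
      moreover have "w m l = 0" if "l > m + 1" for l
        unfolding ws using that I by (subst other) auto
      ultimately show ?thesis using 2 by auto
    next
      case 3
      then have I: "w (Suc m) (j + 1) \<noteq> 0" "\<And>l. l > j + 1 \<Longrightarrow> w (Suc m) l = 0" using IH by auto
      have "w m (j + 1) \<noteq> 0" unfolding ws using 3 I m by (subst other) auto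
      moreover have "w m l = 0" if "l > j + 1" for l
        unfolding ws using that 3 I by (subst other) auto
      ultimately show ?thesis using 3 by auto
    qed
  qed
  from this[of 1] show "burau_shuffle q n v (j + 1) \<noteq> 0" "\<And>l. l > j + 1 \<Longrightarrow> burau_shuffle q n v l = 0"
    using j by (auto simp: w_def burau_shuffle_def simp del: upt_Suc)
qed

text \<open>The first basis vector \<open>e\<close> is pushed one coordinate further by every
  application of the shuffle. In \<open>r(Y) e\<close> the coordinate \<open>degree r + 1\<close>
  therefore comes from the leading term alone, and it is nonzero as long as the degree is at most
  \<open>n\<close>.\<close>

lemma burau_shuffle_independent:
  fixes q :: "'k::field"
  assumes q: "q \<noteq> 0" "q - inverse q \<noteq> 0" and qn: "\<And>i. i \<in> {1..n + 1} \<Longrightarrow> qnum q i \<noteq> 0"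
    and r: "r \<noteq> 0" and eval: "poly_eval op_algebra r (burau_shuffle q n) = (\<lambda>v j. 0)"
  shows "n + 1 \<le> degree r"
proof (rule ccontr)
  interpret E: kalgebra "op_algebra :: ('k, _) module" by (rule kalgebra_op_algebra)
  let ?Y = "burau_shuffle q n"
  define e :: "nat \<Rightarrow> 'k" where "e = (\<lambda>j. if j = 1 then 1 else 0)"
  have Y: "?Y \<in> carrier op_algebra" by (simp add: seq_linear_burau_shuffle)
  have pow: "(?Y [^]\<^bsub>op_algebra\<^esub> i) e (i + 1) \<noteq> 0 \<and> (\<forall>l>i + 1. (?Y [^]\<^bsub>op_algebra\<^esub> i) e l = 0)"
    if "i \<le> n" for i
    using that
  proof (induction i)
    case 0
    then show ?case by (simp add: e_def)
  next
    case (Suc i)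
    define u where "u = (?Y [^]\<^bsub>op_algebra\<^esub> i) e"
    have "(?Y [^]\<^bsub>op_algebra\<^esub> Suc i) e = ?Y u"
      unfolding E.nat_pow_Suc2[OF Y] by (simp add: u_def)
    moreover have "u (i + 1) \<noteq> 0" "\<And>l. l > i + 1 \<Longrightarrow> u l = 0"
      using Suc by (auto simp: u_def)
    ultimately show ?case
      using burau_shuffle_hessenberg[OF q qn, where j = "i + 1" and v = u] Suc.prems by simp
  qed
  assume "\<not> n + 1 \<le> degree r"
  then have d: "degree r \<le> n" by simp
  have "0 = poly_eval op_algebra r ?Y e (degree r + 1)" by (simp add: eval)
  also have "\<dots> = (\<Sum>i\<le>degree r. poly.coeff r i * (?Y [^]\<^bsub>op_algebra\<^esub> i) e (degree r + 1))"
    unfolding poly_eval_def using E.nat_pow_closed[OF Y]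
    by (subst op_algebra_finsum) (auto intro: seq_linear_smult)
  also have "\<dots> = (\<Sum>i\<in>{degree r}. poly.coeff r i * (?Y [^]\<^bsub>op_algebra\<^esub> i) e (degree r + 1))"
    using pow d by (intro sum.mono_neutral_right) auto
  also have "\<dots> \<noteq> 0" using pow[OF d] r by simp
  finally show False by simp
qed


section \<open>Quotients of the braid algebra\<close>

text \<open>The number of strands is a variable \<open>p\<close> because the simplifier would rewrite \<open>n + 1\<close> to \<open>Suc n\<close>
  inside the algebra.\<close>

locale braid_parameters =
  fixes q :: "'k::field" and n p :: nat
  assumes p_eq: "p = n + 1" and n_pos: "n \<ge> 1" and q_nonzero: "q \<noteq> 0" and q2: "q\<^sup>2 \<noteq> 1"
    and qnum_nonzero: "i \<in> {2..n + 1} \<Longrightarrow> qnum q i \<noteq> 0"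
begin

abbreviation "B \<equiv> braid_algebra p :: ('k, braid \<Rightarrow>\<^sub>0 'k) module"
abbreviation "g \<equiv> braid_gen p :: nat \<Rightarrow> (braid \<Rightarrow>\<^sub>0 'k)"
abbreviation "g' \<equiv> braid_gen_inv p :: nat \<Rightarrow> (braid \<Rightarrow>\<^sub>0 'k)"
abbreviation "\<kappa> \<equiv> kappa B g q"

sublocale B: kalgebra B by (rule kalgebra_braid_algebra)
sublocale rep: kalgebra_hom B op_algebra "burau_rep q" by (rule kalgebra_hom_burau[OF q_nonzero])

lemma gen_props:
  assumes "i \<in> {1..n}"
  shows "g i \<in> carrier B" "g' i \<in> carrier B" "g i \<otimes>\<^bsub>B\<^esub> g' i = \<one>\<^bsub>B\<^esub>" "g' i \<otimes>\<^bsub>B\<^esub> g i = \<one>\<^bsub>B\<^esub>"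
proof -
  have "i \<in> {1..<p}" using assms p_eq by auto
  then show "g i \<in> carrier B" "g' i \<in> carrier B" "g i \<otimes>\<^bsub>B\<^esub> g' i = \<one>\<^bsub>B\<^esub>" "g' i \<otimes>\<^bsub>B\<^esub> g i = \<one>\<^bsub>B\<^esub>"
    by (rule braid_gen_closed braid_gen_inverse)+
qed

lemma kappa_closed: "i \<in> {1..n} \<Longrightarrow> \<kappa> i \<in> carrier B"
  using rep.kappa_hom(1)[of g i "g' i" q] gen_props by simp

lemma inv_gen: "i \<in> {1..n} \<Longrightarrow> inv\<^bsub>B\<^esub> (g i) = g' i"
  using rep.inv_hom(1)[of "g i" "g' i"] gen_props by simp

lemma h_nonzero: "q - inverse q \<noteq> 0"
  using q_nonzero q2 by (rule q_minus_inverse_nonzero)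

text \<open>The Burau matrices satisfy the Hecke relation in the form \<sigma> - \<sigma>^{-1} = q -
  q^{-1}; this is why one representation is enough for both families of algebras.\<close>

lemma burau_kappa: "i \<in> {1..n} \<Longrightarrow> burau_rep q (\<kappa> i) = (\<lambda>v j. 0)"
proof -
  assume i: "i \<in> {1..n}"
  then have i': "i \<in> {1..<p}" using p_eq by auto
  have eq: "burau_rep q (\<kappa> i) = (\<lambda>v j. v j + (- 1) * (1 / (q - inverse q) *
      (burau q (i, True) v j + (- 1) * burau q (i, False) v j)))"
    using gen_props[OF i] inv_gen[OF i] burau_rep_gen[OF q_nonzero i']
    by (simp add: kappa_def B.minus_eq_smult rep.add rep.smult rep.one)
  have diff: "burau q (i, True) v j + (- 1) * burau q (i, False) v j = (q - inverse q) * v j" for v j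
    by (auto simp: burau_def Let_def algebra_simps)
  show ?thesis unfolding eq diff using h_nonzero by simp
qed

lemma kappa_skein:
  assumes i: "i \<in> {1..n}"
  shows "g' i = g i \<oplus>\<^bsub>B\<^esub> (- (q - inverse q)) \<odot>\<^bsub>B\<^esub> \<one>\<^bsub>B\<^esub> \<oplus>\<^bsub>B\<^esub> (q - inverse q) \<odot>\<^bsub>B\<^esub> \<kappa> i"
proof -
  let ?h = "q - inverse q"
  note [simp] = gen_props(1,2)[OF i]
  have "?h \<odot>\<^bsub>B\<^esub> \<kappa> i = ?h \<odot>\<^bsub>B\<^esub> \<one>\<^bsub>B\<^esub> \<oplus>\<^bsub>B\<^esub> ((- 1) \<odot>\<^bsub>B\<^esub> g i \<oplus>\<^bsub>B\<^esub> g' i)"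
    using h_nonzero by (simp add: kappa_def inv_gen[OF i] B.minus_eq_smult B.smult_add_right B.smult_smult)
  moreover have "g i \<oplus>\<^bsub>B\<^esub> (- ?h) \<odot>\<^bsub>B\<^esub> \<one>\<^bsub>B\<^esub> \<oplus>\<^bsub>B\<^esub> (?h \<odot>\<^bsub>B\<^esub> \<one>\<^bsub>B\<^esub> \<oplus>\<^bsub>B\<^esub> ((- 1) \<odot>\<^bsub>B\<^esub> g i \<oplus>\<^bsub>B\<^esub> g' i))
      = (g i \<oplus>\<^bsub>B\<^esub> (- 1) \<odot>\<^bsub>B\<^esub> g i) \<oplus>\<^bsub>B\<^esub> ((- ?h) \<odot>\<^bsub>B\<^esub> \<one>\<^bsub>B\<^esub> \<oplus>\<^bsub>B\<^esub> ?h \<odot>\<^bsub>B\<^esub> \<one>\<^bsub>B\<^esub>) \<oplus>\<^bsub>B\<^esub> g' i"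
    by (simp add: B.a_ac)
  moreover have "g i \<oplus>\<^bsub>B\<^esub> (- 1) \<odot>\<^bsub>B\<^esub> g i = \<zero>\<^bsub>B\<^esub>" "(- ?h) \<odot>\<^bsub>B\<^esub> \<one>\<^bsub>B\<^esub> \<oplus>\<^bsub>B\<^esub> ?h \<odot>\<^bsub>B\<^esub> \<one>\<^bsub>B\<^esub> = \<zero>\<^bsub>B\<^esub>"
    using B.smult_add_left[of "g i" 1 "-1"] B.smult_add_left[of "\<one>\<^bsub>B\<^esub>" "- ?h" ?h] by auto
  ultimately show ?thesis by simp
qed

end

text \<open>\<open>burau_zero\<close> says that the Burau representation factors through the
  quotient; elements are lifted to the braid algebra, so the induced map is never
  constructed.\<close>

locale braid_quotient = braid_parameters q n p for q :: "'k::field" and n p :: nat +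
  fixes \<nu> :: 'k and I :: "(braid \<Rightarrow>\<^sub>0 'k) set"
  assumes nu_nonzero: "\<nu> \<noteq> 0" and ideal: "ideal I (braid_algebra p)"
    and burau_zero: "x \<in> I \<Longrightarrow> burau_rep q x = (\<lambda>v j. 0)"
begin

abbreviation "Q \<equiv> quotient_algebra B I"
abbreviation proj :: "(braid \<Rightarrow>\<^sub>0 'k) \<Rightarrow> (braid \<Rightarrow>\<^sub>0 'k) set" where "proj x \<equiv> I +>\<^bsub>B\<^esub> x"

sublocale proj: kalgebra_hom B Q proj by (rule B.kalgebra_hom_quotient[OF ideal])

lemma inv_proj_gen: "i \<in> {1..n} \<Longrightarrow> inv\<^bsub>Q\<^esub> (proj (g i)) = proj (g' i)"
  using proj.inv_hom(2)[of "g i" "g' i"] gen_props by simp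

lemma proj_kappa: "i \<in> {1..n} \<Longrightarrow> proj (\<kappa> i) = kappa Q (\<lambda>i. proj (g i)) q i"
  using proj.kappa_hom(2)[of g i "g' i" q] gen_props by simp

lemma proj_eqI:
  assumes "x \<in> carrier B" "y \<in> carrier B" "x \<ominus>\<^bsub>B\<^esub> y \<in> I"
  shows "proj x = proj y"
  using B.quotient_eq_iff_same_a_r_cos[OF ideal] assms by simp

lemma bmw_relations_quotient:
  assumes k_s: "\<And>i. i \<in> {1..n} \<Longrightarrow> \<kappa> i \<otimes>\<^bsub>B\<^esub> g i \<ominus>\<^bsub>B\<^esub> \<nu> \<odot>\<^bsub>B\<^esub> \<kappa> i \<in> I"
    and s_k: "\<And>i. i \<in> {1..n} \<Longrightarrow> g i \<otimes>\<^bsub>B\<^esub> \<kappa> i \<ominus>\<^bsub>B\<^esub> \<nu> \<odot>\<^bsub>B\<^esub> \<kappa> i \<in> I"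
    and ksk: "\<And>i. i \<in> {2..n} \<Longrightarrow>
      \<kappa> i \<otimes>\<^bsub>B\<^esub> g (i - 1) \<otimes>\<^bsub>B\<^esub> \<kappa> i \<ominus>\<^bsub>B\<^esub> inverse \<nu> \<odot>\<^bsub>B\<^esub> \<kappa> i \<in> I"
    and ktk: "\<And>i. i \<in> {2..n} \<Longrightarrow>
      \<kappa> i \<otimes>\<^bsub>B\<^esub> inv\<^bsub>B\<^esub> (g (i - 1)) \<otimes>\<^bsub>B\<^esub> \<kappa> i \<ominus>\<^bsub>B\<^esub> \<nu> \<odot>\<^bsub>B\<^esub> \<kappa> i \<in> I"
    and nondeg: "(\<forall>i\<in>{1..n}. \<kappa> i \<in> I) \<or> (\<forall>j\<in>{1..n}. \<nu> \<noteq> q ^ (2 * j - 1))"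
  shows "bmw_relations Q (\<lambda>i. proj (g i)) (\<lambda>i. proj (g' i)) (\<lambda>i. proj (\<kappa> i)) q \<nu> n"
proof (intro bmw_relations.intro bmw_relations_axioms.intro)
  show "kalgebra Q" by (rule proj.B.kalgebra_axioms)
  show "(\<forall>i\<in>{1..n}. proj (\<kappa> i) = \<zero>\<^bsub>Q\<^esub>) \<or> (\<forall>j\<in>{1..n}. \<nu> \<noteq> q ^ (2 * j - 1))"
    using nondeg B.quotient_zero_iff[OF ideal] kappa_closed by blast
next
  fix i assume i: "i \<in> {1..n}"
  note [simp] = gen_props(1,2)[OF i] kappa_closed[OF i]
  show "proj (g i) \<in> carrier Q" "proj (g' i) \<in> carrier Q" "proj (\<kappa> i) \<in> carrier Q"
    by (rule proj.closed; simp)+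
  show "proj (g i) \<otimes>\<^bsub>Q\<^esub> proj (g' i) = \<one>\<^bsub>Q\<^esub>"
    using proj.mult[of "g i" "g' i"] proj.one gen_props(3)[OF i] by simp
  show "proj (g' i) \<otimes>\<^bsub>Q\<^esub> proj (g i) = \<one>\<^bsub>Q\<^esub>"
    using proj.mult[of "g' i" "g i"] proj.one gen_props(4)[OF i] by simp
  have "proj (g' i) = proj (g i \<oplus>\<^bsub>B\<^esub> (- (q - inverse q)) \<odot>\<^bsub>B\<^esub> \<one>\<^bsub>B\<^esub> \<oplus>\<^bsub>B\<^esub> (q - inverse q) \<odot>\<^bsub>B\<^esub> \<kappa> i)"
    using kappa_skein[OF i] by simp
  also have "\<dots> = proj (g i) \<oplus>\<^bsub>Q\<^esub> (- (q - inverse q)) \<odot>\<^bsub>Q\<^esub> \<one>\<^bsub>Q\<^esub> \<oplus>\<^bsub>Q\<^esub> (q - inverse q) \<odot>\<^bsub>Q\<^esub> proj (\<kappa> i)"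
    by (simp only: proj.add proj.smult proj.one B.one_closed B.a_closed B.smult_closed
        gen_props(1,2)[OF i] kappa_closed[OF i])
  finally show "proj (g' i) = proj (g i) \<oplus>\<^bsub>Q\<^esub> (- (q - inverse q)) \<odot>\<^bsub>Q\<^esub> \<one>\<^bsub>Q\<^esub>
      \<oplus>\<^bsub>Q\<^esub> (q - inverse q) \<odot>\<^bsub>Q\<^esub> proj (\<kappa> i)" .
  show "proj (\<kappa> i) \<otimes>\<^bsub>Q\<^esub> proj (g i) = \<nu> \<odot>\<^bsub>Q\<^esub> proj (\<kappa> i)"
    using proj_eqI[OF _ _ k_s[OF i]] proj.mult[of "\<kappa> i" "g i"] proj.smult[of "\<kappa> i" \<nu>] by simp
  show "proj (g i) \<otimes>\<^bsub>Q\<^esub> proj (\<kappa> i) = \<nu> \<odot>\<^bsub>Q\<^esub> proj (\<kappa> i)"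
    using proj_eqI[OF _ _ s_k[OF i]] proj.mult[of "g i" "\<kappa> i"] proj.smult[of "\<kappa> i" \<nu>] by simp
next
  fix i assume i: "i \<in> {2..n}"
  define l where "l = i - 1"
  have i1: "i \<in> {1..n}" "l \<in> {1..n}" using i by (auto simp: l_def)
  have i2: "i \<in> {1..<p}" "l \<in> {1..<p}" "\<bar>int i - int l\<bar> = 1" using i p_eq by (auto simp: l_def)
  note [simp] = gen_props(1,2)[OF i1(1)] kappa_closed[OF i1(1)] gen_props(1,2)[OF i1(2)]
  have m3: "proj (x \<otimes>\<^bsub>B\<^esub> y \<otimes>\<^bsub>B\<^esub> z) = proj x \<otimes>\<^bsub>Q\<^esub> (proj y \<otimes>\<^bsub>Q\<^esub> proj z)"
    if "x \<in> carrier B" "y \<in> carrier B" "z \<in> carrier B" for x y z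
    using that proj.mult by (simp only: B.m_assoc B.m_closed)
  show "proj (\<kappa> i) \<otimes>\<^bsub>Q\<^esub> (proj (g (i - 1)) \<otimes>\<^bsub>Q\<^esub> proj (\<kappa> i)) = inverse \<nu> \<odot>\<^bsub>Q\<^esub> proj (\<kappa> i)"
    using proj_eqI[OF _ _ ksk[OF i, folded l_def]] m3[of "\<kappa> i" "g l" "\<kappa> i"] proj.smult[of "\<kappa> i" "inverse \<nu>"]
    unfolding l_def[symmetric] by simp
  show "proj (\<kappa> i) \<otimes>\<^bsub>Q\<^esub> (proj (g' (i - 1)) \<otimes>\<^bsub>Q\<^esub> proj (\<kappa> i)) = \<nu> \<odot>\<^bsub>Q\<^esub> proj (\<kappa> i)"
    using proj_eqI[OF _ _ ktk[OF i, folded l_def, unfolded inv_gen[OF i1(2)]]]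
      m3[of "\<kappa> i" "g' l" "\<kappa> i"] proj.smult[of "\<kappa> i" \<nu>]
    unfolding l_def[symmetric] by simp
  have "g i \<otimes>\<^bsub>B\<^esub> g l \<otimes>\<^bsub>B\<^esub> g i = g l \<otimes>\<^bsub>B\<^esub> g i \<otimes>\<^bsub>B\<^esub> g l"
    using braid_gen_braid[OF i2, where ?'a = 'k] by (simp add: B.m_assoc)
  then show "proj (g i) \<otimes>\<^bsub>Q\<^esub> (proj (g (i - 1)) \<otimes>\<^bsub>Q\<^esub> proj (g i)) =
      proj (g (i - 1)) \<otimes>\<^bsub>Q\<^esub> (proj (g i) \<otimes>\<^bsub>Q\<^esub> proj (g (i - 1)))"
    using m3[of "g i" "g l" "g i"] m3[of "g l" "g i" "g l"] unfolding l_def[symmetric] by simp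
next
  fix i j assume ij: "i \<in> {1..n}" "j \<in> {1..n}" "i + 1 < j"
  then have "g i \<otimes>\<^bsub>B\<^esub> g j = g j \<otimes>\<^bsub>B\<^esub> g i"
    by (intro braid_gen_far) (auto simp: p_eq)
  then show "proj (g i) \<otimes>\<^bsub>Q\<^esub> proj (g j) = proj (g j) \<otimes>\<^bsub>Q\<^esub> proj (g i)"
    using proj.mult[of "g i" "g j"] proj.mult[of "g j" "g i"] gen_props(1) ij by simp
qed (use n_pos q_nonzero q2 nu_nonzero qnum_nonzero in auto)

lemma bmw_generated_quotient:
  assumes "bmw_relations Q (\<lambda>i. proj (g i)) (\<lambda>i. proj (g' i)) (\<lambda>i. proj (\<kappa> i)) q \<nu> n"
  shows "bmw_generated Q (\<lambda>i. proj (g i)) (\<lambda>i. proj (g' i)) (\<lambda>i. proj (\<kappa> i)) q \<nu> n"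
proof -
  interpret R: bmw_relations Q "\<lambda>i. proj (g i)" "\<lambda>i. proj (g' i)" "\<lambda>i. proj (\<kappa> i)" q \<nu> n by fact
  show ?thesis
  proof (unfold_locales)
    fix M
    assume one: "\<one>\<^bsub>Q\<^esub> \<in> M"
      and add: "\<And>x y. \<lbrakk>x \<in> carrier Q; y \<in> carrier Q; x \<in> M; y \<in> M\<rbrakk> \<Longrightarrow> x \<oplus>\<^bsub>Q\<^esub> y \<in> M"
      and smult: "\<And>c x. \<lbrakk>x \<in> carrier Q; x \<in> M\<rbrakk> \<Longrightarrow> c \<odot>\<^bsub>Q\<^esub> x \<in> M"
      and gen: "\<And>i x. \<lbrakk>i \<in> {1..n}; x \<in> carrier Q; x \<in> M\<rbrakk> \<Longrightarrow> proj (g i) \<otimes>\<^bsub>Q\<^esub> x \<in> M"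
      and inv: "\<And>i x. \<lbrakk>i \<in> {1..n}; x \<in> carrier Q; x \<in> M\<rbrakk> \<Longrightarrow> proj (g' i) \<otimes>\<^bsub>Q\<^esub> x \<in> M"
    have "carrier B \<subseteq> {x. proj x \<in> M}"
    proof (rule braid_algebra_generated)
      show "\<one>\<^bsub>B\<^esub> \<in> {x. proj x \<in> M}" using one proj.one by simp
    next
      fix x y assume "x \<in> carrier B" "y \<in> carrier B" "x \<in> {x. proj x \<in> M}" "y \<in> {x. proj x \<in> M}"
      then show "x \<oplus>\<^bsub>B\<^esub> y \<in> {x. proj x \<in> M}"
        using add[of "proj x" "proj y"] proj.add[of x y] proj.closed by simp
    next
      fix c x assume "x \<in> carrier B" "x \<in> {x. proj x \<in> M}"
      then show "c \<odot>\<^bsub>B\<^esub> x \<in> {x. proj x \<in> M}"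
        using smult[of "proj x" c] proj.smult[of x c] proj.closed by simp
    next
      fix i x assume "i \<in> {1..<p}" and x: "x \<in> carrier B" "x \<in> {x. proj x \<in> M}"
      then have i: "i \<in> {1..n}" using p_eq by auto
      show "g i \<otimes>\<^bsub>B\<^esub> x \<in> {x. proj x \<in> M}" "g' i \<otimes>\<^bsub>B\<^esub> x \<in> {x. proj x \<in> M}"
        using gen[OF i, of "proj x"] inv[OF i, of "proj x"] x proj.closed
          proj.mult[OF gen_props(1)[OF i] x(1)] proj.mult[OF gen_props(2)[OF i] x(1)] by simp_all
    qed
    then show "carrier Q \<subseteq> M" using B.quotient_surj by blast
  next
    fix r assume r: "r \<noteq> 0" "poly_eval Q r R.Y = \<zero>\<^bsub>Q\<^esub>"
    \<comment> \<open>A lift of the Baxterized generator to the braid algebra. The product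
      \<open>Yt\<close> of these lifts projects to the shuffle and acts in Burau as
      \<open>burau_shuffle\<close>, so a polynomial annihilating the shuffle maps \<open>Yt\<close>
      into \<open>I\<close>.\<close>
    define b where "b i = inverse (q ^ i) \<odot>\<^bsub>B\<^esub> (\<one>\<^bsub>B\<^esub> \<oplus>\<^bsub>B\<^esub> (((q ^ i)\<^sup>2 - 1) / (q - inverse q)) \<odot>\<^bsub>B\<^esub> g i
      \<oplus>\<^bsub>B\<^esub> (((q ^ i)\<^sup>2 - 1) / (1 - inverse \<nu> * inverse q * (q ^ i)\<^sup>2)) \<odot>\<^bsub>B\<^esub> \<kappa> i)" for i
    have b: "b i \<in> carrier B" "proj (b i) = R.bax i (q ^ i)" "burau_rep q (b i) = burau_bax q i"
      if i: "i \<in> {1..n}" for i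
    proof -
      note cl = gen_props(1)[OF i] kappa_closed[OF i]
      show "b i \<in> carrier B" using cl by (simp add: b_def)
      show "proj (b i) = R.bax i (q ^ i)"
        unfolding b_def R.bax_def
        by (simp only: proj.add proj.smult proj.one B.one_closed B.a_closed B.smult_closed cl)
      have "i \<in> {1..<p}" using i p_eq by auto
      then show "burau_rep q (b i) = burau_bax q i"
        using cl burau_kappa[OF i] burau_rep_gen(1)[OF q_nonzero, of i p]
        by (simp add: b_def burau_bax_def rep.add rep.smult rep.one fun_eq_iff)
    qed
    define Yt where "Yt = foldr (\<lambda>i y. b i \<otimes>\<^bsub>B\<^esub> y) [1..<n + 1] \<one>\<^bsub>B\<^esub>"
    have set: "\<And>i. i \<in> set [1..<n + 1] \<Longrightarrow> i \<in> {1..n}" by auto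
    have Yt: "Yt \<in> carrier B" and pY: "proj Yt = foldr (\<lambda>i y. proj (b i) \<otimes>\<^bsub>Q\<^esub> y) [1..<n + 1] \<one>\<^bsub>Q\<^esub>"
      and rY: "burau_rep q Yt = foldr (\<lambda>i y. burau_rep q (b i) \<otimes>\<^bsub>op_algebra\<^esub> y) [1..<n + 1] \<one>\<^bsub>op_algebra\<^esub>"
      unfolding Yt_def using proj.foldr_hom[of "[1..<n + 1]" b] rep.foldr_hom[of "[1..<n + 1]" b] b(1) set
      by blast+
    have "proj Yt = R.Y"
      unfolding pY R.Y_def shuffle_def by (rule foldr_cong) (use b(2) set in auto)
    moreover have bY: "burau_rep q Yt = burau_shuffle q n"
      unfolding rY burau_shuffle_def
    proof (rule foldr_cong)
      fix T i assume "i \<in> set [1..<n + 1]"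
      then show "burau_rep q (b i) \<otimes>\<^bsub>op_algebra\<^esub> T = burau_bax q i \<circ> T"
        using b(3)[OF set] by (simp only: op_algebra_simps)
    qed simp_all
    ultimately have "proj (poly_eval B r Yt) = \<zero>\<^bsub>Q\<^esub>"
      using r(2) proj.poly_eval_hom[OF Yt] by simp
    moreover have "poly_eval B r Yt \<in> carrier B"
      unfolding poly_eval_def using Yt by (intro B.finsum_closed) auto
    ultimately have inI: "poly_eval B r Yt \<in> I"
      using B.quotient_zero_iff[OF ideal] by blast
    have "poly_eval op_algebra r (burau_shuffle q n) = (\<lambda>v j. 0)"
      using burau_zero[OF inI] rep.poly_eval_hom[OF Yt, of r] bY by simp
    moreover have "qnum q i \<noteq> 0" if "i \<in> {1..n + 1}" for i
      using qnum_nonzero[of i] that h_nonzero by (cases "i = 1") (auto simp: qnum_def)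
    ultimately show "n + 1 \<le> degree r"
      using burau_shuffle_independent[OF q_nonzero h_nonzero _ r(1)] by blast
  qed
qed

end

lemma (in kalgebra_hom) genideal_zero:
  assumes "S \<subseteq> carrier A" "\<And>x. x \<in> S \<Longrightarrow> f x = \<zero>\<^bsub>B\<^esub>" "x \<in> Idl\<^bsub>A\<^esub> S"
  shows "f x = \<zero>\<^bsub>B\<^esub>"
proof -
  interpret h: ring_hom_ring A B f by (rule ring_hom_ring)
  have "S \<subseteq> a_kernel A B f"
    unfolding a_kernel_def' using assms(1,2) by blast
  from A.genideal_minimal[OF h.kernel_is_ideal this] show ?thesis
    using assms(3) unfolding a_kernel_def' by blast
qed

section \<open>Hecke and Birman--Murakami--Wenzl algebras\<close>

lemma (in braid_parameters) braid_quotient_genideal: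
  assumes "\<nu> \<noteq> 0" and R: "R \<subseteq> carrier B" and zero: "\<And>x. x \<in> R \<Longrightarrow> burau_rep q x = (\<lambda>v j. 0)"
  shows "braid_quotient q n p \<nu> (Idl\<^bsub>B\<^esub> R)"
proof (intro braid_quotient.intro braid_quotient_axioms.intro braid_parameters_axioms)
  show "ideal (Idl\<^bsub>B\<^esub> R) B" by (rule B.genideal_ideal[OF R])
  show "burau_rep q x = (\<lambda>v j. 0)" if "x \<in> Idl\<^bsub>B\<^esub> R" for x
    using rep.genideal_zero[OF R _ that] zero by simp
qed fact

lemma braid_gens_index:
  fixes n p :: nat
  assumes "p = n + 1" shows "{1..<p} = {1..n}" "{2..<p} = {2..n}"
  using assms by auto

lemma (in braid_parameters) hecke_ideal_eq:
  "hecke_ideal q p = Idl\<^bsub>B\<^esub> {g i \<otimes>\<^bsub>B\<^esub> g i \<ominus>\<^bsub>B\<^esub> ((q - inverse q) \<odot>\<^bsub>B\<^esub> g i \<oplus>\<^bsub>B\<^esub> \<one>\<^bsub>B\<^esub>) | i. i \<in> {1..n}}"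
  unfolding hecke_ideal_def Let_def braid_gens_index[OF p_eq] ..

lemma (in braid_parameters) hecke_relators_closed:
  "{g i \<otimes>\<^bsub>B\<^esub> g i \<ominus>\<^bsub>B\<^esub> ((q - inverse q) \<odot>\<^bsub>B\<^esub> g i \<oplus>\<^bsub>B\<^esub> \<one>\<^bsub>B\<^esub>) | i. i \<in> {1..n}} \<subseteq> carrier B"
  using gen_props(1) by auto

text \<open>The parameter is set to 1, an arbitrary nonzero value, since \<kappa> vanishes in this
  quotient.\<close>

lemma (in braid_parameters) braid_quotient_hecke: "braid_quotient q n p 1 (hecke_ideal q p)"
  unfolding hecke_ideal_eq
proof (rule braid_quotient_genideal[OF _ hecke_relators_closed])
  fix x assume "x \<in> {g i \<otimes>\<^bsub>B\<^esub> g i \<ominus>\<^bsub>B\<^esub> ((q - inverse q) \<odot>\<^bsub>B\<^esub> g i \<oplus>\<^bsub>B\<^esub> \<one>\<^bsub>B\<^esub>) | i. i \<in> {1..n}}"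
  then obtain i where i: "i \<in> {1..n}"
    and x: "x = g i \<otimes>\<^bsub>B\<^esub> g i \<ominus>\<^bsub>B\<^esub> ((q - inverse q) \<odot>\<^bsub>B\<^esub> g i \<oplus>\<^bsub>B\<^esub> \<one>\<^bsub>B\<^esub>)"
    by auto
  have i': "i \<in> {1..<p}" using i braid_gens_index[OF p_eq] by simp
  note [simp] = gen_props(1)[OF i]
  have "burau_rep q x = (\<lambda>v j. burau q (i, True) (burau q (i, True) v) j
      + (- 1) * ((q - inverse q) * burau q (i, True) v j + v j))"
    unfolding x by (simp add: B.minus_eq_smult rep.add rep.smult rep.mult rep.one burau_rep_gen[OF q_nonzero i'])
  also have "\<dots> = (\<lambda>v j. 0)"
    using q_nonzero by (auto simp: burau_def Let_def fun_eq_iff algebra_simps)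
  finally show "burau_rep q x = (\<lambda>v j. 0)" .
qed simp

text \<open>The witnesses \<open>t\<close> and \<open>k\<close> stay hidden, since later conclusions
  speak only of the generators and the shuffle.\<close>

lemma (in braid_parameters) bmw_generated_hecke:
  obtains t k where "bmw_generated (hecke_algebra q p) (hecke_sigma q p) t k q 1 n"
    "bmw_relations.Y (hecke_algebra q p) (hecke_sigma q p) k q 1 n =
      shuffle (hecke_algebra q p) (hecke_baxter q p) q n"
proof -
  interpret H: braid_quotient q n p 1 "hecke_ideal q p" by (rule braid_quotient_hecke)
  let ?h = "q - inverse q"
  have Q: "H.Q = hecke_algebra q p" by (simp add: hecke_algebra_def)
  have s: "(\<lambda>i. H.proj (g i)) = hecke_sigma q p" by (simp add: hecke_sigma_def fun_eq_iff)
  \<comment> \<open>\<kappa>_i is a scalar multiple of \<sigma>_i^{-1} times the quadratic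
    relator.\<close>
  have kI: "\<kappa> i \<in> hecke_ideal q p" if i: "i \<in> {1..n}" for i
  proof -
    note [simp] = gen_props(1,2)[OF i]
    define x where "x = g i \<otimes>\<^bsub>B\<^esub> g i \<ominus>\<^bsub>B\<^esub> (?h \<odot>\<^bsub>B\<^esub> g i \<oplus>\<^bsub>B\<^esub> \<one>\<^bsub>B\<^esub>)"
    have xI: "x \<in> hecke_ideal q p"
      unfolding x_def hecke_ideal_eq using subsetD[OF B.genideal_self[OF hecke_relators_closed]] i by blast
    have "g' i \<otimes>\<^bsub>B\<^esub> x = g i \<oplus>\<^bsub>B\<^esub> (- ?h) \<odot>\<^bsub>B\<^esub> \<one>\<^bsub>B\<^esub> \<oplus>\<^bsub>B\<^esub> (- 1) \<odot>\<^bsub>B\<^esub> g' i"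
    proof -
      have "g' i \<otimes>\<^bsub>B\<^esub> (g i \<otimes>\<^bsub>B\<^esub> g i) = g i"
        using gen_props(4)[OF i] by (simp add: B.m_assoc[symmetric])
      then show ?thesis
        using gen_props(4)[OF i] by (simp add: x_def B.minus_eq_smult B.expand)
    qed
    moreover have "(inverse q - q) / ?h = - 1"
      using h_nonzero by (simp add: divide_eq_eq)
    ultimately have "\<kappa> i = (- (1 / ?h)) \<odot>\<^bsub>B\<^esub> (g' i \<otimes>\<^bsub>B\<^esub> x)"
      using h_nonzero
      by (simp add: kappa_def inv_gen[OF i] B.minus_eq_smult B.smult_add_right B.smult_smult B.a_ac)
    moreover have "g' i \<otimes>\<^bsub>B\<^esub> x \<in> hecke_ideal q p"
      by (rule ideal.I_l_closed[OF H.ideal xI]) simp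
    ultimately show ?thesis using B.ideal_smult_closed[OF H.ideal] by simp
  qed
  have minus: "x \<ominus>\<^bsub>B\<^esub> c \<odot>\<^bsub>B\<^esub> y \<in> hecke_ideal q p"
    if "x \<in> hecke_ideal q p" "y \<in> hecke_ideal q p" for x y c
    using that B.ideal_smult_closed[OF H.ideal] ideal.Icarr[OF H.ideal]
      additive_subgroup.a_closed[OF ideal.axioms(1)[OF H.ideal]]
    by (simp add: B.minus_eq_smult)
  have "bmw_relations H.Q (\<lambda>i. H.proj (g i)) (\<lambda>i. H.proj (g' i)) (\<lambda>i. H.proj (\<kappa> i)) q 1 n"
  proof (rule H.bmw_relations_quotient)
    fix i assume i: "i \<in> {1..n}"
    show "\<kappa> i \<otimes>\<^bsub>B\<^esub> g i \<ominus>\<^bsub>B\<^esub> 1 \<odot>\<^bsub>B\<^esub> \<kappa> i \<in> hecke_ideal q p"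
      "g i \<otimes>\<^bsub>B\<^esub> \<kappa> i \<ominus>\<^bsub>B\<^esub> 1 \<odot>\<^bsub>B\<^esub> \<kappa> i \<in> hecke_ideal q p"
      using ideal.I_l_closed[OF H.ideal kI[OF i] gen_props(1)[OF i]]
        ideal.I_r_closed[OF H.ideal kI[OF i] gen_props(1)[OF i]] kI[OF i]
      by (auto intro: minus)
  next
    fix i assume "i \<in> {2..n}"
    then have i: "i \<in> {1..n}" "i - 1 \<in> {1..n}" by auto
    show "\<kappa> i \<otimes>\<^bsub>B\<^esub> g (i - 1) \<otimes>\<^bsub>B\<^esub> \<kappa> i \<ominus>\<^bsub>B\<^esub> inverse 1 \<odot>\<^bsub>B\<^esub> \<kappa> i \<in> hecke_ideal q p"
      "\<kappa> i \<otimes>\<^bsub>B\<^esub> inv\<^bsub>B\<^esub> g (i - 1) \<otimes>\<^bsub>B\<^esub> \<kappa> i \<ominus>\<^bsub>B\<^esub> 1 \<odot>\<^bsub>B\<^esub> \<kappa> i \<in> hecke_ideal q p"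
      unfolding inv_gen[OF i(2)]
      by (rule minus[OF ideal.I_l_closed[OF H.ideal kI[OF i(1)]] kI[OF i(1)]],
          rule B.m_closed[OF kappa_closed[OF i(1)]], rule gen_props[OF i(2)])+
  qed (use kI in blast)
  note rel = this
  interpret G: bmw_generated H.Q "\<lambda>i. H.proj (g i)" "\<lambda>i. H.proj (g' i)" "\<lambda>i. H.proj (\<kappa> i)" q 1 n
    by (rule H.bmw_generated_quotient[OF rel])
  \<comment> \<open>Substituting \<sigma>^{-1} = \<sigma> - (q - q^{-1}) turns the Hecke form of
    \<sigma>_i(x) into the Birman--Murakami--Wenzl form with \<kappa>_i = 0.\<close>
  have bax: "hecke_baxter q p i x = G.bax i x" if i: "i \<in> {1..n}" and x: "x \<noteq> 0" for i x
  proof -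
    have k0: "H.proj (\<kappa> i) = \<zero>\<^bsub>H.Q\<^esub>"
      using B.quotient_zero_iff[OF H.ideal kappa_closed[OF i]] kI[OF i] by blast
    define \<sigma> \<tau> where st: "\<sigma> = H.proj (g i)" "\<tau> = H.proj (g' i)"
    have cl: "\<sigma> \<in> carrier H.Q" using G.s_closed[OF i] by (simp only: st)
    have tau: "\<tau> = \<sigma> \<oplus>\<^bsub>H.Q\<^esub> (- ?h) \<odot>\<^bsub>H.Q\<^esub> \<one>\<^bsub>H.Q\<^esub>"
      using G.skein[OF i] cl unfolding k0 st[symmetric]
      by (simp only: H.proj.B.smult_zero_right H.proj.B.r_zero H.proj.B.add.m_closed H.proj.B.smult_closed H.proj.B.one_closed)
    have "hecke_baxter q p i x = (1 / ?h) \<odot>\<^bsub>H.Q\<^esub> (x \<odot>\<^bsub>H.Q\<^esub> \<sigma> \<ominus>\<^bsub>H.Q\<^esub> inverse x \<odot>\<^bsub>H.Q\<^esub> \<tau>)"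
      unfolding hecke_baxter_def Let_def Q[symmetric] s[symmetric] H.inv_proj_gen[OF i] st ..
    also have "\<dots> = (1 / ?h * x) \<odot>\<^bsub>H.Q\<^esub> \<sigma> \<oplus>\<^bsub>H.Q\<^esub> ((1 / ?h * (- 1 * inverse x)) \<odot>\<^bsub>H.Q\<^esub> \<sigma>
        \<oplus>\<^bsub>H.Q\<^esub> (1 / ?h * (- 1 * (inverse x * - ?h))) \<odot>\<^bsub>H.Q\<^esub> \<one>\<^bsub>H.Q\<^esub>)"
      unfolding tau using cl
      by (simp only: H.proj.B.minus_eq_smult H.proj.B.smult_add_right H.proj.B.smult_smult H.proj.B.smult_closed H.proj.B.one_closed
          H.proj.B.add.m_closed)
    also have "\<dots> = (1 / ?h * x + 1 / ?h * (- 1 * inverse x)) \<odot>\<^bsub>H.Q\<^esub> \<sigma> \<oplus>\<^bsub>H.Q\<^esub> inverse x \<odot>\<^bsub>H.Q\<^esub> \<one>\<^bsub>H.Q\<^esub>"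
    proof -
      have "1 / ?h * (- 1 * (inverse x * - ?h)) = inverse x"
        using h_nonzero by (simp del: minus_diff_eq)
      then show ?thesis using cl
        by (simp only: H.proj.B.smult_add_left H.proj.B.a_assoc H.proj.B.smult_closed H.proj.B.one_closed)
    qed
    also have "1 / ?h * x + 1 / ?h * (- 1 * inverse x) = inverse x * ((x\<^sup>2 - 1) / ?h)"
    proof -
      have "inverse x * (x\<^sup>2 - 1) = x - inverse x" using x by (simp add: field_simps power2_eq_square)
      then have "inverse x * ((x\<^sup>2 - 1) / ?h) = (x - inverse x) / ?h"
        by (metis times_divide_eq_right)
      then show ?thesis by (simp add: diff_divide_distrib)
    qed
    also have "(inverse x * ((x\<^sup>2 - 1) / ?h)) \<odot>\<^bsub>H.Q\<^esub> \<sigma> \<oplus>\<^bsub>H.Q\<^esub> inverse x \<odot>\<^bsub>H.Q\<^esub> \<one>\<^bsub>H.Q\<^esub> = G.bax i x"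
      unfolding G.bax_def k0 st[symmetric] using cl
      by (simp only: H.proj.B.smult_zero_right H.proj.B.r_zero H.proj.B.add.m_closed H.proj.B.smult_closed H.proj.B.one_closed
          H.proj.B.smult_add_right H.proj.B.smult_smult H.proj.B.a_comm[of "inverse x \<odot>\<^bsub>H.Q\<^esub> \<one>\<^bsub>H.Q\<^esub>"])
    finally show ?thesis .
  qed
  have "G.Y = shuffle (hecke_algebra q p) (hecke_baxter q p) q n"
    unfolding G.Y_def shuffle_def Q[symmetric]
  proof (rule foldr_cong)
    fix y i assume "i \<in> set [1..<n + 1]"
    then have "i \<in> {1..n}" by auto
    from bax[OF this, of "q ^ i"] q_nonzero
    show "G.bax i (q ^ i) \<otimes>\<^bsub>H.Q\<^esub> y = hecke_baxter q p i (q ^ i) \<otimes>\<^bsub>H.Q\<^esub> y" by simp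
  qed simp_all
  then show ?thesis
    using that[of "\<lambda>i. H.proj (g' i)" "\<lambda>i. H.proj (\<kappa> i)"] G.bmw_generated_axioms
    unfolding Q s bmw_generated_def by blast
qed

lemma (in braid_parameters) bmw_generated_bmw:
  assumes nu: "\<nu> \<noteq> 0" and nondeg: "\<forall>j\<in>{1..n}. \<nu> \<noteq> q ^ (2 * j - 1)"
  obtains t k where "bmw_generated (bmw_algebra q \<nu> p) (bmw_sigma q \<nu> p) t k q \<nu> n"
    "bmw_relations.Y (bmw_algebra q \<nu> p) (bmw_sigma q \<nu> p) k q \<nu> n =
      shuffle (bmw_algebra q \<nu> p) (bmw_baxter q \<nu> p) q n"
proof -
  define R where "R =
      ({\<kappa> i \<otimes>\<^bsub>B\<^esub> g i \<ominus>\<^bsub>B\<^esub> \<nu> \<odot>\<^bsub>B\<^esub> \<kappa> i | i. i \<in> {1..n}} \<union>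
       {g i \<otimes>\<^bsub>B\<^esub> \<kappa> i \<ominus>\<^bsub>B\<^esub> \<nu> \<odot>\<^bsub>B\<^esub> \<kappa> i | i. i \<in> {1..n}} \<union>
       {\<kappa> i \<otimes>\<^bsub>B\<^esub> g (i - 1) \<otimes>\<^bsub>B\<^esub> \<kappa> i \<ominus>\<^bsub>B\<^esub> inverse \<nu> \<odot>\<^bsub>B\<^esub> \<kappa> i | i. i \<in> {2..n}} \<union>
       {\<kappa> i \<otimes>\<^bsub>B\<^esub> inv\<^bsub>B\<^esub> (g (i - 1)) \<otimes>\<^bsub>B\<^esub> \<kappa> i \<ominus>\<^bsub>B\<^esub> \<nu> \<odot>\<^bsub>B\<^esub> \<kappa> i | i. i \<in> {2..n}})"
  have I: "bmw_ideal q \<nu> p = Idl\<^bsub>B\<^esub> R"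
    unfolding bmw_ideal_def Let_def R_def braid_gens_index[OF p_eq] ..
  \<comment> \<open>The common shape of the four kinds of relators: \<open>z\<close> is
    \<open>\<kappa> i\<close>, and so is at least one of \<open>x\<close> and \<open>y\<close>, with
    triple products bracketed to the left.\<close>
  have diff: "x \<otimes>\<^bsub>B\<^esub> y \<ominus>\<^bsub>B\<^esub> c \<odot>\<^bsub>B\<^esub> z \<in> carrier B \<and> burau_rep q (x \<otimes>\<^bsub>B\<^esub> y \<ominus>\<^bsub>B\<^esub> c \<odot>\<^bsub>B\<^esub> z) = (\<lambda>v j. 0)"
    if "x \<in> carrier B" "y \<in> carrier B" "z \<in> carrier B" "burau_rep q z = (\<lambda>v j. 0)"
      "burau_rep q x = (\<lambda>v j. 0) \<or> burau_rep q y = (\<lambda>v j. 0)" for x y z c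
  proof -
    have "burau_rep q x (\<lambda>j. 0) = (\<lambda>j. 0)"
      using seq_linearD(2)[of "burau_rep q x" 0 "\<lambda>j. 0"] rep.closed[OF that(1)] by simp
    then show ?thesis
      using that by (auto simp: B.minus_eq_smult rep.add rep.smult rep.mult)
  qed
  have R: "x \<in> carrier B \<and> burau_rep q x = (\<lambda>v j. 0)" if "x \<in> R" for x
  proof -
    note kb = kappa_closed burau_kappa
    from that consider i where "i \<in> {1..n}" "x = \<kappa> i \<otimes>\<^bsub>B\<^esub> g i \<ominus>\<^bsub>B\<^esub> \<nu> \<odot>\<^bsub>B\<^esub> \<kappa> i"
      | i where "i \<in> {1..n}" "x = g i \<otimes>\<^bsub>B\<^esub> \<kappa> i \<ominus>\<^bsub>B\<^esub> \<nu> \<odot>\<^bsub>B\<^esub> \<kappa> i"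
      | i where "i \<in> {2..n}" "x = \<kappa> i \<otimes>\<^bsub>B\<^esub> g (i - 1) \<otimes>\<^bsub>B\<^esub> \<kappa> i \<ominus>\<^bsub>B\<^esub> inverse \<nu> \<odot>\<^bsub>B\<^esub> \<kappa> i"
      | i where "i \<in> {2..n}" "x = \<kappa> i \<otimes>\<^bsub>B\<^esub> inv\<^bsub>B\<^esub> (g (i - 1)) \<otimes>\<^bsub>B\<^esub> \<kappa> i \<ominus>\<^bsub>B\<^esub> \<nu> \<odot>\<^bsub>B\<^esub> \<kappa> i"
      unfolding R_def by blast
    then show ?thesis
    proof cases
      case 1
      show ?thesis unfolding 1(2) by (rule diff) (use 1(1) kb gen_props(1) in auto)
    next
      case 2
      show ?thesis unfolding 2(2) by (rule diff) (use 2(1) kb gen_props(1) in auto)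
    next
      case 3
      then have i: "i \<in> {1..n}" "i - 1 \<in> {1..n}" by auto
      show ?thesis unfolding 3(2)
        by (rule diff) (use kb[OF i(1)] gen_props(1)[OF i(2)] in auto)
    next
      case 4
      then have i: "i \<in> {1..n}" "i - 1 \<in> {1..n}" by auto
      show ?thesis unfolding 4(2) inv_gen[OF i(2)]
        by (rule diff) (use kb[OF i(1)] gen_props(2)[OF i(2)] in auto)
    qed
  qed
  have RB: "R \<subseteq> carrier B" using R by blast
  interpret H: braid_quotient q n p \<nu> "bmw_ideal q \<nu> p"
    unfolding I by (rule braid_quotient_genideal[OF nu RB]) (use R in blast)
  have Q: "H.Q = bmw_algebra q \<nu> p" by (simp add: bmw_algebra_def)
  have s: "(\<lambda>i. H.proj (g i)) = bmw_sigma q \<nu> p" by (simp add: bmw_sigma_def fun_eq_iff)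
  have RI: "R \<subseteq> bmw_ideal q \<nu> p" unfolding I by (rule B.genideal_self[OF RB])
  have rel: "bmw_relations H.Q (\<lambda>i. H.proj (g i)) (\<lambda>i. H.proj (g' i)) (\<lambda>i. H.proj (\<kappa> i)) q \<nu> n"
    by (rule H.bmw_relations_quotient; (rule subsetD[OF RI])?) (use nondeg in \<open>unfold R_def, blast+\<close>)
  interpret G: bmw_generated H.Q "\<lambda>i. H.proj (g i)" "\<lambda>i. H.proj (g' i)" "\<lambda>i. H.proj (\<kappa> i)" q \<nu> n
    by (rule H.bmw_generated_quotient[OF rel])
  have "G.Y = shuffle (bmw_algebra q \<nu> p) (bmw_baxter q \<nu> p) q n"
    unfolding G.Y_def shuffle_def Q[symmetric]
  proof (rule foldr_cong)
    fix y i assume "i \<in> set [1..<n + 1]"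
    then have "i \<in> {1..n}" by auto
    then have "G.bax i (q ^ i) = bmw_baxter q \<nu> p i (q ^ i)"
      unfolding G.bax_def bmw_baxter_def Let_def Q[symmetric] s[symmetric] by (simp only: H.proj_kappa)
    then show "G.bax i (q ^ i) \<otimes>\<^bsub>H.Q\<^esub> y = bmw_baxter q \<nu> p i (q ^ i) \<otimes>\<^bsub>H.Q\<^esub> y" by simp
  qed simp_all
  then show ?thesis
    using that[of "\<lambda>i. H.proj (g' i)" "\<lambda>i. H.proj (\<kappa> i)"] G.bmw_generated_axioms
    unfolding Q s bmw_generated_def by blast
qed

lemma (in bmw_generated) shuffle_theorem:
  "(Y [^] n) \<otimes> (Y \<ominus> qfact q (n + 1) \<odot> \<one>) = \<zero>
    \<and> is_minimal_poly A Y ([:0, 1:] ^ n * ([:0, 1:] - [:qfact q (n + 1):]))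
    \<and> (n > 1 \<longrightarrow> \<not> semisimple_element A Y)
    \<and> is_semisimple_part A Y (qfact q (n + 1) \<odot> symmetrizer A s q n)
    \<and> eigenvalue_multiplicity A (\<lambda>x. Y \<otimes> x) (qfact q (n + 1)) = 1"
  using shuffle_annihilated shuffle_minimal_poly shuffle_not_semisimple shuffle_semisimple_part
    shuffle_multiplicity
  unfolding symmetrizer_eq N_def by blast

theorem mainTheorem7:
  fixes n :: nat and q \<nu> :: "'k::field"
    and A :: "('k, (braid \<Rightarrow>\<^sub>0 'k) set) module"
    and \<sigma> :: "nat \<Rightarrow> (braid \<Rightarrow>\<^sub>0 'k) set"
    and Sh :: "(braid \<Rightarrow>\<^sub>0 'k) set"
  assumes "n \<ge> 1" and "q \<noteq> 0" and "q\<^sup>2 \<noteq> 1"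
    and "\<forall>k\<in>{2..n + 1}. qnum q k \<noteq> 0"
    and "A = hecke_algebra q (n + 1) \<and> \<sigma> = hecke_sigma q (n + 1) \<and> Sh = hecke_shuffle q n
       \<or> A = bmw_algebra q \<nu> (n + 1) \<and> \<sigma> = bmw_sigma q \<nu> (n + 1) \<and> Sh = bmw_shuffle q \<nu> n
          \<and> \<nu> \<notin> {0, q, - inverse q} \<and> (\<forall>j\<in>{1..n}. \<nu> \<noteq> q ^ (2 * j - 1))"
  shows "(Sh [^]\<^bsub>A\<^esub> n) \<otimes>\<^bsub>A\<^esub> (Sh \<ominus>\<^bsub>A\<^esub> qfact q (n + 1) \<odot>\<^bsub>A\<^esub> \<one>\<^bsub>A\<^esub>) = \<zero>\<^bsub>A\<^esub>
    \<and> is_minimal_poly A Sh ([:0, 1:] ^ n * ([:0, 1:] - [:qfact q (n + 1):]))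
    \<and> is_minimal_poly (hecke_algebra q (n + 1)) (hecke_shuffle q n)
        ([:0, 1:] ^ n * ([:0, 1:] - [:qfact q (n + 1):]))
    \<and> (n > 1 \<longrightarrow> \<not> semisimple_element A Sh)
    \<and> is_semisimple_part A Sh (qfact q (n + 1) \<odot>\<^bsub>A\<^esub> symmetrizer A \<sigma> q n)
    \<and> eigenvalue_multiplicity (hecke_algebra q (n + 1))
        (\<lambda>x. hecke_shuffle q n \<otimes>\<^bsub>hecke_algebra q (n + 1)\<^esub> x) (qfact q (n + 1)) = 1"
proof -
  interpret braid_parameters q n "n + 1"
    by unfold_locales (use assms(1-4) in auto)
  \<comment> \<open>The Hecke facts are collected before the case split, as two clauses of the
    conclusion concern the Hecke algebra in either case.\<close>
  obtain t k where "bmw_generated (hecke_algebra q (n + 1)) (hecke_sigma q (n + 1)) t k q 1 n"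
    "bmw_relations.Y (hecke_algebra q (n + 1)) (hecke_sigma q (n + 1)) k q 1 n = hecke_shuffle q n"
    using bmw_generated_hecke unfolding hecke_shuffle_def by blast
  note hecke = bmw_generated.shuffle_theorem[OF this(1), unfolded this(2)]
  show ?thesis
  proof (cases "A = hecke_algebra q (n + 1) \<and> \<sigma> = hecke_sigma q (n + 1) \<and> Sh = hecke_shuffle q n")
    case True
    then show ?thesis using hecke by blast
  next
    case False
    with assms(5) have A: "A = bmw_algebra q \<nu> (n + 1)" "\<sigma> = bmw_sigma q \<nu> (n + 1)" "Sh = bmw_shuffle q \<nu> n"
      and nu: "\<nu> \<noteq> 0" "\<forall>j\<in>{1..n}. \<nu> \<noteq> q ^ (2 * j - 1)"
      by blast+
    obtain t k where "bmw_generated A \<sigma> t k q \<nu> n" "bmw_relations.Y A \<sigma> k q \<nu> n = Sh"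
      using bmw_generated_bmw[OF nu] unfolding A bmw_shuffle_def by blast
    note bmw = bmw_generated.shuffle_theorem[OF this(1), unfolded this(2)]
    show ?thesis using bmw hecke by blast
  qed
qed

end
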